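(* Let $n\in\mathbb{N}$, let $G_n$ denote the Houghton group acting on $\Omega_n=\mathbb{N}\times\{1,\ldots,n\}$, let $H_n$ denote the stabilizer subgroup in $G_n$ of a point of $\Omega_n$, and let $\Lambda$ be an ICC amenable group. Then $L(\Lambda\wr_{G_n}H_n)<L(\Lambda\wr G_n)$ is an infinite index inclusion of amenable factors such that the smaller factor is a maximal von Neumann subalgebra of the larger one.
   Context: For $n\ge1$, regard $\Omega_n=\mathbb{N}\times\{1,\ldots,n\}$ as the disjoint union of copies $\mathbb{N}_1,\ldots,\mathbb{N}_n$ of $\mathbb{N}$. The Houghton group $G_n$ is the group of all permutations $\sigma$ of $\Omega_n$ such that for each $i\in\{1,\ldots,n\}$ the set $\sigma(\mathbb{N}_i)\Delta\mathbb{N}_i$ is finite and $\sigma$ is eventually a translation on $\mathbb{N}_i$, i.e. there exist $(m_1,\ldots,m_n)\in\mathbb{Z}^n$ and a finite set $K_\sigma\subseteq\Omega_n$ with $\sigma(k,i)=(k+m_i,i)$ for all $(k,i)\in\Omega_n\setminus K_\sigma$. ICC means infinite conjugacy classes; $L(\Gamma)$ is the group von Neumann algebra; $\Lambda^{\oplus G}$ is the direct sum of copies of $\Lambda$ indexed by $G$ with the shift action of $G$; $\Lambda\wr G=\Lambda^{\oplus G}\rtimes G$ and, for $H<G$, $\Lambda\wr_G H=\Lambda^{\oplus G}\rtimes H$. Index means Jones index. A von Neumann subalgebra $\mathsf{N}$ of $\mathsf{M}$ is maximal if any von Neumann subalgebra $\mathsf{P}$ of $\mathsf{M}$ with $\mathsf{N}\subseteq\mathsf{P}$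 equals $\mathsf{N}$ or $\mathsf{M}$. Inclusions are unital. *)

theory Defs
  imports
    "HOL-Analysis.Analysis"
    "HOL-Algebra.Group_Action"
    "HOL-Algebra.Product_Groups"
begin

section \<open>Groups\<close>

definition Omega :: "nat \<Rightarrow> (nat \<times> nat) set"
  where "Omega n = UNIV \<times> {1..n}"

definition eventual_translation :: "nat \<Rightarrow> (nat \<times> nat \<Rightarrow> nat \<times> nat) \<Rightarrow> bool"
  where "eventual_translation n \<sigma> \<longleftrightarrow>
    (\<exists>(m :: nat \<Rightarrow> int) K. finite K \<and> K \<subseteq> Omega n \<and>
      (\<forall>k i. (k, i) \<in> Omega n - K \<longrightarrow>
         snd (\<sigma> (k, i)) = i \<and> int (fst (\<sigma> (k, i))) = int k + m i))"

text \<open>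
  \<^term>\<open>(permutes)\<close> makes a permutation of \<^term>\<open>Omega n\<close> the identity off \<^term>\<open>Omega n\<close>,
  so that equal permutations are equal functions.
\<close>

definition houghton_group :: "nat \<Rightarrow> (nat \<times> nat \<Rightarrow> nat \<times> nat) monoid"
  where "houghton_group n =
    \<lparr>carrier = {\<sigma>. \<sigma> permutes Omega n \<and>
       (\<forall>i\<in>{1..n}. finite (sym_diff (\<sigma> ` (UNIV \<times> {i})) (UNIV \<times> {i}))) \<and>
       eventual_translation n \<sigma>},
     mult = (\<circ>), one = id\<rparr>"

text \<open>Following the usual convention, an ICC group is in particular infinite.\<close>

definition icc_group :: "('g, 'x) monoid_scheme \<Rightarrow> bool"
  where "icc_group G \<longleftrightarrow> group G \<and> infinite (carrier G) \<and>
    (\<forall>g\<in>carrier G. g \<noteq> \<one>\<^bsub>G\<^esub> \<longrightarrow>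
       infinite {h \<otimes>\<^bsub>G\<^esub> g \<otimes>\<^bsub>G\<^esub> inv\<^bsub>G\<^esub> h | h. h \<in> carrier G})"

text \<open>
  A left invariant mean on the bounded real functions on the group. Positivity is tested on the
  carrier only, so the value of the mean depends only on the restriction to the carrier.
\<close>

definition left_invariant_mean ::
    "('g, 'x) monoid_scheme \<Rightarrow> (('g \<Rightarrow> real) \<Rightarrow> real) \<Rightarrow> bool"
  where "left_invariant_mean G m \<longleftrightarrow>
    (\<forall>u v. bounded (u ` carrier G) \<longrightarrow> bounded (v ` carrier G) \<longrightarrow>
       m (\<lambda>x. u x + v x) = m u + m v) \<and>
    (\<forall>c u. bounded (u ` carrier G) \<longrightarrow> m (\<lambda>x. c * u x) = c * m u) \<and>
    (\<forall>u. bounded (u ` carrier G) \<longrightarrow> (\<forall>x\<in>carrier G. 0 \<le> u x) \<longrightarrow> 0 \<le> m u) \<and>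
    m (\<lambda>x. 1) = 1 \<and>
    (\<forall>g\<in>carrier G. \<forall>u. bounded (u ` carrier G) \<longrightarrow> m (\<lambda>x. u (g \<otimes>\<^bsub>G\<^esub> x)) = m u)"

definition amenable_group :: "('g, 'x) monoid_scheme \<Rightarrow> bool"
  where "amenable_group G \<longleftrightarrow> group G \<and> (\<exists>m. left_invariant_mean G m)"

definition semidirect_product ::
    "('a, 'x) monoid_scheme \<Rightarrow> ('g, 'y) monoid_scheme \<Rightarrow> ('g \<Rightarrow> 'a \<Rightarrow> 'a) \<Rightarrow> ('a \<times> 'g) monoid"
  where "semidirect_product A G \<alpha> =
    \<lparr>carrier = carrier A \<times> carrier G,
     mult = (\<lambda>(x, g) (y, h). (x \<otimes>\<^bsub>A\<^esub> \<alpha> g y, g \<otimes>\<^bsub>G\<^esub> h)),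
     one = (\<one>\<^bsub>A\<^esub>, \<one>\<^bsub>G\<^esub>)\<rparr>"

definition shift_action ::
    "('g, 'x) monoid_scheme \<Rightarrow> 'g \<Rightarrow> ('g \<Rightarrow> 'l) \<Rightarrow> ('g \<Rightarrow> 'l)"
  where "shift_action G g x = (\<lambda>k\<in>carrier G. x (inv\<^bsub>G\<^esub> g \<otimes>\<^bsub>G\<^esub> k))"

definition partial_wreath ::
    "('l, 'x) monoid_scheme \<Rightarrow> ('g, 'y) monoid_scheme \<Rightarrow> 'g set \<Rightarrow> (('g \<Rightarrow> 'l) \<times> 'g) monoid"
  where "partial_wreath L G H =
    semidirect_product (sum_group (carrier G) (\<lambda>_. L)) (G\<lparr>carrier := H\<rparr>) (shift_action G)"

definition wreath ::
    "('l, 'x) monoid_scheme \<Rightarrow> ('g, 'y) monoid_scheme \<Rightarrow> (('g \<Rightarrow> 'l) \<times> 'g) monoid"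
  where "wreath L G = semidirect_product (sum_group (carrier G) (\<lambda>_. L)) G (shift_action G)"


section \<open>Bounded operators on \<open>\<ell>\<^sup>2(S)\<close>\<close>

text \<open>
  A vector of \<open>\<ell>\<^sup>2(S)\<close> is a square summable function vanishing off \<open>S\<close>. As every complex
  Hilbert space is some \<open>\<ell>\<^sup>2(S)\<close>, the notions below cover von Neumann algebras on arbitrary
  Hilbert spaces. Operators are extensional on \<^term>\<open>ell2 S\<close>, so that operators
  that agree on \<open>\<ell>\<^sup>2(S)\<close> are equal; their composition is \<^const>\<open>compose\<close>.
\<close>

type_synonym 'a vec = "'a \<Rightarrow> complex"
type_synonym 'a oper = "'a vec \<Rightarrow> 'a vec"

definition ell2 :: "'a set \<Rightarrow> 'a vec set"
  where "ell2 S = {u. (\<forall>x. x \<notin> S \<longrightarrow> u x = 0) \<and> (\<lambda>x. (cmod (u x))\<^sup>2) summable_on S}"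

definition ell2_inner :: "'a set \<Rightarrow> 'a vec \<Rightarrow> 'a vec \<Rightarrow> complex"
  where "ell2_inner S u v = (\<Sum>\<^sub>\<infinity>x\<in>S. u x * cnj (v x))"

definition ell2_norm :: "'a set \<Rightarrow> 'a vec \<Rightarrow> real"
  where "ell2_norm S u = sqrt (\<Sum>\<^sub>\<infinity>x\<in>S. (cmod (u x))\<^sup>2)"

definition bounded_ops :: "'a set \<Rightarrow> 'a oper set"
  where "bounded_ops S = {T \<in> ell2 S \<rightarrow>\<^sub>E ell2 S.
    (\<forall>u\<in>ell2 S. \<forall>v\<in>ell2 S. T (\<lambda>x. u x + v x) = (\<lambda>x. T u x + T v x)) \<and>
    (\<forall>c. \<forall>u\<in>ell2 S. T (\<lambda>x. c * u x) = (\<lambda>x. c * T u x)) \<and>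
    (\<exists>C. \<forall>u\<in>ell2 S. ell2_norm S (T u) \<le> C * ell2_norm S u)}"

definition op_id :: "'a set \<Rightarrow> 'a oper"
  where "op_id S = (\<lambda>u\<in>ell2 S. u)"

definition op_add :: "'a set \<Rightarrow> 'a oper \<Rightarrow> 'a oper \<Rightarrow> 'a oper"
  where "op_add S A B = (\<lambda>u\<in>ell2 S. (\<lambda>x. A u x + B u x))"

definition op_scale :: "'a set \<Rightarrow> complex \<Rightarrow> 'a oper \<Rightarrow> 'a oper"
  where "op_scale S c A = (\<lambda>u\<in>ell2 S. (\<lambda>x. c * A u x))"

abbreviation op_mult :: "'a set \<Rightarrow> 'a oper \<Rightarrow> 'a oper \<Rightarrow> 'a oper"
  where "op_mult S \<equiv> compose (ell2 S)"

definition op_adj :: "'a set \<Rightarrow> 'a oper \<Rightarrow> 'a oper"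
  where "op_adj S T = (THE A. A \<in> bounded_ops S \<and>
    (\<forall>u\<in>ell2 S. \<forall>v\<in>ell2 S. ell2_inner S (T u) v = ell2_inner S u (A v)))"

definition op_positive :: "'a set \<Rightarrow> 'a oper \<Rightarrow> bool"
  where "op_positive S T \<longleftrightarrow> T \<in> bounded_ops S \<and>
    (\<forall>u\<in>ell2 S. ell2_inner S (T u) u \<in> \<real>\<^sub>\<ge>\<^sub>0)"

definition op_projection :: "'a set \<Rightarrow> 'a oper \<Rightarrow> bool"
  where "op_projection S P \<longleftrightarrow> P \<in> bounded_ops S \<and> op_adj S P = P \<and> op_mult S P P = P"

definition ell2_closure :: "'a set \<Rightarrow> 'a vec set \<Rightarrow> 'a vec set"
  where "ell2_closure S V = {u \<in> ell2 S. \<forall>\<epsilon>>0. \<exists>v\<in>V. ell2_norm S (\<lambda>x. u x - v x) < \<epsilon>}"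


section \<open>Von Neumann algebras\<close>

definition commutant :: "'a set \<Rightarrow> 'a oper set \<Rightarrow> 'a oper set"
  where "commutant S M = {T \<in> bounded_ops S. \<forall>A\<in>M. op_mult S T A = op_mult S A T}"

text \<open>
  A self-adjoint set of operators that equals its bicommutant. It is then automatically a
  subalgebra containing the identity operator, so all inclusions of von Neumann algebras on
  \<open>\<ell>\<^sup>2(S)\<close> are unital.
\<close>

definition von_neumann_algebra :: "'a set \<Rightarrow> 'a oper set \<Rightarrow> bool"
  where "von_neumann_algebra S M \<longleftrightarrow> M \<subseteq> bounded_ops S \<and>
    (\<forall>T\<in>M. op_adj S T \<in> M) \<and> commutant S (commutant S M) = M"

definition vn_factor :: "'a set \<Rightarrow> 'a oper set \<Rightarrow> bool"
  where "vn_factor S M \<longleftrightarrow> von_neumann_algebra S M \<and>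
    M \<inter> commutant S M = {op_scale S c (op_id S) | c. True}"

definition maximal_vn_subalgebra :: "'a set \<Rightarrow> 'a oper set \<Rightarrow> 'a oper set \<Rightarrow> bool"
  where "maximal_vn_subalgebra S N M \<longleftrightarrow>
    von_neumann_algebra S N \<and> von_neumann_algebra S M \<and> N \<subseteq> M \<and>
    (\<forall>P. von_neumann_algebra S P \<and> N \<subseteq> P \<and> P \<subseteq> M \<longrightarrow> P = N \<or> P = M)"

definition conditional_expectation :: "'a set \<Rightarrow> 'a oper set \<Rightarrow> ('a oper \<Rightarrow> 'a oper) \<Rightarrow> bool"
  where "conditional_expectation S M E \<longleftrightarrow>
    (\<forall>T\<in>bounded_ops S. E T \<in> M) \<and>
    (\<forall>T\<in>bounded_ops S. \<forall>R\<in>bounded_ops S. E (op_add S T R) = op_add S (E T) (E R)) \<and>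
    (\<forall>c. \<forall>T\<in>bounded_ops S. E (op_scale S c T) = op_scale S c (E T)) \<and>
    (\<forall>T. op_positive S T \<longrightarrow> op_positive S (E T)) \<and>
    (\<forall>A\<in>M. E A = A) \<and>
    (\<forall>A\<in>M. \<forall>B\<in>M. \<forall>T\<in>bounded_ops S.
       E (op_mult S A (op_mult S T B)) = op_mult S A (op_mult S (E T) B))"

text \<open>
  Amenability: there is a (not necessarily normal) conditional expectation of \<open>B(\<ell>\<^sup>2(S))\<close>
  onto \<open>M\<close>. This does not depend on the Hilbert space on which \<open>M\<close> is represented.
\<close>

definition amenable_vn :: "'a set \<Rightarrow> 'a oper set \<Rightarrow> bool"
  where "amenable_vn S M \<longleftrightarrow> von_neumann_algebra S M \<and> (\<exists>E. conditional_expectation S M E)"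


section \<open>Jones index\<close>

definition finite_vn :: "'a set \<Rightarrow> 'a oper set \<Rightarrow> bool"
  where "finite_vn S M \<longleftrightarrow> von_neumann_algebra S M \<and>
    (\<forall>V\<in>M. op_mult S (op_adj S V) V = op_id S \<longrightarrow> op_mult S V (op_adj S V) = op_id S)"

definition faithful_tracial_state :: "'a set \<Rightarrow> 'a oper set \<Rightarrow> ('a oper \<Rightarrow> complex) \<Rightarrow> bool"
  where "faithful_tracial_state S M \<tau> \<longleftrightarrow>
    (\<forall>A\<in>M. \<forall>B\<in>M. \<tau> (op_add S A B) = \<tau> A + \<tau> B) \<and>
    (\<forall>c. \<forall>A\<in>M. \<tau> (op_scale S c A) = c * \<tau> A) \<and>
    \<tau> (op_id S) = 1 \<and>
    (\<forall>A\<in>M. \<tau> (op_mult S (op_adj S A) A) \<in> \<real>\<^sub>\<ge>\<^sub>0) \<and>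
    (\<forall>A\<in>M. \<tau> (op_mult S (op_adj S A) A) = 0 \<longrightarrow> A = (\<lambda>u\<in>ell2 S. (\<lambda>x. 0))) \<and>
    (\<forall>A\<in>M. \<forall>B\<in>M. \<tau> (op_mult S A B) = \<tau> (op_mult S B A))"

text \<open>
  A finite factor has exactly one tracial state, and it is faithful and normal. The choice
  operator is needed only because the values of a state off \<open>M\<close> are irrelevant.
\<close>

definition factor_trace :: "'a set \<Rightarrow> 'a oper set \<Rightarrow> 'a oper \<Rightarrow> complex"
  where "factor_trace S M = (SOME \<tau>. faithful_tracial_state S M \<tau>)"

text \<open>The orthogonal projection \<open>[M\<xi>]\<close> onto the closure of \<open>M\<xi>\<close>.\<close>

definition cyclic_projection :: "'a set \<Rightarrow> 'a oper set \<Rightarrow> 'a vec \<Rightarrow> 'a oper"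
  where "cyclic_projection S M \<xi> =
    (THE P. op_projection S P \<and> P ` ell2 S = ell2_closure S {T \<xi> | T. T \<in> M})"

text \<open>
  The Murray--von Neumann coupling constant \<open>dim\<^sub>M(\<ell>\<^sup>2(S))\<close> of a finite factor \<open>M\<close> on
  \<open>\<ell>\<^sup>2(S)\<close>: it is \<open>tr\<^sub>M([M'\<xi>]) / tr\<^bsub>M'\<^esub>([M\<xi>])\<close> for any nonzero \<open>\<xi>\<close> (the quotient does
  not depend on \<open>\<xi>\<close>) if \<open>M'\<close> is finite, and \<open>\<infinity>\<close> otherwise.
\<close>

definition coupling_constant :: "'a set \<Rightarrow> 'a oper set \<Rightarrow> ennreal"
  where "coupling_constant S M =
    (if finite_vn S (commutant S M) then
       (let \<xi> = (SOME \<xi>. \<xi> \<in> ell2 S \<and> \<xi> \<noteq> (\<lambda>x. 0)) in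
          ennreal (Re (factor_trace S M (cyclic_projection S (commutant S M) \<xi>))) /
          ennreal (Re (factor_trace S (commutant S M) (cyclic_projection S M \<xi>))))
     else \<infinity>)"

text \<open>
  Jones' definition \<open>[M : N] = dim\<^sub>N(H) / dim\<^sub>M(H)\<close> for finite factors \<open>N \<subseteq> M\<close> on a Hilbert
  space \<open>H\<close> on which \<open>M'\<close> is finite; it does not depend on \<open>H\<close>. For \<open>H = L\<^sup>2(M)\<close>, as is the
  case for a group von Neumann algebra on \<open>\<ell>\<^sup>2\<close> of the group, \<open>dim\<^sub>M(H) = 1\<close>.
\<close>

definition jones_index :: "'a set \<Rightarrow> 'a oper set \<Rightarrow> 'a oper set \<Rightarrow> ennreal"
  where "jones_index S M N = coupling_constant S N / coupling_constant S M"


section \<open>Group von Neumann algebras\<close>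

definition left_regular :: "('g, 'x) monoid_scheme \<Rightarrow> 'g \<Rightarrow> 'g oper"
  where "left_regular G g = (\<lambda>u\<in>ell2 (carrier G).
    (\<lambda>x. if x \<in> carrier G then u (inv\<^bsub>G\<^esub> g \<otimes>\<^bsub>G\<^esub> x) else 0))"

text \<open>
  For a subgroup with carrier \<open>K\<close>, the von Neumann algebra on \<open>\<ell>\<^sup>2(G)\<close> generated by the left
  translations by \<open>K\<close>: this is \<open>L(K)\<close> in its standard inclusion \<open>L(K) \<subseteq> L(G)\<close>.
\<close>

definition subgroup_vn :: "('g, 'x) monoid_scheme \<Rightarrow> 'g set \<Rightarrow> 'g oper set"
  where "subgroup_vn G K =
    commutant (carrier G) (commutant (carrier G) (left_regular G ` K))"

definition group_vn :: "('g, 'x) monoid_scheme \<Rightarrow> 'g oper set"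
  where "group_vn G = subgroup_vn G (carrier G)"

end

theory Submission
  imports Defs
begin

text \<open>
  Write \<open>\<Gamma> = A \<rtimes> G\<close>, where \<open>A\<close> is the direct sum \<open>\<Lambda>\<^bsup>\<oplus>G\<^esup>\<close> and \<open>K = A \<rtimes> H\<close>. As \<open>\<Lambda>\<close> is ICC, every
  nontrivial element of \<open>\<Gamma>\<close> has infinitely many conjugates under \<open>A\<close>, so a square summable function
  on \<open>\<Gamma>\<close> that is invariant under conjugation by \<open>A\<close> is a multiple of \<open>\<delta>\<^sub>1\<close>. This gives factoriality
  at once. If \<open>L(K) \<subseteq> P \<subseteq> L(\<Gamma>)\<close>, it also shows that the projection of \<open>\<delta>\<^sub>g\<close> onto the closure of
  \<open>P\<delta>\<^sub>1\<close> is \<open>\<delta>\<^sub>g\<close> or \<open>0\<close>: either \<open>P\<close> contains the unitary of \<open>g\<close>, or no element of \<open>P\<close> has a Fourier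
  coefficient at \<open>g\<close>. Hence \<open>P\<close> is the algebra of an intermediate subgroup, and \<open>K\<close> is a maximal
  subgroup because \<open>H\<close> is one, \<open>G\<close> being highly transitive. The index is infinite because \<open>H\<close> has
  infinite index. A Houghton group is amenable since its commutators are finitary permutations;
  then \<open>\<Gamma>\<close> is amenable, and averaging over \<open>\<Gamma>\<close> in the right regular representation followed by
  compression to the blocks of the cosets of \<open>K\<close> is a conditional expectation onto \<open>L(K)\<close>.
\<close>

section \<open>Square summable vectors\<close>

text \<open>Everything is reduced to the single vector \<open>ket \<one>\<close>. It is cyclic and
  separating for L(\<Gamma>) and its vector state is a trace, so an element T is the family
  \<open>T (ket \<one>)\<close> of its Fourier coefficients, and questions on operators become
  questions on square summable functions on \<Gamma>. The obstacle is the way back: membership in P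
  means commuting with the commutant of P, whereas projecting only yields a limit of vectors;
  traciality bridges this gap. The subgroup A acts in two roles. It is normal, so that for each g
  its left translations and their g-twisted right counterparts both preserve the closure of
  P\<delta>. And its conjugation orbits are infinite even on elements with a nontrivial component in
  G: such an element moves coordinates, so that conjugation can multiply a coordinate by an
  arbitrary element of \<Lambda>. Means are always taken on the whole group; amenability is proved
  by enlarging the set of translations under which a mean is invariant, which avoids quotient groups
  and restrictions of functions.\<close>

definition ket :: "'a \<Rightarrow> 'a vec"
  where "ket x = (\<lambda>y. if y = x then 1 else 0)"

definition cut :: "'a set \<Rightarrow> 'a vec \<Rightarrow> 'a vec"
  where "cut B u = (\<lambda>x. if x \<in> B then u x else 0)"

lemma ell2_outside: "u \<in> ell2 S \<Longrightarrow> x \<notin> S \<Longrightarrow> u x = 0"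
  by (simp add: ell2_def)

lemma ell2_summable: "u \<in> ell2 S \<Longrightarrow> (\<lambda>x. (cmod (u x))\<^sup>2) summable_on S"
  by (simp add: ell2_def)

lemma ell2_norm_nonneg [simp]: "0 \<le> ell2_norm S u"
  by (simp add: ell2_norm_def infsum_nonneg)

lemma ell2_norm_power2: "(ell2_norm S u)\<^sup>2 = (\<Sum>\<^sub>\<infinity>x\<in>S. (cmod (u x))\<^sup>2)"
  by (simp add: ell2_norm_def infsum_nonneg)

text \<open>One estimate of finite partial sums gives membership and norm bound together. Limits of
  sequences, operators built from forms, composition operators and block compressions all enter
  \<open>ell2\<close> through it.\<close>

lemma ell2_boundI:
  assumes "\<And>x. x \<notin> S \<Longrightarrow> u x = 0" "0 \<le> C"
    and "\<And>F. finite F \<Longrightarrow> F \<subseteq> S \<Longrightarrow> (\<Sum>x\<in>F. (cmod (u x))\<^sup>2) \<le> C\<^sup>2"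
  shows "u \<in> ell2 S" "ell2_norm S u \<le> C"
proof -
  show u: "u \<in> ell2 S"
    using assms nonneg_bounded_partial_sums_imp_summable_on[of S "\<lambda>x. (cmod (u x))\<^sup>2" "C\<^sup>2"]
    by (auto simp: ell2_def intro!: eventually_finite_subsets_at_top_weakI)
  have "(ell2_norm S u)\<^sup>2 \<le> C\<^sup>2"
    unfolding ell2_norm_power2
    by (rule infsum_le_finite_sums[OF ell2_summable[OF u]]) (rule assms(3))
  then show "ell2_norm S u \<le> C" using assms(2) by (rule power2_le_imp_le)
qed

lemma ell2_finite_sum_le:
  assumes "u \<in> ell2 S" "finite F" "F \<subseteq> S"
  shows "(\<Sum>x\<in>F. (cmod (u x))\<^sup>2) \<le> (ell2_norm S u)\<^sup>2"
  unfolding ell2_norm_power2 using assms by (intro finite_sum_le_infsum ell2_summable) auto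

lemma ell2_coord_le:
  assumes "u \<in> ell2 S" shows "cmod (u x) \<le> ell2_norm S u"
proof (cases "x \<in> S")
  case True
  with ell2_finite_sum_le[OF assms, of "{x}"] have "(cmod (u x))\<^sup>2 \<le> (ell2_norm S u)\<^sup>2"
    by simp
  then show ?thesis by (rule power2_le_imp_le) simp
qed (simp add: ell2_outside[OF assms])

lemma ell2_norm_eq_0D:
  assumes "u \<in> ell2 S" "ell2_norm S u = 0" shows "u = (\<lambda>x. 0)"
  using ell2_coord_le[OF assms(1)] assms(2) by (auto simp: fun_eq_iff)

lemma ell2_zero [simp]: "(\<lambda>x. 0) \<in> ell2 S"
  by (simp add: ell2_def)

lemma ell2_norm_zero [simp]: "ell2_norm S (\<lambda>x. 0) = 0"
  by (simp add: ell2_norm_def)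

lemma ell2_scale [intro, simp]:
  assumes "u \<in> ell2 S" shows "(\<lambda>x. c * u x) \<in> ell2 S"
  using assms by (auto simp: ell2_def norm_mult power_mult_distrib intro: summable_on_cmult_right)

lemma ell2_add [intro, simp]:
  assumes "u \<in> ell2 S" "v \<in> ell2 S" shows "(\<lambda>x. u x + v x) \<in> ell2 S"
proof -
  have "(\<lambda>x. 2 * (cmod (u x))\<^sup>2 + 2 * (cmod (v x))\<^sup>2) summable_on S"
    by (intro summable_on_add summable_on_cmult_right ell2_summable assms)
  moreover have "(cmod (u x + v x))\<^sup>2 \<le> 2 * (cmod (u x))\<^sup>2 + 2 * (cmod (v x))\<^sup>2" for x
  proof -
    have "(cmod (u x + v x))\<^sup>2 \<le> (cmod (u x) + cmod (v x))\<^sup>2"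
      by (simp add: norm_triangle_ineq power_mono)
    also have "\<dots> \<le> 2 * (cmod (u x))\<^sup>2 + 2 * (cmod (v x))\<^sup>2"
      using zero_le_power2[of "cmod (u x) - cmod (v x)"] by (simp add: power2_eq_square algebra_simps)
    finally show ?thesis .
  qed
  ultimately have "(\<lambda>x. (cmod (u x + v x))\<^sup>2) summable_on S"
    by (rule summable_on_comparison_test) auto
  then show ?thesis using assms by (simp add: ell2_def)
qed

lemma ell2_diff [intro, simp]:
  assumes "u \<in> ell2 S" "v \<in> ell2 S" shows "(\<lambda>x. u x - v x) \<in> ell2 S"
  using ell2_add[OF assms(1) ell2_scale[OF assms(2), of "-1"]] by simp

lemma ell2_cut [intro, simp]:
  assumes "u \<in> ell2 S" shows "cut B u \<in> ell2 S"
proof -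
  have "(\<lambda>x. (cmod (cut B u x))\<^sup>2) summable_on S"
    by (rule summable_on_comparison_test[OF ell2_summable[OF assms]]) (auto simp: cut_def)
  then show ?thesis using assms by (simp add: ell2_def cut_def)
qed

lemma ell2_finite_support:
  assumes "finite F" "\<And>x. x \<notin> F \<Longrightarrow> u x = 0" "F \<subseteq> S"
  shows "u \<in> ell2 S"
proof -
  have "(\<lambda>x. (cmod (u x))\<^sup>2) summable_on S \<longleftrightarrow> (\<lambda>x. (cmod (u x))\<^sup>2) summable_on F"
    by (rule summable_on_cong_neutral) (use assms in auto)
  then show ?thesis using assms by (auto simp: ell2_def)
qed

lemma ell2_ket [intro, simp]: "x \<in> S \<Longrightarrow> ket x \<in> ell2 S"
  by (rule ell2_finite_support[of "{x}"]) (auto simp: ket_def)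

section \<open>Inner product, Cauchy-Schwarz inequality and norm estimates\<close>

lemma ell2_inner_abs_summable:
  assumes "u \<in> ell2 S" "v \<in> ell2 S"
  shows "(\<lambda>x. norm (u x * cnj (v x))) summable_on S"
proof -
  have "(\<lambda>x. (cmod (u x))\<^sup>2 + (cmod (v x))\<^sup>2) summable_on S"
    by (intro summable_on_add ell2_summable assms)
  then show ?thesis
  proof (rule summable_on_comparison_test)
    fix x
    have "2 * (cmod (u x) * cmod (v x)) \<le> (cmod (u x))\<^sup>2 + (cmod (v x))\<^sup>2"
      using zero_le_power2[of "cmod (u x) - cmod (v x)"] by (simp add: power2_eq_square algebra_simps)
    moreover have "0 \<le> cmod (u x) * cmod (v x)" by simp
    ultimately have "cmod (u x) * cmod (v x) \<le> (cmod (u x))\<^sup>2 + (cmod (v x))\<^sup>2" by linarith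
    then show "norm (u x * cnj (v x)) \<le> (cmod (u x))\<^sup>2 + (cmod (v x))\<^sup>2"
      by (simp add: norm_mult)
  qed auto
qed

lemma ell2_inner_summable:
  assumes "u \<in> ell2 S" "v \<in> ell2 S"
  shows "(\<lambda>x. u x * cnj (v x)) summable_on S"
  using ell2_inner_abs_summable[OF assms] by (rule abs_summable_summable)

lemma ell2_inner_add_left:
  assumes "u \<in> ell2 S" "v \<in> ell2 S" "w \<in> ell2 S"
  shows "ell2_inner S (\<lambda>x. u x + v x) w = ell2_inner S u w + ell2_inner S v w"
  unfolding ell2_inner_def by (simp add: distrib_right infsum_add ell2_inner_summable assms)

lemma ell2_inner_scale_left: "ell2_inner S (\<lambda>x. c * u x) w = c * ell2_inner S u w"
  unfolding ell2_inner_def by (simp add: mult.assoc infsum_cmult_right')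

lemma ell2_inner_commute: "ell2_inner S v u = cnj (ell2_inner S u v)"
  unfolding ell2_inner_def infsum_cnj[symmetric] by (simp add: mult.commute)

lemma ell2_inner_add_right:
  assumes "u \<in> ell2 S" "v \<in> ell2 S" "w \<in> ell2 S"
  shows "ell2_inner S w (\<lambda>x. u x + v x) = ell2_inner S w u + ell2_inner S w v"
  by (subst (1 2 3) ell2_inner_commute) (simp add: ell2_inner_add_left assms)

lemma ell2_inner_scale_right: "ell2_inner S w (\<lambda>x. c * u x) = cnj c * ell2_inner S w u"
  by (subst (1 2) ell2_inner_commute) (simp add: ell2_inner_scale_left)

lemma ell2_inner_diff_left:
  assumes "u \<in> ell2 S" "v \<in> ell2 S" "w \<in> ell2 S"
  shows "ell2_inner S (\<lambda>x. u x - v x) w = ell2_inner S u w - ell2_inner S v w"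
  using ell2_inner_add_left[OF assms(1) ell2_scale[OF assms(2), of "-1"] assms(3)]
    ell2_inner_scale_left[of S "-1" v w] by simp

lemma ell2_inner_diff_right:
  assumes "u \<in> ell2 S" "v \<in> ell2 S" "w \<in> ell2 S"
  shows "ell2_inner S w (\<lambda>x. u x - v x) = ell2_inner S w u - ell2_inner S w v"
  by (subst (1 2 3) ell2_inner_commute) (simp add: ell2_inner_diff_left assms)

lemma ell2_inner_zero [simp]: "ell2_inner S (\<lambda>x. 0) w = 0" "ell2_inner S w (\<lambda>x. 0) = 0"
  by (simp_all add: ell2_inner_def)

lemma ell2_inner_self: "ell2_inner S u u = of_real ((ell2_norm S u)\<^sup>2)"
proof -
  have "ell2_inner S u u = (\<Sum>\<^sub>\<infinity>x\<in>S. of_real ((cmod (u x))\<^sup>2))"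
    unfolding ell2_inner_def by (rule infsum_cong) (simp only: complex_norm_square)
  also have "\<dots> = of_real (\<Sum>\<^sub>\<infinity>x\<in>S. (cmod (u x))\<^sup>2)"
  proof (cases "(\<lambda>x. (cmod (u x))\<^sup>2) summable_on S")
    case True
    then show ?thesis by (metis has_sum_infsum has_sum_of_real infsumI)
  next
    case False
    then have "\<not> (\<lambda>x. complex_of_real ((cmod (u x))\<^sup>2)) summable_on S"
      using summable_on_Re by fastforce
    with False show ?thesis by (simp add: infsum_not_exists)
  qed
  finally show ?thesis by (simp only: ell2_norm_power2)
qed

lemma ell2_inner_ket:
  assumes "x \<in> S" shows "ell2_inner S u (ket x) = u x"
proof -
  have "ell2_inner S u (ket x) = (\<Sum>\<^sub>\<infinity>y\<in>{x}. u y)"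
    unfolding ell2_inner_def by (rule infsum_cong_neutral) (use assms in \<open>auto simp: ket_def\<close>)
  then show ?thesis by simp
qed

lemma ell2_inner_ket_left: "x \<in> S \<Longrightarrow> ell2_inner S (ket x) u = cnj (u x)"
  by (subst ell2_inner_commute) (simp add: ell2_inner_ket)

lemma ell2_norm_scale: "ell2_norm S (\<lambda>x. c * u x) = cmod c * ell2_norm S u"
  unfolding ell2_norm_def
  by (simp add: norm_mult power_mult_distrib infsum_cmult_right' real_sqrt_mult)

lemma ell2_norm_power2_diff:
  assumes "u \<in> ell2 S" "v \<in> ell2 S"
  shows "(ell2_norm S (\<lambda>x. u x - v x))\<^sup>2
    = (ell2_norm S u)\<^sup>2 - 2 * Re (ell2_inner S u v) + (ell2_norm S v)\<^sup>2"
proof -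
  have "complex_of_real ((ell2_norm S (\<lambda>x. u x - v x))\<^sup>2)
      = ell2_inner S u u - ell2_inner S u v - (cnj (ell2_inner S u v) - ell2_inner S v v)"
    unfolding ell2_inner_self[symmetric]
    by (simp add: ell2_inner_diff_left ell2_inner_diff_right assms ell2_inner_commute[of S v u])
  then have "Re (complex_of_real ((ell2_norm S (\<lambda>x. u x - v x))\<^sup>2))
      = Re (ell2_inner S u u - ell2_inner S u v - (cnj (ell2_inner S u v) - ell2_inner S v v))"
    by (rule arg_cong)
  then show ?thesis by (simp only: ell2_inner_self Re_complex_of_real minus_complex.sel complex_cnj) (simp del: of_real_power)
qed

text \<open>The best coefficient is b = <u,v> / |v|^2, the projection of u to the line of v. That
  the minimum is nonnegative is the Cauchy-Schwarz inequality; that it cannot fall below a distance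
  already minimal gives orthogonality in \<open>ell2_projection\<close>.\<close>

lemma ell2_norm_power2_diff_optimal:
  assumes "u \<in> ell2 S" "v \<in> ell2 S" "ell2_norm S v \<noteq> 0"
  obtains b where "(ell2_norm S (\<lambda>x. u x - b * v x))\<^sup>2
    = (ell2_norm S u)\<^sup>2 - (cmod (ell2_inner S u v))\<^sup>2 / (ell2_norm S v)\<^sup>2"
proof
  define a where "a = ell2_inner S u v"
  define s where "s = (ell2_norm S v)\<^sup>2"
  have s: "s > 0" using assms by (simp add: s_def)
  define b where "b = a / complex_of_real s"
  have "(ell2_norm S (\<lambda>x. u x - b * v x))\<^sup>2
      = (ell2_norm S u)\<^sup>2 - 2 * Re (cnj b * a) + (cmod b)\<^sup>2 * s"
    using ell2_norm_power2_diff[OF assms(1) ell2_scale[OF assms(2)], of b]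
    by (simp only: ell2_inner_scale_right ell2_norm_scale power_mult_distrib s_def a_def)
  moreover have "cnj b * a = of_real ((cmod a)\<^sup>2 / s)"
    by (simp only: b_def of_real_divide complex_norm_square complex_cnj_divide complex_cnj_complex_of_real) simp
  moreover have "(cmod b)\<^sup>2 * s = (cmod a)\<^sup>2 / s"
    using s by (simp add: b_def norm_divide power2_eq_square)
  ultimately show "(ell2_norm S (\<lambda>x. u x - b * v x))\<^sup>2
    = (ell2_norm S u)\<^sup>2 - (cmod (ell2_inner S u v))\<^sup>2 / (ell2_norm S v)\<^sup>2"
    unfolding s_def a_def by simp
qed

lemma ell2_Cauchy_Schwarz:
  assumes "u \<in> ell2 S" "v \<in> ell2 S"
  shows "cmod (ell2_inner S u v) \<le> ell2_norm S u * ell2_norm S v"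
proof (cases "ell2_norm S v = 0")
  case True
  then show ?thesis using ell2_norm_eq_0D[OF assms(2)] by simp
next
  case False
  obtain b where "(ell2_norm S (\<lambda>x. u x - b * v x))\<^sup>2
    = (ell2_norm S u)\<^sup>2 - (cmod (ell2_inner S u v))\<^sup>2 / (ell2_norm S v)\<^sup>2"
    using ell2_norm_power2_diff_optimal[OF assms False] .
  then have "(cmod (ell2_inner S u v))\<^sup>2 / (ell2_norm S v)\<^sup>2 \<le> (ell2_norm S u)\<^sup>2"
    using zero_le_power2[of "ell2_norm S (\<lambda>x. u x - b * v x)"] by linarith
  then have "(cmod (ell2_inner S u v))\<^sup>2 \<le> (ell2_norm S u * ell2_norm S v)\<^sup>2"
    using False by (simp add: divide_le_eq power_mult_distrib)
  then show ?thesis by (rule power2_le_imp_le) simp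
qed

lemma ell2_norm_diff_triangle:
  assumes "u \<in> ell2 S" "v \<in> ell2 S"
  shows "ell2_norm S (\<lambda>x. u x - v x) \<le> ell2_norm S u + ell2_norm S v"
proof (rule power2_le_imp_le)
  have "- Re (ell2_inner S u v) \<le> cmod (ell2_inner S u v)"
    using abs_Re_le_cmod[of "ell2_inner S u v"] by linarith
  also have "\<dots> \<le> ell2_norm S u * ell2_norm S v" by (rule ell2_Cauchy_Schwarz[OF assms])
  finally show "(ell2_norm S (\<lambda>x. u x - v x))\<^sup>2 \<le> (ell2_norm S u + ell2_norm S v)\<^sup>2"
    unfolding ell2_norm_power2_diff[OF assms] by (simp add: power2_sum)
qed simp

lemma ell2_norm_minus: "ell2_norm S (\<lambda>x. - u x) = ell2_norm S u"
  by (simp add: ell2_norm_def)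

lemma ell2_norm_minus_commute: "ell2_norm S (\<lambda>x. u x - v x) = ell2_norm S (\<lambda>x. v x - u x)"
  by (simp add: ell2_norm_def norm_minus_commute)

lemma ell2_norm_triangle:
  assumes "u \<in> ell2 S" "v \<in> ell2 S"
  shows "ell2_norm S (\<lambda>x. u x + v x) \<le> ell2_norm S u + ell2_norm S v"
  using ell2_norm_diff_triangle[OF assms(1) ell2_scale[OF assms(2), of "-1"]]
  by (simp add: ell2_norm_minus)

lemma ell2_dist_triangle:
  assumes "u \<in> ell2 S" "v \<in> ell2 S" "w \<in> ell2 S"
  shows "ell2_norm S (\<lambda>x. u x - w x) \<le> ell2_norm S (\<lambda>x. u x - v x) + ell2_norm S (\<lambda>x. v x - w x)"
  using ell2_norm_triangle[OF ell2_diff[OF assms(1,2)] ell2_diff[OF assms(2,3)]] by simp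

lemma ell2_parallelogram:
  assumes "u \<in> ell2 S" "v \<in> ell2 S"
  shows "(ell2_norm S (\<lambda>x. u x - v x))\<^sup>2 + (ell2_norm S (\<lambda>x. u x + v x))\<^sup>2
    = 2 * (ell2_norm S u)\<^sup>2 + 2 * (ell2_norm S v)\<^sup>2"
proof -
  have "(ell2_norm S (\<lambda>x. u x + v x))\<^sup>2
    = (ell2_norm S u)\<^sup>2 + 2 * Re (ell2_inner S u v) + (ell2_norm S v)\<^sup>2"
    using ell2_norm_power2_diff[OF assms(1) ell2_scale[OF assms(2), of "-1"]]
      ell2_inner_scale_right[of S u "-1" v] by (simp add: ell2_norm_minus)
  then show ?thesis by (simp add: ell2_norm_power2_diff assms)
qed

section \<open>Density of finite supports, completeness and orthogonal projection\<close>

lemma ell2_cut_approx: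
  assumes "u \<in> ell2 S" "\<epsilon> > 0"
  obtains F where "finite F" "F \<subseteq> S" "ell2_norm S (\<lambda>x. u x - cut F u x) < \<epsilon>"
proof -
  define f where "f = (\<lambda>x. (cmod (u x))\<^sup>2)"
  have f: "f summable_on S" unfolding f_def by (rule ell2_summable[OF assms(1)])
  \<comment> \<open>Half of \<open>\<epsilon>\<^sup>2\<close>, because the approximation is a weak
    inequality and the conclusion is strict.\<close>
  obtain F where F: "finite F" "F \<subseteq> S" "dist (sum f F) (infsum f S) \<le> \<epsilon>\<^sup>2 / 2"
    using infsum_finite_approximation[OF f, of "\<epsilon>\<^sup>2 / 2"] assms(2) by auto
  have "(ell2_norm S (\<lambda>x. u x - cut F u x))\<^sup>2 = infsum f (S - F)"
    unfolding ell2_norm_power2 by (rule infsum_cong_neutral) (auto simp: cut_def f_def)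
  also have "\<dots> = infsum f S - sum f F"
    by (subst infsum_Diff) (use f F in auto)
  also have "\<dots> < \<epsilon>\<^sup>2" using F(3) assms(2) by (simp add: dist_real_def abs_le_iff) (smt (verit) zero_less_power)
  finally have "ell2_norm S (\<lambda>x. u x - cut F u x) < \<epsilon>"
    using assms(2) by (intro power2_less_imp_less[of _ \<epsilon>]) simp_all
  with F show ?thesis using that by blast
qed

text \<open>Coordinates are dominated by the norm, so pointwise limits exist. The norm estimate
  survives the limit because it is tested on finite sets of coordinates, where the limit may be
  taken inside the sum.\<close>

lemma ell2_complete:
  fixes u :: "nat \<Rightarrow> 'a vec"
  assumes u: "\<And>n. u n \<in> ell2 S"
    and cauchy: "\<And>\<epsilon>. \<epsilon> > 0 \<Longrightarrow> \<exists>N. \<forall>m\<ge>N. \<forall>n\<ge>N. ell2_norm S (\<lambda>x. u m x - u n x) \<le> \<epsilon>"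
  obtains w where "w \<in> ell2 S"
    "\<forall>\<epsilon>>0. \<exists>N. \<forall>n\<ge>N. ell2_norm S (\<lambda>x. u n x - w x) \<le> \<epsilon>"
proof -
  have "Cauchy (\<lambda>n. u n x)" for x
  proof (rule metric_CauchyI)
    fix e :: real assume "e > 0"
    then obtain N where N: "\<forall>m\<ge>N. \<forall>n\<ge>N. ell2_norm S (\<lambda>x. u m x - u n x) \<le> e / 2"
      using cauchy[of "e / 2"] by auto
    have "dist (u m x) (u n x) < e" if "m \<ge> N" "n \<ge> N" for m n
    proof -
      have "dist (u m x) (u n x) \<le> ell2_norm S (\<lambda>x. u m x - u n x)"
        using ell2_coord_le[OF ell2_diff[OF u[of m] u[of n]], of x] by (simp add: dist_norm)
      also have "\<dots> \<le> e / 2" using N that by blast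
      also have "\<dots> < e" using \<open>e > 0\<close> by simp
      finally show ?thesis .
    qed
    then show "\<exists>M. \<forall>m\<ge>M. \<forall>n\<ge>M. dist (u m x) (u n x) < e" by blast
  qed
  then have "convergent (\<lambda>n. u n x)" for x
    by (rule Cauchy_convergent)
  then have w: "(\<lambda>n. u n x) \<longlonglongrightarrow> lim (\<lambda>n. u n x)" for x
    by (simp add: convergent_LIMSEQ_iff)
  define w where "w = (\<lambda>x. lim (\<lambda>n. u n x))"
  have w: "(\<lambda>n. u n x) \<longlonglongrightarrow> w x" for x
    unfolding w_def by (rule w)
  have w0: "w x = 0" if "x \<notin> S" for x
    using w[of x] that by (simp add: ell2_outside[OF u] LIMSEQ_const_iff)
  have key: "(\<lambda>x. u n x - w x) \<in> ell2 S \<and> ell2_norm S (\<lambda>x. u n x - w x) \<le> \<epsilon>"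
    if "\<epsilon> > 0" and N: "\<forall>m\<ge>N. \<forall>n\<ge>N. ell2_norm S (\<lambda>x. u m x - u n x) \<le> \<epsilon>" and "n \<ge> N" for \<epsilon> n N
  proof -
    have "(\<Sum>x\<in>F. (cmod (u n x - w x))\<^sup>2) \<le> \<epsilon>\<^sup>2" if F: "finite F" "F \<subseteq> S" for F
    proof (rule tendsto_upperbound)
      show "(\<lambda>m. \<Sum>x\<in>F. (cmod (u n x - u m x))\<^sup>2) \<longlonglongrightarrow> (\<Sum>x\<in>F. (cmod (u n x - w x))\<^sup>2)"
        by (intro tendsto_intros w)
      have "(\<Sum>x\<in>F. (cmod (u n x - u m x))\<^sup>2) \<le> \<epsilon>\<^sup>2" if "m \<ge> N" for m
      proof -
        have "(\<Sum>x\<in>F. (cmod (u n x - u m x))\<^sup>2) \<le> (ell2_norm S (\<lambda>x. u n x - u m x))\<^sup>2"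
          using ell2_finite_sum_le[OF ell2_diff[OF u u] F] .
        also have "\<dots> \<le> \<epsilon>\<^sup>2" using N \<open>n \<ge> N\<close> that by (intro power_mono) auto
        finally show ?thesis .
      qed
      then show "\<forall>\<^sub>F m in sequentially. (\<Sum>x\<in>F. (cmod (u n x - u m x))\<^sup>2) \<le> \<epsilon>\<^sup>2"
        by (auto simp: eventually_sequentially)
    qed simp
    then show ?thesis
      using ell2_boundI[of S "\<lambda>x. u n x - w x" \<epsilon>] \<open>\<epsilon> > 0\<close> w0 by (auto simp: ell2_outside[OF u])
  qed
  obtain N where N: "\<forall>m\<ge>N. \<forall>n\<ge>N. ell2_norm S (\<lambda>x. u m x - u n x) \<le> 1"
    using cauchy[of 1] by auto
  have "(\<lambda>x. u N x - w x) \<in> ell2 S" using key[of 1 N N] N by simp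
  from ell2_diff[OF u[of N] this] have "w \<in> ell2 S" by simp
  moreover have "\<exists>N. \<forall>n\<ge>N. ell2_norm S (\<lambda>x. u n x - w x) \<le> \<epsilon>" if e: "\<epsilon> > 0" for \<epsilon>
  proof -
    obtain N where N: "\<forall>m\<ge>N. \<forall>n\<ge>N. ell2_norm S (\<lambda>x. u m x - u n x) \<le> \<epsilon>"
      using cauchy[OF e] by blast
    show ?thesis using key[OF e N] by (intro exI[of _ N]) simp
  qed
  ultimately show ?thesis using that by simp
qed

definition ell2_subspace :: "'a set \<Rightarrow> 'a vec set \<Rightarrow> bool"
  where "ell2_subspace S V \<longleftrightarrow> V \<subseteq> ell2 S \<and> (\<lambda>x. 0) \<in> V \<and>
    (\<forall>u\<in>V. \<forall>v\<in>V. (\<lambda>x. u x + v x) \<in> V) \<and> (\<forall>c. \<forall>u\<in>V. (\<lambda>x. c * u x) \<in> V)"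

lemma ell2_closureD: "u \<in> ell2_closure S V \<Longrightarrow> u \<in> ell2 S"
  by (simp add: ell2_closure_def)

lemma ell2_closure_approx:
  assumes "u \<in> ell2_closure S V" "\<epsilon> > 0"
  obtains v where "v \<in> V" "ell2_norm S (\<lambda>x. u x - v x) < \<epsilon>"
  using assms by (auto simp: ell2_closure_def)

lemma ell2_closure_superset: "V \<subseteq> ell2 S \<Longrightarrow> u \<in> V \<Longrightarrow> u \<in> ell2_closure S V"
  by (auto simp: ell2_closure_def intro!: bexI[of _ u])

lemma ell2_subspace_closure:
  assumes "ell2_subspace S V" shows "ell2_subspace S (ell2_closure S V)"
  unfolding ell2_subspace_def
proof (intro conjI ballI allI)
  have V: "V \<subseteq> ell2 S" using assms by (simp add: ell2_subspace_def)
  show "ell2_closure S V \<subseteq> ell2 S" by (auto simp: ell2_closure_def)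
  show "(\<lambda>x. 0) \<in> ell2_closure S V"
    using assms by (intro ell2_closure_superset) (auto simp: ell2_subspace_def)
  fix u assume u: "u \<in> ell2_closure S V"
  note u' = ell2_closureD[OF u]
  show "(\<lambda>x. u x + v x) \<in> ell2_closure S V" if v: "v \<in> ell2_closure S V" for v
    unfolding ell2_closure_def
  proof (intro CollectI conjI allI impI)
    note v' = ell2_closureD[OF v]
    show "(\<lambda>x. u x + v x) \<in> ell2 S" using u' v' by simp
    fix \<epsilon> :: real assume "\<epsilon> > 0"
    then have \<epsilon>: "\<epsilon> / 2 > 0" by simp
    obtain a where a: "a \<in> V" "ell2_norm S (\<lambda>x. u x - a x) < \<epsilon> / 2"
      using ell2_closure_approx[OF u \<epsilon>] .
    obtain b where b: "b \<in> V" "ell2_norm S (\<lambda>x. v x - b x) < \<epsilon> / 2"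
      using ell2_closure_approx[OF v \<epsilon>] .
    have aS: "a \<in> ell2 S" and bS: "b \<in> ell2 S" using a b V by auto
    have "ell2_norm S (\<lambda>x. (u x - a x) + (v x - b x)) < \<epsilon>"
      using ell2_norm_triangle[OF ell2_diff[OF u' aS] ell2_diff[OF v' bS]] a(2) b(2) by linarith
    also have "(\<lambda>x. (u x - a x) + (v x - b x)) = (\<lambda>x. u x + v x - (a x + b x))" by auto
    finally have "ell2_norm S (\<lambda>x. u x + v x - (a x + b x)) < \<epsilon>" .
    moreover have "(\<lambda>x. a x + b x) \<in> V" using assms a b by (simp add: ell2_subspace_def)
    ultimately show "\<exists>y\<in>V. ell2_norm S (\<lambda>x. u x + v x - y x) < \<epsilon>" by (intro bexI)
  qed
  show "(\<lambda>x. c * u x) \<in> ell2_closure S V" for c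
    unfolding ell2_closure_def
  proof (intro CollectI conjI allI impI)
    show "(\<lambda>x. c * u x) \<in> ell2 S" using u' by simp
    fix \<epsilon> :: real assume "\<epsilon> > 0"
    have c: "cmod c + 1 > 0" using norm_ge_zero[of c] by linarith
    then have "\<epsilon> / (cmod c + 1) > 0" using \<open>\<epsilon> > 0\<close> by simp
    then obtain a where a: "a \<in> V" "ell2_norm S (\<lambda>x. u x - a x) < \<epsilon> / (cmod c + 1)"
      using ell2_closure_approx[OF u] by blast
    have "ell2_norm S (\<lambda>x. c * u x - c * a x) = cmod c * ell2_norm S (\<lambda>x. u x - a x)"
      using ell2_norm_scale[of S c "\<lambda>x. u x - a x"] by (simp only: right_diff_distrib)
    also have "\<dots> \<le> (cmod c + 1) * ell2_norm S (\<lambda>x. u x - a x)"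
      by (intro mult_right_mono) auto
    also have "\<dots> < \<epsilon>" using a(2) c by (simp add: pos_less_divide_eq mult.commute)
    finally have "ell2_norm S (\<lambda>x. c * u x - c * a x) < \<epsilon>" .
    moreover have "(\<lambda>x. c * a x) \<in> V" using assms a by (simp add: ell2_subspace_def)
    ultimately show "\<exists>y\<in>V. ell2_norm S (\<lambda>x. c * u x - y x) < \<epsilon>" by (intro bexI)
  qed
qed

lemma ell2_closure_closed:
  assumes "u \<in> ell2 S" "V \<subseteq> ell2 S"
    and "\<And>\<epsilon>. \<epsilon> > 0 \<Longrightarrow> \<exists>v\<in>ell2_closure S V. ell2_norm S (\<lambda>x. u x - v x) < \<epsilon>"
  shows "u \<in> ell2_closure S V"
  unfolding ell2_closure_def
proof (intro CollectI conjI allI impI assms(1))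
  fix \<epsilon> :: real assume "\<epsilon> > 0"
  then obtain v where v: "v \<in> ell2_closure S V" "ell2_norm S (\<lambda>x. u x - v x) < \<epsilon> / 2"
    using assms(3)[of "\<epsilon> / 2"] half_gt_zero by blast
  then obtain w where w: "w \<in> V" "ell2_norm S (\<lambda>x. v x - w x) < \<epsilon> / 2"
    using ell2_closure_approx[of v S V "\<epsilon> / 2"] half_gt_zero[OF \<open>\<epsilon> > 0\<close>] by blast
  have "ell2_norm S (\<lambda>x. u x - w x) < \<epsilon>"
    using ell2_dist_triangle[OF assms(1) ell2_closureD[OF v(1)], of w] v(2) w assms(2) by auto
  with w show "\<exists>w\<in>V. ell2_norm S (\<lambda>x. u x - w x) < \<epsilon>" by blast
qed

text \<open>A minimising sequence is Cauchy by the parallelogram law. Its limit p is the projection: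
  if u - p were not orthogonal to v, the optimal multiple of v added to p would come closer to
  u.\<close>

theorem ell2_projection:
  assumes V: "ell2_subspace S V" and u: "u \<in> ell2 S"
  obtains p where "p \<in> ell2_closure S V" "\<And>v. v \<in> ell2_closure S V \<Longrightarrow> ell2_inner S (\<lambda>x. u x - p x) v = 0"
proof -
  let ?W = "ell2_closure S V"
  have W: "ell2_subspace S ?W" by (rule ell2_subspace_closure[OF V])
  have WS: "?W \<subseteq> ell2 S" and VS: "V \<subseteq> ell2 S" using V by (auto simp: ell2_closure_def ell2_subspace_def)
  have Wadd: "(\<lambda>x. a x + b x) \<in> ?W" if "a \<in> ?W" "b \<in> ?W" for a b
    using W that by (simp add: ell2_subspace_def)
  have Wsc: "(\<lambda>x. c * a x) \<in> ?W" if "a \<in> ?W" for a c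
    using W that by (simp add: ell2_subspace_def)
  define D where "D = (\<lambda>v. (ell2_norm S (\<lambda>x. u x - v x))\<^sup>2) ` ?W"
  define d where "d = Inf D"
  have D0: "D \<noteq> {}" using W by (auto simp: D_def ell2_subspace_def)
  have bdd: "bdd_below D" by (auto simp: D_def intro!: bdd_belowI[of _ 0])
  have dle: "d \<le> (ell2_norm S (\<lambda>x. u x - v x))\<^sup>2" if "v \<in> ?W" for v
    unfolding d_def using that bdd by (intro cInf_lower) (auto simp: D_def)
  have "\<exists>v\<in>?W. (ell2_norm S (\<lambda>x. u x - v x))\<^sup>2 < d + 1 / Suc n" for n
    using cInf_less_iff[OF D0 bdd, of "d + 1 / Suc n"] by (auto simp: d_def D_def)
  then obtain v where v: "\<And>n. v n \<in> ?W"
    and vd: "\<And>n. (ell2_norm S (\<lambda>x. u x - v n x))\<^sup>2 < d + 1 / Suc n" by metis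
  have vS: "v n \<in> ell2 S" for n using v WS by blast
  have mid: "(ell2_norm S (\<lambda>x. v m x - v n x))\<^sup>2 \<le> 2 / Suc m + 2 / Suc n" for m n
  proof -
    let ?a = "\<lambda>x. u x - v n x" and ?b = "\<lambda>x. u x - v m x"
    \<comment> \<open>The midpoint belongs to the subspace, so its squared distance to u is at least
      d; the parallelogram law then bounds the distance of the two approximants by their excesses
      over d.\<close>
    have "(\<lambda>x. (1/2) * (v n x + v m x)) \<in> ?W" by (intro Wsc Wadd v)
    from dle[OF this] have "4 * d \<le> 4 * (ell2_norm S (\<lambda>x. u x - (1/2) * (v n x + v m x)))\<^sup>2" by simp
    also have "\<dots> = (ell2_norm S (\<lambda>x. 2 * (u x - (1/2) * (v n x + v m x))))\<^sup>2"
      by (simp only: ell2_norm_scale power_mult_distrib) simp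
    also have "\<dots> = (ell2_norm S (\<lambda>x. ?a x + ?b x))\<^sup>2" by (simp add: algebra_simps)
    finally have "4 * d \<le> (ell2_norm S (\<lambda>x. ?a x + ?b x))\<^sup>2" .
    moreover have "(ell2_norm S (\<lambda>x. ?a x - ?b x))\<^sup>2 + (ell2_norm S (\<lambda>x. ?a x + ?b x))\<^sup>2
        = 2 * (ell2_norm S ?a)\<^sup>2 + 2 * (ell2_norm S ?b)\<^sup>2"
      by (rule ell2_parallelogram) (use u vS in auto)
    moreover have "(\<lambda>x. ?a x - ?b x) = (\<lambda>x. v m x - v n x)" by auto
    ultimately show ?thesis using vd[of m] vd[of n] by simp
  qed
  have cauchy: "\<exists>N. \<forall>m\<ge>N. \<forall>n\<ge>N. ell2_norm S (\<lambda>x. v m x - v n x) \<le> \<epsilon>" if "\<epsilon> > 0" for \<epsilon>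
  proof -
    \<comment> \<open>Chosen so that each of the two summands 2/(k+1) in \<open>mid\<close> is at
      most half of \<open>\<epsilon>\<^sup>2\<close>.\<close>
    obtain N :: nat where N: "4 / \<epsilon>\<^sup>2 < N" using reals_Archimedean2 by blast
    have "ell2_norm S (\<lambda>x. v m x - v n x) \<le> \<epsilon>" if "m \<ge> N" "n \<ge> N" for m n
    proof (rule power2_le_imp_le)
      have *: "2 / real (Suc k) \<le> \<epsilon>\<^sup>2 / 2" if "k \<ge> N" for k
      proof -
        have "4 / \<epsilon>\<^sup>2 \<le> Suc k" using N that by linarith
        then show ?thesis using \<open>\<epsilon> > 0\<close> by (simp add: field_simps)
      qed
      show "(ell2_norm S (\<lambda>x. v m x - v n x))\<^sup>2 \<le> \<epsilon>\<^sup>2"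
        using mid[of m n] *[OF that(1)] *[OF that(2)] by linarith
    qed (use \<open>\<epsilon> > 0\<close> in simp)
    then show ?thesis by blast
  qed
  obtain p where p: "p \<in> ell2 S"
    and "\<forall>\<epsilon>>0. \<exists>N. \<forall>n\<ge>N. ell2_norm S (\<lambda>x. v n x - p x) \<le> \<epsilon>"
    using ell2_complete[of v S, OF vS cauchy] .
  then have lim: "\<exists>N. \<forall>n\<ge>N. ell2_norm S (\<lambda>x. v n x - p x) \<le> \<epsilon>" if "\<epsilon> > 0" for \<epsilon>
    using that by simp
  have pW: "p \<in> ?W"
  proof (rule ell2_closure_closed[OF p VS])
    fix \<epsilon> :: real assume "\<epsilon> > 0"
    then obtain N where "ell2_norm S (\<lambda>x. v N x - p x) \<le> \<epsilon> / 2" using lim[of "\<epsilon> / 2"] by auto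
    then have "ell2_norm S (\<lambda>x. p x - v N x) < \<epsilon>"
      using \<open>\<epsilon> > 0\<close> by (subst ell2_norm_minus_commute) linarith
    with v show "\<exists>v\<in>?W. ell2_norm S (\<lambda>x. p x - v x) < \<epsilon>" by blast
  qed
  have pd: "(ell2_norm S (\<lambda>x. u x - p x))\<^sup>2 \<le> d"
  proof -
    have d0: "d \<ge> 0" unfolding d_def by (rule cInf_greatest[OF D0]) (auto simp: D_def)
    have "ell2_norm S (\<lambda>x. u x - p x) \<le> sqrt d"
    proof (rule tendsto_le[of sequentially])
      have "(\<lambda>n. ell2_norm S (\<lambda>x. v n x - p x)) \<longlonglongrightarrow> 0"
      proof (rule LIMSEQ_I)
        fix r :: real assume "r > 0"
        then obtain N where "\<forall>n\<ge>N. ell2_norm S (\<lambda>x. v n x - p x) \<le> r / 2" using lim[of "r / 2"] by auto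
        then show "\<exists>no. \<forall>n\<ge>no. norm (ell2_norm S (\<lambda>x. v n x - p x) - 0) < r"
          using \<open>r > 0\<close> by (intro exI[of _ N]) (auto intro: le_less_trans)
      qed
      moreover have "(\<lambda>n. 1 / real (Suc n)) \<longlonglongrightarrow> 0"
        using LIMSEQ_inverse_real_of_nat by (simp only: inverse_eq_divide)
      then have "(\<lambda>n. sqrt (d + 1 / Suc n)) \<longlonglongrightarrow> sqrt (d + 0)"
        by (intro tendsto_intros)
      ultimately have "(\<lambda>n. sqrt (d + 1 / Suc n) + ell2_norm S (\<lambda>x. v n x - p x)) \<longlonglongrightarrow> sqrt (d + 0) + 0"
        by (intro tendsto_add)
      then show "(\<lambda>n. sqrt (d + 1 / Suc n) + ell2_norm S (\<lambda>x. v n x - p x)) \<longlonglongrightarrow> sqrt d" by simp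
      have "ell2_norm S (\<lambda>x. u x - p x) \<le> sqrt (d + 1 / Suc n) + ell2_norm S (\<lambda>x. v n x - p x)" for n
        using ell2_dist_triangle[OF u vS p, of n] real_le_rsqrt[OF less_imp_le[OF vd[of n]]] by linarith
      then show "\<forall>\<^sub>F n in sequentially. ell2_norm S (\<lambda>x. u x - p x) \<le> sqrt (d + 1 / Suc n) + ell2_norm S (\<lambda>x. v n x - p x)"
        by simp
    qed simp_all
    from power_mono[OF this ell2_norm_nonneg, of 2] show ?thesis using d0 by simp
  qed
  have "ell2_inner S (\<lambda>x. u x - p x) v = 0" if v: "v \<in> ?W" for v
  proof (cases "ell2_norm S v = 0")
    case True
    then have "v = (\<lambda>x. 0)" using v WS by (intro ell2_norm_eq_0D) auto
    then show ?thesis by simp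
  next
    case False
    have vS': "v \<in> ell2 S" using v WS by blast
    obtain b where b: "(ell2_norm S (\<lambda>x. (u x - p x) - b * v x))\<^sup>2
      = (ell2_norm S (\<lambda>x. u x - p x))\<^sup>2
        - (cmod (ell2_inner S (\<lambda>x. u x - p x) v))\<^sup>2 / (ell2_norm S v)\<^sup>2"
      using ell2_norm_power2_diff_optimal[OF ell2_diff[OF u p] vS' False] .
    have "d \<le> (ell2_norm S (\<lambda>x. u x - (p x + b * v x)))\<^sup>2"
      by (intro dle Wadd Wsc pW v)
    also have "(\<lambda>x. u x - (p x + b * v x)) = (\<lambda>x. (u x - p x) - b * v x)" by auto
    finally have "(cmod (ell2_inner S (\<lambda>x. u x - p x) v))\<^sup>2 / (ell2_norm S v)\<^sup>2 \<le> 0"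
      using b pd by linarith
    then show ?thesis using False by (simp add: divide_le_0_iff)
  qed
  with pW show ?thesis by (rule that)
qed

section \<open>Bounded operators and commutants\<close>

lemma op_in_ell2: "T \<in> bounded_ops S \<Longrightarrow> u \<in> ell2 S \<Longrightarrow> T u \<in> ell2 S"
  by (auto simp: bounded_ops_def)

lemma op_vec_add:
  "T \<in> bounded_ops S \<Longrightarrow> u \<in> ell2 S \<Longrightarrow> v \<in> ell2 S \<Longrightarrow> T (\<lambda>x. u x + v x) = (\<lambda>x. T u x + T v x)"
  by (auto simp: bounded_ops_def)

lemma op_vec_scale: "T \<in> bounded_ops S \<Longrightarrow> u \<in> ell2 S \<Longrightarrow> T (\<lambda>x. c * u x) = (\<lambda>x. c * T u x)"
  by (auto simp: bounded_ops_def)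

lemma op_vec_diff:
  assumes "T \<in> bounded_ops S" "u \<in> ell2 S" "v \<in> ell2 S"
  shows "T (\<lambda>x. u x - v x) = (\<lambda>x. T u x - T v x)"
  using op_vec_add[OF assms(1,2) ell2_scale[OF assms(3), of "-1"]] op_vec_scale[OF assms(1,3), of "-1"]
  by simp

lemma op_vec_zero: "T \<in> bounded_ops S \<Longrightarrow> T (\<lambda>x. 0) = (\<lambda>x. 0)"
  using op_vec_scale[of T S "\<lambda>x. 0" 0] by simp

lemma op_extensional: "T \<in> bounded_ops S \<Longrightarrow> T \<in> extensional (ell2 S)"
  by (auto simp: bounded_ops_def PiE_def)

lemma op_bound:
  assumes "T \<in> bounded_ops S"
  obtains C where "C \<ge> 0" "\<And>u. u \<in> ell2 S \<Longrightarrow> ell2_norm S (T u) \<le> C * ell2_norm S u"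
proof -
  obtain C where C: "\<forall>u\<in>ell2 S. ell2_norm S (T u) \<le> C * ell2_norm S u"
    using assms by (auto simp: bounded_ops_def)
  have "ell2_norm S (T u) \<le> max C 0 * ell2_norm S u" if "u \<in> ell2 S" for u
  proof -
    have "ell2_norm S (T u) \<le> C * ell2_norm S u" using C that by blast
    also have "\<dots> \<le> max C 0 * ell2_norm S u" by (intro mult_right_mono) auto
    finally show ?thesis .
  qed
  then show ?thesis using that[of "max C 0"] by simp
qed

lemma bounded_opsI:
  assumes "T \<in> extensional (ell2 S)" "\<And>u. u \<in> ell2 S \<Longrightarrow> T u \<in> ell2 S"
    and "\<And>u v. u \<in> ell2 S \<Longrightarrow> v \<in> ell2 S \<Longrightarrow> T (\<lambda>x. u x + v x) = (\<lambda>x. T u x + T v x)"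
    and "\<And>c u. u \<in> ell2 S \<Longrightarrow> T (\<lambda>x. c * u x) = (\<lambda>x. c * T u x)"
    and "\<And>u. u \<in> ell2 S \<Longrightarrow> ell2_norm S (T u) \<le> C * ell2_norm S u"
  shows "T \<in> bounded_ops S"
  using assms by (auto simp: bounded_ops_def PiE_def intro!: exI[of _ C])

lemma op_eqI:
  assumes "A \<in> bounded_ops S" "B \<in> bounded_ops S" "\<And>u. u \<in> ell2 S \<Longrightarrow> A u = B u"
  shows "A = B"
  using assms by (intro extensionalityI[of A "ell2 S"] op_extensional)

lemma ell2_eqI:
  assumes "u \<in> ell2 S" "v \<in> ell2 S" "\<And>w. w \<in> ell2 S \<Longrightarrow> ell2_inner S u w = ell2_inner S v w"
  shows "u = v"
proof
  fix x show "u x = v x"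
    using assms(3)[of "ket x"] ell2_outside[OF assms(1)] ell2_outside[OF assms(2)]
    by (cases "x \<in> S") (auto simp: ell2_inner_ket)
qed

section \<open>Operators from bounded forms, adjoints and matrix entries\<close>

lemma cut_insert: "x \<notin> F \<Longrightarrow> cut (insert x F) u = (\<lambda>y. u x * ket x y + cut F u y)"
  by (auto simp: cut_def ket_def fun_eq_iff)

text \<open>Finitely supported vectors are dense.\<close>

lemma antilinear_functional_zero:
  assumes add: "\<And>u v. u \<in> ell2 S \<Longrightarrow> v \<in> ell2 S \<Longrightarrow> \<phi> (\<lambda>x. u x + v x) = \<phi> u + \<phi> v"
    and scale: "\<And>c u. u \<in> ell2 S \<Longrightarrow> \<phi> (\<lambda>x. c * u x) = cnj c * \<phi> u"
    and bound: "\<And>u. u \<in> ell2 S \<Longrightarrow> cmod (\<phi> u) \<le> C * ell2_norm S u"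
    and ket: "\<And>x. x \<in> S \<Longrightarrow> \<phi> (ket x) = 0"
    and u: "u \<in> ell2 S"
  shows "\<phi> u = 0"
proof -
  have fin: "\<phi> (cut F u) = 0" if "finite F" "F \<subseteq> S" for F
    using that
  proof (induction F)
    case empty
    have "\<phi> (\<lambda>x. 0 * u x) = 0" by (subst scale[OF u]) simp
    then show ?case by (simp add: cut_def)
  next
    case (insert x F)
    then show ?case
      by (simp add: cut_insert add scale ket u)
  qed
  have "cmod (\<phi> u) \<le> 0 + \<epsilon>" if "\<epsilon> > 0" for \<epsilon>
  proof -
    \<comment> \<open>\<open>C\<close> is an arbitrary real number, hence the denominator
      \<open>\<bar>C\<bar> + 1\<close>.\<close>
    have pos: "\<epsilon> / (\<bar>C\<bar> + 1) > 0" using that by (simp add: add_nonneg_pos)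
    obtain F where F: "finite F" "F \<subseteq> S" "ell2_norm S (\<lambda>x. u x - cut F u x) < \<epsilon> / (\<bar>C\<bar> + 1)"
      using ell2_cut_approx[OF u pos] .
    have "\<phi> (\<lambda>x. (u x - cut F u x) + cut F u x) = \<phi> (\<lambda>x. u x - cut F u x) + \<phi> (cut F u)"
      by (rule add) (use u in auto)
    then have "cmod (\<phi> u) = cmod (\<phi> (\<lambda>x. u x - cut F u x))" using fin[OF F(1,2)] by simp
    also have "\<dots> \<le> C * ell2_norm S (\<lambda>x. u x - cut F u x)" by (rule bound) (use u in auto)
    also have "\<dots> \<le> (\<bar>C\<bar> + 1) * ell2_norm S (\<lambda>x. u x - cut F u x)"
      by (intro mult_right_mono) auto
    also have "\<dots> \<le> (\<bar>C\<bar> + 1) * (\<epsilon> / (\<bar>C\<bar> + 1))" using F(3) by (intro mult_left_mono) auto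
    also have "\<dots> = \<epsilon>" by (simp add: add_nonneg_pos pos_add_strict field_simps abs_add_one_gt_zero less_imp_neq)
    finally show ?thesis by simp
  qed
  then have "cmod (\<phi> u) \<le> 0" by (rule field_le_epsilon)
  then show ?thesis by simp
qed

text \<open>The operator is defined through its coordinates \<open>B u (ket x)\<close>. Boundedness
  of the form makes them square summable, and the form is recovered because a bounded antilinear
  functional is determined by its values on the basis.\<close>

lemma bounded_form_op:
  assumes addl: "\<And>u u' v. u \<in> ell2 S \<Longrightarrow> u' \<in> ell2 S \<Longrightarrow> v \<in> ell2 S \<Longrightarrow> B (\<lambda>x. u x + u' x) v = B u v + B u' v"
    and scalel: "\<And>c u v. u \<in> ell2 S \<Longrightarrow> v \<in> ell2 S \<Longrightarrow> B (\<lambda>x. c * u x) v = c * B u v"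
    and addr: "\<And>u v v'. u \<in> ell2 S \<Longrightarrow> v \<in> ell2 S \<Longrightarrow> v' \<in> ell2 S \<Longrightarrow> B u (\<lambda>x. v x + v' x) = B u v + B u v'"
    and scaler: "\<And>c u v. u \<in> ell2 S \<Longrightarrow> v \<in> ell2 S \<Longrightarrow> B u (\<lambda>x. c * v x) = cnj c * B u v"
    and bound: "\<And>u v. u \<in> ell2 S \<Longrightarrow> v \<in> ell2 S \<Longrightarrow> cmod (B u v) \<le> C * ell2_norm S u * ell2_norm S v"
    and C: "C \<ge> 0"
  obtains T where "T \<in> bounded_ops S" "\<forall>u\<in>ell2 S. \<forall>v\<in>ell2 S. ell2_inner S (T u) v = B u v"
proof -
  define T where "T = (\<lambda>u\<in>ell2 S. \<lambda>x. if x \<in> S then B u (ket x) else 0)"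
  have T: "T u = (\<lambda>x. if x \<in> S then B u (ket x) else 0)" if "u \<in> ell2 S" for u
    using that by (simp add: T_def)
  have fin: "B u (cut F w) = (\<Sum>x\<in>F. cnj (w x) * B u (ket x))"
    if "finite F" "F \<subseteq> S" "u \<in> ell2 S" "w \<in> ell2 S" for F u w
    using that
  proof (induction F)
    case empty
    have "B u (\<lambda>x. 0 * w x) = 0" by (subst scaler) (use empty in auto)
    then show ?case by (simp add: cut_def)
  next
    case (insert x F)
    then show ?case by (simp add: cut_insert addr scaler)
  qed
  have part: "(\<Sum>x\<in>F. (cmod (T u x))\<^sup>2) \<le> (C * ell2_norm S u)\<^sup>2"
    if F: "finite F" "F \<subseteq> S" and u: "u \<in> ell2 S" for F u
  proof -
    \<comment> \<open>The form is tested on the finite part of the would-be vector itself: B u w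
      equals |w|^2, so the bound on the form gives |w|^2 <= C |u| |w|, and a factor |w|
      cancels.\<close>
    define w where "w = (\<lambda>x. if x \<in> F then B u (ket x) else 0)"
    define s where "s = (\<Sum>x\<in>F. (cmod (B u (ket x)))\<^sup>2)"
    have s: "s \<ge> 0" unfolding s_def by (intro sum_nonneg) auto
    have w: "w \<in> ell2 S" by (rule ell2_finite_support[of F]) (use F in \<open>auto simp: w_def\<close>)
    have cw: "cut F w = w" by (auto simp: cut_def w_def)
    have "(ell2_norm S w)\<^sup>2 = (\<Sum>\<^sub>\<infinity>x\<in>F. (cmod (B u (ket x)))\<^sup>2)"
      unfolding ell2_norm_power2 by (rule infsum_cong_neutral) (use F in \<open>auto simp: w_def\<close>)
    then have nw: "(ell2_norm S w)\<^sup>2 = s" using F by (simp add: s_def)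
    have "B u w = (\<Sum>x\<in>F. cnj (w x) * B u (ket x))" using fin[OF F u w] by (simp only: cw)
    also have "\<dots> = (\<Sum>x\<in>F. of_real ((cmod (B u (ket x)))\<^sup>2))"
      by (rule sum.cong) (simp_all only: w_def complex_norm_square if_True mult.commute)
    also have "\<dots> = of_real s" by (simp add: s_def)
    finally have "s = cmod (B u w)" using s by simp
    also have "\<dots> \<le> C * ell2_norm S u * ell2_norm S w" by (rule bound[OF u w])
    finally have "ell2_norm S w * ell2_norm S w \<le> C * ell2_norm S u * ell2_norm S w"
      using nw by (simp add: power2_eq_square)
    then have "ell2_norm S w \<le> C * ell2_norm S u"
      using C mult_right_le_imp_le[of "ell2_norm S w" "ell2_norm S w" "C * ell2_norm S u"]
      by (cases "ell2_norm S w = 0") (simp_all add: less_le)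
    then have "s \<le> (C * ell2_norm S u)\<^sup>2" unfolding nw[symmetric] by (rule power_mono) simp
    also have "s = (\<Sum>x\<in>F. (cmod (T u x))\<^sup>2)"
      unfolding s_def by (rule sum.cong) (use F u in \<open>auto simp: T\<close>)
    finally show ?thesis .
  qed
  have TS: "T u \<in> ell2 S" and Tn: "ell2_norm S (T u) \<le> C * ell2_norm S u" if u: "u \<in> ell2 S" for u
    using ell2_boundI[of S "T u" "C * ell2_norm S u"] part[OF _ _ u] C u by (auto simp: T)
  have TB: "T \<in> bounded_ops S"
  proof (rule bounded_opsI)
    show "T \<in> extensional (ell2 S)" by (simp add: T_def)
    show "T (\<lambda>x. u x + v x) = (\<lambda>x. T u x + T v x)" if "u \<in> ell2 S" "v \<in> ell2 S" for u v
      using that by (auto simp: T addl fun_eq_iff)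
    show "T (\<lambda>x. c * u x) = (\<lambda>x. c * T u x)" if "u \<in> ell2 S" for c u
      using that by (auto simp: T scalel fun_eq_iff)
  qed (rule TS Tn, assumption)+
  have "ell2_inner S (T u) v = B u v" if u: "u \<in> ell2 S" and v: "v \<in> ell2 S" for u v
  proof -
    \<comment> \<open>Both terms are bounded and antilinear in v and agree on the basis by
      definition of T; the constant 2 C |u| is the sum of their two bounds.\<close>
    have "ell2_inner S (T u) v - B u v = 0"
    proof (rule antilinear_functional_zero[where u = v and C = "2 * (C * ell2_norm S u)"
          and \<phi> = "\<lambda>v. ell2_inner S (T u) v - B u v" and S = S])
      fix v v' assume "v \<in> ell2 S" "v' \<in> ell2 S"
      then show "ell2_inner S (T u) (\<lambda>x. v x + v' x) - B u (\<lambda>x. v x + v' x)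
        = ell2_inner S (T u) v - B u v + (ell2_inner S (T u) v' - B u v')"
        by (simp add: ell2_inner_add_right TS u addr)
    next
      fix c v assume "v \<in> ell2 S"
      then show "ell2_inner S (T u) (\<lambda>x. c * v x) - B u (\<lambda>x. c * v x) = cnj c * (ell2_inner S (T u) v - B u v)"
        by (simp add: ell2_inner_scale_right scaler u algebra_simps)
    next
      fix v assume v: "v \<in> ell2 S"
      have "cmod (ell2_inner S (T u) v) \<le> C * ell2_norm S u * ell2_norm S v"
        using ell2_Cauchy_Schwarz[OF TS[OF u] v] mult_right_mono[OF Tn[OF u] ell2_norm_nonneg[of S v]]
        by linarith
      then show "cmod (ell2_inner S (T u) v - B u v) \<le> 2 * (C * ell2_norm S u) * ell2_norm S v"
        using bound[OF u v] norm_triangle_ineq4[of "ell2_inner S (T u) v" "B u v"] by linarith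
    next
      fix x assume "x \<in> S"
      then show "ell2_inner S (T u) (ket x) - B u (ket x) = 0" by (simp add: ell2_inner_ket T u)
    qed (rule v)
    then show ?thesis by simp
  qed
  with TB show ?thesis using that by blast
qed

text \<open>The adjoint is, up to conjugation, the operator of the form <u, T v>. Unique existence
  is what gives meaning to the description operator in \<open>op_adj\<close>.\<close>

lemma op_adj_ex:
  assumes T: "T \<in> bounded_ops S"
  shows "\<exists>!A. A \<in> bounded_ops S \<and>
    (\<forall>u\<in>ell2 S. \<forall>v\<in>ell2 S. ell2_inner S (T u) v = ell2_inner S u (A v))"
proof -
  obtain C where C: "C \<ge> 0" "\<And>u. u \<in> ell2 S \<Longrightarrow> ell2_norm S (T u) \<le> C * ell2_norm S u"
    using op_bound[OF T] by blast
  have bd: "cmod (ell2_inner S u (T v)) \<le> C * ell2_norm S u * ell2_norm S v"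
    if "u \<in> ell2 S" "v \<in> ell2 S" for u v
    using ell2_Cauchy_Schwarz[OF that(1) op_in_ell2[OF T that(2)]]
      mult_left_mono[OF C(2)[OF that(2)] ell2_norm_nonneg[of S u]] by (simp add: mult_ac)
  obtain A where A: "A \<in> bounded_ops S" "\<forall>u\<in>ell2 S. \<forall>v\<in>ell2 S. ell2_inner S (A u) v = ell2_inner S u (T v)"
    by (rule bounded_form_op[where S = S and B = "\<lambda>u v. ell2_inner S u (T v)" and C = C])
      (auto simp: ell2_inner_add_left ell2_inner_scale_left ell2_inner_add_right ell2_inner_scale_right
        op_in_ell2[OF T] op_vec_add[OF T] op_vec_scale[OF T] bd C)
  show ?thesis
  proof (rule ex1I[of _ A])
    have "ell2_inner S (T u) v = ell2_inner S u (A v)" if "u \<in> ell2 S" "v \<in> ell2 S" for u v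
      using A(2) that by (subst (1 2) ell2_inner_commute) simp
    then show "A \<in> bounded_ops S \<and> (\<forall>u\<in>ell2 S. \<forall>v\<in>ell2 S. ell2_inner S (T u) v = ell2_inner S u (A v))"
      using A by blast
    fix A' assume A': "A' \<in> bounded_ops S \<and> (\<forall>u\<in>ell2 S. \<forall>v\<in>ell2 S. ell2_inner S (T u) v = ell2_inner S u (A' v))"
    show "A' = A"
    proof (rule op_eqI)
      show "A' v = A v" if v: "v \<in> ell2 S" for v
      proof (rule ell2_eqI)
        fix w assume w: "w \<in> ell2 S"
        have "ell2_inner S (A' v) w = cnj (ell2_inner S (T w) v)"
          using A' v w by (subst ell2_inner_commute) simp
        also have "\<dots> = ell2_inner S (A v) w" using A v w by (simp add: ell2_inner_commute[of S v])
        finally show "ell2_inner S (A' v) w = ell2_inner S (A v) w" .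
      qed (use A A' v op_in_ell2 in blast)+
    qed (use A A' in blast)+
  qed
qed

lemma
  assumes T: "T \<in> bounded_ops S"
  shows op_adj_in: "op_adj S T \<in> bounded_ops S"
    and op_adj_inner: "u \<in> ell2 S \<Longrightarrow> v \<in> ell2 S \<Longrightarrow> ell2_inner S (T u) v = ell2_inner S u (op_adj S T v)"
  using theI'[OF op_adj_ex[OF T]] unfolding op_adj_def by blast+

lemma op_adj_inner_left:
  assumes "T \<in> bounded_ops S" "u \<in> ell2 S" "v \<in> ell2 S"
  shows "ell2_inner S (op_adj S T u) v = ell2_inner S u (T v)"
  using assms by (subst (1 2) ell2_inner_commute) (simp add: op_adj_inner)

lemma op_adj_eqI:
  assumes "T \<in> bounded_ops S" "A \<in> bounded_ops S"
    and "\<And>u v. u \<in> ell2 S \<Longrightarrow> v \<in> ell2 S \<Longrightarrow> ell2_inner S (T u) v = ell2_inner S u (A v)"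
  shows "op_adj S T = A"
  unfolding op_adj_def by (rule the1_equality[OF op_adj_ex]) (use assms in auto)

lemma op_adj_adj: "T \<in> bounded_ops S \<Longrightarrow> op_adj S (op_adj S T) = T"
  by (rule op_adj_eqI) (simp_all add: op_adj_in op_adj_inner_left)

lemma op_adj_ket:
  assumes "T \<in> bounded_ops S" "x \<in> S" "y \<in> S"
  shows "op_adj S T (ket y) x = cnj (T (ket x) y)"
proof -
  have "op_adj S T (ket y) x = ell2_inner S (op_adj S T (ket y)) (ket x)"
    using assms by (simp add: ell2_inner_ket)
  also have "\<dots> = ell2_inner S (ket y) (T (ket x))" using assms by (intro op_adj_inner_left) auto
  finally show ?thesis using assms by (simp add: ell2_inner_ket_left)
qed

text \<open>Row y of the matrix of T is the conjugate of the square summable vector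
  \<open>op_adj S T (ket y)\<close>, so the series converges absolutely. Operators can therefore be
  compared and multiplied entry by entry.\<close>

lemma op_matrix:
  assumes "T \<in> bounded_ops S" "u \<in> ell2 S" "y \<in> S"
  shows "T u y = (\<Sum>\<^sub>\<infinity>x\<in>S. u x * T (ket x) y)"
proof -
  have "T u y = ell2_inner S (T u) (ket y)" using assms by (simp add: ell2_inner_ket)
  also have "\<dots> = ell2_inner S u (op_adj S T (ket y))" using assms by (intro op_adj_inner) auto
  also have "\<dots> = (\<Sum>\<^sub>\<infinity>x\<in>S. u x * T (ket x) y)"
    unfolding ell2_inner_def by (rule infsum_cong) (simp add: op_adj_ket assms)
  finally show ?thesis .
qed

lemma op_eq_ketI:
  assumes "A \<in> bounded_ops S" "B \<in> bounded_ops S"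
    and "\<And>x y. x \<in> S \<Longrightarrow> y \<in> S \<Longrightarrow> A (ket x) y = B (ket x) y"
  shows "A = B"
proof (rule op_eqI[OF assms(1,2)])
  fix u assume u: "u \<in> ell2 S"
  show "A u = B u"
  proof
    fix y show "A u y = B u y"
    proof (cases "y \<in> S")
      case True
      then show ?thesis
        unfolding op_matrix[OF assms(1) u True] op_matrix[OF assms(2) u True]
        by (intro infsum_cong) (simp add: assms(3))
    next
      case False
      then show ?thesis
        using ell2_outside[OF op_in_ell2[OF assms(1) u]] ell2_outside[OF op_in_ell2[OF assms(2) u]] by simp
    qed
  qed
qed

lemma op_mult_apply: "u \<in> ell2 S \<Longrightarrow> op_mult S A B u = A (B u)"
  by (simp add: compose_def)

lemma op_mult_in [intro]:
  assumes "A \<in> bounded_ops S" "B \<in> bounded_ops S"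
  shows "op_mult S A B \<in> bounded_ops S"
proof -
  obtain C where C: "C \<ge> 0" "\<And>u. u \<in> ell2 S \<Longrightarrow> ell2_norm S (A u) \<le> C * ell2_norm S u"
    using op_bound[OF assms(1)] by blast
  obtain D where D: "D \<ge> 0" "\<And>u. u \<in> ell2 S \<Longrightarrow> ell2_norm S (B u) \<le> D * ell2_norm S u"
    using op_bound[OF assms(2)] by blast
  have "ell2_norm S (A (B u)) \<le> (C * D) * ell2_norm S u" if u: "u \<in> ell2 S" for u
    using C(2)[OF op_in_ell2[OF assms(2) u]] mult_left_mono[OF D(2)[OF u] C(1)] by (simp add: mult_ac)
  then show ?thesis
    by (intro bounded_opsI[where C = "C * D"])
      (auto simp: op_mult_apply op_in_ell2[OF assms(1)] op_in_ell2[OF assms(2)]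
        op_vec_add[OF assms(1)] op_vec_add[OF assms(2)] op_vec_scale[OF assms(1)] op_vec_scale[OF assms(2)])
qed

lemma op_id_apply: "u \<in> ell2 S \<Longrightarrow> op_id S u = u"
  by (simp add: op_id_def)

lemma op_id_in [intro, simp]: "op_id S \<in> bounded_ops S"
  by (rule bounded_opsI[where C = 1]) (auto simp: op_id_def)

lemma op_add_apply: "u \<in> ell2 S \<Longrightarrow> op_add S A B u = (\<lambda>x. A u x + B u x)"
  by (simp add: op_add_def)

lemma op_scale_apply: "u \<in> ell2 S \<Longrightarrow> op_scale S c A u = (\<lambda>x. c * A u x)"
  by (simp add: op_scale_def)

lemma op_add_in [intro]:
  assumes "A \<in> bounded_ops S" "B \<in> bounded_ops S"
  shows "op_add S A B \<in> bounded_ops S"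
proof -
  obtain C where C: "\<And>u. u \<in> ell2 S \<Longrightarrow> ell2_norm S (A u) \<le> C * ell2_norm S u"
    using op_bound[OF assms(1)] by blast
  obtain D where D: "\<And>u. u \<in> ell2 S \<Longrightarrow> ell2_norm S (B u) \<le> D * ell2_norm S u"
    using op_bound[OF assms(2)] by blast
  note mem = op_in_ell2[OF assms(1)] op_in_ell2[OF assms(2)]
  have "ell2_norm S (\<lambda>x. A u x + B u x) \<le> (C + D) * ell2_norm S u" if u: "u \<in> ell2 S" for u
    using ell2_norm_triangle[OF mem(1)[OF u] mem(2)[OF u]] C[OF u] D[OF u] by (simp add: distrib_right)
  then show ?thesis
    by (intro bounded_opsI[where C = "C + D"])
      (auto simp: op_add_def mem algebra_simps
        op_vec_add[OF assms(1)] op_vec_add[OF assms(2)] op_vec_scale[OF assms(1)] op_vec_scale[OF assms(2)])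
qed

lemma op_scale_in [intro]:
  assumes "A \<in> bounded_ops S" shows "op_scale S c A \<in> bounded_ops S"
proof -
  obtain C where C: "\<And>u. u \<in> ell2 S \<Longrightarrow> ell2_norm S (A u) \<le> C * ell2_norm S u"
    using op_bound[OF assms] by blast
  have "ell2_norm S (\<lambda>x. c * A u x) \<le> (cmod c * C) * ell2_norm S u" if u: "u \<in> ell2 S" for u
    using mult_left_mono[OF C[OF u] norm_ge_zero[of c]] by (simp add: ell2_norm_scale mult_ac)
  then show ?thesis
    by (intro bounded_opsI[where C = "cmod c * C"])
      (auto simp: op_scale_def op_in_ell2[OF assms] algebra_simps op_vec_add[OF assms] op_vec_scale[OF assms])
qed

section \<open>Commutants\<close>

lemma commutant_iff:
  assumes "X \<subseteq> bounded_ops S"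
  shows "T \<in> commutant S X \<longleftrightarrow> T \<in> bounded_ops S \<and> (\<forall>A\<in>X. \<forall>u\<in>ell2 S. T (A u) = A (T u))"
proof
  assume "T \<in> commutant S X"
  then have "T \<in> bounded_ops S" and eq: "\<And>A. A \<in> X \<Longrightarrow> op_mult S T A = op_mult S A T"
    by (auto simp: commutant_def)
  then show "T \<in> bounded_ops S \<and> (\<forall>A\<in>X. \<forall>u\<in>ell2 S. T (A u) = A (T u))"
    using fun_cong[OF eq] by (auto simp: op_mult_apply) (metis op_mult_apply)
next
  assume "T \<in> bounded_ops S \<and> (\<forall>A\<in>X. \<forall>u\<in>ell2 S. T (A u) = A (T u))"
  then show "T \<in> commutant S X" using assms
    by (auto simp: commutant_def op_mult_apply intro!: op_eqI[of _ S])
qed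

lemma commutant_bounded: "commutant S X \<subseteq> bounded_ops S"
  by (auto simp: commutant_def)

lemma commutant_antimono: "X \<subseteq> Y \<Longrightarrow> commutant S Y \<subseteq> commutant S X"
  by (auto simp: commutant_def)

lemma commutant_double_superset: "X \<subseteq> bounded_ops S \<Longrightarrow> X \<subseteq> commutant S (commutant S X)"
  by (auto simp: commutant_def)

lemma commutant_triple: "X \<subseteq> bounded_ops S \<Longrightarrow> commutant S (commutant S (commutant S X)) = commutant S X"
  by (intro equalityI commutant_antimono commutant_double_superset commutant_bounded)

lemma commutant_adj:
  assumes X: "X \<subseteq> bounded_ops S" "\<And>A. A \<in> X \<Longrightarrow> op_adj S A \<in> X" and T: "T \<in> commutant S X"
  shows "op_adj S T \<in> commutant S X"
proof -
  have TB: "T \<in> bounded_ops S" and comm: "\<And>A u. A \<in> X \<Longrightarrow> u \<in> ell2 S \<Longrightarrow> T (A u) = A (T u)"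
    using T by (auto simp: commutant_iff[OF X(1)])
  have "op_adj S T (A u) = A (op_adj S T u)" if A: "A \<in> X" and u: "u \<in> ell2 S" for A u
  proof (rule ell2_eqI)
    have AB: "A \<in> bounded_ops S" using A X by blast
    note mem = op_in_ell2[OF AB] op_in_ell2[OF TB] op_in_ell2[OF op_adj_in[OF AB]]
      op_in_ell2[OF op_adj_in[OF TB]]
    show "op_adj S T (A u) \<in> ell2 S" "A (op_adj S T u) \<in> ell2 S"
      by (simp_all add: mem u)
    fix w assume w: "w \<in> ell2 S"
    have "ell2_inner S (op_adj S T (A u)) w = ell2_inner S u (op_adj S A (T w))"
      using AB TB u w by (simp add: op_adj_inner_left op_adj_inner mem)
    also have "op_adj S A (T w) = T (op_adj S A w)" using comm[OF X(2)[OF A] w] by simp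
    also have "ell2_inner S u (T (op_adj S A w)) = ell2_inner S (A (op_adj S T u)) w"
      using AB TB u w by (simp add: op_adj_inner_left op_adj_inner mem)
    finally show "ell2_inner S (op_adj S T (A u)) w = ell2_inner S (A (op_adj S T u)) w" .
  qed
  then show ?thesis using TB by (simp add: commutant_iff[OF X(1)] op_adj_in)
qed

text \<open>The third commutant is the first, so a commutant always equals its bicommutant.\<close>

lemma von_neumann_commutant:
  assumes "X \<subseteq> bounded_ops S" "\<And>A. A \<in> X \<Longrightarrow> op_adj S A \<in> X"
  shows "von_neumann_algebra S (commutant S X)"
  using assms commutant_adj[OF assms]
  by (auto simp: von_neumann_algebra_def commutant_triple commutant_bounded)

text \<open>A von Neumann algebra is the commutant of its own commutant. With that commutant as
  \<open>X\<close>, these statements supply the algebra operations that the definition by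
  bicommutants leaves implicit.\<close>

lemma
  assumes X: "X \<subseteq> bounded_ops S"
  shows commutant_id: "op_id S \<in> commutant S X"
    and commutant_add: "A \<in> commutant S X \<Longrightarrow> B \<in> commutant S X \<Longrightarrow> op_add S A B \<in> commutant S X"
    and commutant_scale: "A \<in> commutant S X \<Longrightarrow> op_scale S c A \<in> commutant S X"
    and commutant_mult: "A \<in> commutant S X \<Longrightarrow> B \<in> commutant S X \<Longrightarrow> op_mult S A B \<in> commutant S X"
proof -
  have XB: "C \<in> bounded_ops S" "u \<in> ell2 S \<Longrightarrow> C u \<in> ell2 S" if "C \<in> X" for C u
    using X that by (auto simp: bounded_ops_def)
  have AB: "u \<in> ell2 S \<Longrightarrow> A u \<in> ell2 S" if "A \<in> commutant S X" for A u
    using that by (auto simp: commutant_def bounded_ops_def)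
  show "op_id S \<in> commutant S X"
    by (simp add: commutant_iff[OF X] op_id_apply XB)
  show "op_add S A B \<in> commutant S X" if "A \<in> commutant S X" "B \<in> commutant S X"
    using that AB[OF that(1)] AB[OF that(2)]
    by (simp add: commutant_iff[OF X] op_add_apply XB op_vec_add[OF XB(1)] op_add_in)
  show "op_scale S c A \<in> commutant S X" if "A \<in> commutant S X"
    using that AB[OF that] by (simp add: commutant_iff[OF X] op_scale_apply XB op_vec_scale[OF XB(1)] op_scale_in)
  show "op_mult S A B \<in> commutant S X" if "A \<in> commutant S X" "B \<in> commutant S X"
    using that AB[OF that(1)] AB[OF that(2)]
    by (simp add: commutant_iff[OF X] op_mult_apply XB op_mult_in)
qed

section \<open>Composition operators and cut-offs\<close>

definition pull :: "'a set \<Rightarrow> ('a \<Rightarrow> 'a) \<Rightarrow> 'a oper"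
  where "pull S f = (\<lambda>u\<in>ell2 S. \<lambda>x. if x \<in> S then u (f x) else 0)"

lemma pull_apply: "u \<in> ell2 S \<Longrightarrow> pull S f u = (\<lambda>x. if x \<in> S then u (f x) else 0)"
  by (simp add: pull_def)

lemma pull_extensional: "pull S f \<in> extensional (ell2 S)"
  by (simp add: pull_def)

text \<open>Composition with an injective map is a contraction, as no coordinate of u is read twice.
  Both regular representations and the slide of cosets in the index argument are of this
  form.\<close>

lemma pull_in:
  assumes "inj_on f S" "f ` S \<subseteq> S"
  shows "pull S f \<in> bounded_ops S"
proof -
  have "pull S f u \<in> ell2 S \<and> ell2_norm S (pull S f u) \<le> ell2_norm S u" if u: "u \<in> ell2 S" for u
  proof -
    have "(\<Sum>x\<in>F. (cmod (pull S f u x))\<^sup>2) \<le> (ell2_norm S u)\<^sup>2" if F: "finite F" "F \<subseteq> S" for F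
    proof -
      have "(\<Sum>x\<in>F. (cmod (pull S f u x))\<^sup>2) = (\<Sum>x\<in>F. (cmod (u (f x)))\<^sup>2)"
        using F u by (intro sum.cong) (auto simp: pull_apply)
      also have "\<dots> = (\<Sum>y\<in>f ` F. (cmod (u y))\<^sup>2)"
        using assms(1) F by (subst sum.reindex) (auto intro: inj_on_subset)
      also have "\<dots> \<le> (ell2_norm S u)\<^sup>2"
        by (rule ell2_finite_sum_le[OF u]) (use F assms in auto)
      finally show ?thesis .
    qed
    then show ?thesis using ell2_boundI[of S "pull S f u" "ell2_norm S u"] u by (auto simp: pull_apply)
  qed
  then show ?thesis
    by (intro bounded_opsI[where C = 1]) (auto simp: pull_apply[OF ell2_add] pull_apply[OF ell2_scale] pull_apply fun_eq_iff pull_extensional)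
qed

lemma pull_inner:
  assumes "bij_betw f S S" "bij_betw g S S" "\<And>x. x \<in> S \<Longrightarrow> f (g x) = x"
    and "u \<in> ell2 S" "v \<in> ell2 S"
  shows "ell2_inner S (pull S f u) v = ell2_inner S u (pull S g v)"
proof -
  have "ell2_inner S (pull S f u) v = (\<Sum>\<^sub>\<infinity>x\<in>S. u (f x) * cnj (v x))"
    unfolding ell2_inner_def by (rule infsum_cong) (simp add: pull_apply assms)
  also have "\<dots> = (\<Sum>\<^sub>\<infinity>x\<in>S. u (f (g x)) * cnj (v (g x)))"
    by (rule infsum_reindex_bij_betw[OF assms(2), symmetric])
  also have "\<dots> = ell2_inner S u (pull S g v)"
    unfolding ell2_inner_def by (rule infsum_cong) (simp add: pull_apply assms)
  finally show ?thesis .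
qed

definition cutop :: "'a set \<Rightarrow> 'a set \<Rightarrow> 'a oper"
  where "cutop S B = (\<lambda>u\<in>ell2 S. cut B u)"

lemma cutop_apply: "u \<in> ell2 S \<Longrightarrow> cutop S B u = cut B u"
  by (simp add: cutop_def)

lemma cut_norm_le:
  assumes "u \<in> ell2 S" shows "ell2_norm S (cut B u) \<le> ell2_norm S u"
proof (rule ell2_boundI(2))
  fix F assume F: "finite F" "F \<subseteq> S"
  have "(\<Sum>x\<in>F. (cmod (cut B u x))\<^sup>2) \<le> (\<Sum>x\<in>F. (cmod (u x))\<^sup>2)"
    by (rule sum_mono) (auto simp: cut_def)
  also have "\<dots> \<le> (ell2_norm S u)\<^sup>2" by (rule ell2_finite_sum_le[OF assms F])
  finally show "(\<Sum>x\<in>F. (cmod (cut B u x))\<^sup>2) \<le> (ell2_norm S u)\<^sup>2" .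
qed (use assms in \<open>auto simp: cut_def ell2_outside\<close>)

lemma cutop_in: "cutop S B \<in> bounded_ops S"
  by (rule bounded_opsI[where C = 1])
    (auto simp: cutop_def cut_norm_le, auto simp: cut_def fun_eq_iff)

section \<open>The left and right regular representations\<close>

text \<open>N equal values c contribute N |c|^2 to a finite norm. This is where infinite conjugacy
  classes meet square summability.\<close>

lemma ell2_constant_on_infinite:
  assumes u: "u \<in> ell2 S" and X: "infinite X" "X \<subseteq> S" and c: "\<And>x. x \<in> X \<Longrightarrow> u x = c"
  shows "c = 0"
proof (rule ccontr)
  assume "c \<noteq> 0"
  then have c0: "(cmod c)\<^sup>2 > 0" by simp
  obtain n :: nat where n: "(ell2_norm S u)\<^sup>2 / (cmod c)\<^sup>2 < n" using reals_Archimedean2 by blast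
  obtain F where F: "F \<subseteq> X" "finite F" "card F = n" using infinite_arbitrarily_large[OF X(1)] by blast
  have "n * (cmod c)\<^sup>2 = (\<Sum>x\<in>F. (cmod (u x))\<^sup>2)"
  proof -
    have "(\<Sum>x\<in>F. (cmod (u x))\<^sup>2) = (\<Sum>x\<in>F. (cmod c)\<^sup>2)"
      by (rule sum.cong) (use F c in auto)
    then show ?thesis using F by simp
  qed
  also have "\<dots> \<le> (ell2_norm S u)\<^sup>2" using F X by (intro ell2_finite_sum_le[OF u]) auto
  finally show False using n c0 by (simp add: divide_less_eq)
qed

lemma ell2_closure_op:
  assumes T: "T \<in> bounded_ops S" and V: "V \<subseteq> ell2 S" and TV: "\<And>v. v \<in> V \<Longrightarrow> T v \<in> V"
    and u: "u \<in> ell2_closure S V"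
  shows "T u \<in> ell2_closure S V"
proof -
  obtain C where C: "C \<ge> 0" "\<And>u. u \<in> ell2 S \<Longrightarrow> ell2_norm S (T u) \<le> C * ell2_norm S u"
    using op_bound[OF T] by blast
  have uS: "u \<in> ell2 S" by (rule ell2_closureD[OF u])
  show ?thesis
    unfolding ell2_closure_def
  proof (intro CollectI conjI allI impI)
    show "T u \<in> ell2 S" by (rule op_in_ell2[OF T uS])
    fix \<epsilon> :: real assume "\<epsilon> > 0"
    then have "\<epsilon> / (C + 1) > 0" using C(1) by simp
    then obtain v where v: "v \<in> V" "ell2_norm S (\<lambda>x. u x - v x) < \<epsilon> / (C + 1)"
      using ell2_closure_approx[OF u] by blast
    have vS: "v \<in> ell2 S" using v V by blast
    have "ell2_norm S (\<lambda>x. T u x - T v x) \<le> C * ell2_norm S (\<lambda>x. u x - v x)"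
      using C(2)[OF ell2_diff[OF uS vS]] by (simp add: op_vec_diff[OF T uS vS])
    also have "\<dots> \<le> (C + 1) * ell2_norm S (\<lambda>x. u x - v x)" by (intro mult_right_mono) auto
    also have "\<dots> < \<epsilon>" using v(2) C(1) by (simp add: pos_less_divide_eq mult.commute)
    finally show "\<exists>v\<in>V. ell2_norm S (\<lambda>x. T u x - v x) < \<epsilon>" using TV[OF v(1)] by blast
  qed
qed

lemma ell2_subspace_add: "ell2_subspace S V \<Longrightarrow> u \<in> V \<Longrightarrow> v \<in> V \<Longrightarrow> (\<lambda>x. u x + v x) \<in> V"
  by (simp add: ell2_subspace_def)

lemma ell2_subspace_scale: "ell2_subspace S V \<Longrightarrow> u \<in> V \<Longrightarrow> (\<lambda>x. c * u x) \<in> V"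
  by (simp add: ell2_subspace_def)

lemma ell2_subspace_diff: "ell2_subspace S V \<Longrightarrow> u \<in> V \<Longrightarrow> v \<in> V \<Longrightarrow> (\<lambda>x. u x - v x) \<in> V"
  using ell2_subspace_add[of S V u "\<lambda>x. -1 * v x"] ell2_subspace_scale[of S V v "-1"] by simp

lemma ell2_projection_unique:
  assumes V: "ell2_subspace S V" and u: "u \<in> ell2 S"
    and p: "p \<in> ell2_closure S V" "\<And>v. v \<in> ell2_closure S V \<Longrightarrow> ell2_inner S (\<lambda>x. u x - p x) v = 0"
    and q: "q \<in> ell2_closure S V" "\<And>v. v \<in> ell2_closure S V \<Longrightarrow> ell2_inner S (\<lambda>x. u x - q x) v = 0"
  shows "p = q"
proof -
  have W: "ell2_subspace S (ell2_closure S V)" by (rule ell2_subspace_closure[OF V])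
  have pS: "p \<in> ell2 S" and qS: "q \<in> ell2 S" using p(1) q(1) by (auto dest: ell2_closureD)
  have d: "(\<lambda>x. p x - q x) \<in> ell2_closure S V" by (rule ell2_subspace_diff[OF W p(1) q(1)])
  have "ell2_inner S (\<lambda>x. (u x - q x) - (u x - p x)) (\<lambda>x. p x - q x) = 0"
    by (subst ell2_inner_diff_left) (use p(2)[OF d] q(2)[OF d] u pS qS in auto)
  then have "ell2_inner S (\<lambda>x. p x - q x) (\<lambda>x. p x - q x) = 0" by simp
  then have "ell2_norm S (\<lambda>x. p x - q x) = 0" by (simp add: ell2_inner_self)
  then have "(\<lambda>x. p x - q x) = (\<lambda>x. 0)" by (rule ell2_norm_eq_0D[OF ell2_diff[OF pS qS]])
  then show ?thesis by (simp add: fun_eq_iff)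
qed

text \<open>Since W and its adjoint preserve the subspace, \<open>W p\<close> satisfies the
  conditions that characterise the projection of \<open>W u\<close>; as \<open>W u = u\<close>,
  uniqueness gives \<open>W p = p\<close>.\<close>

lemma ell2_projection_invariant:
  assumes V: "ell2_subspace S V" and W: "W \<in> bounded_ops S"
    and WV: "\<And>v. v \<in> V \<Longrightarrow> W v \<in> V" "\<And>v. v \<in> V \<Longrightarrow> op_adj S W v \<in> V"
    and u: "u \<in> ell2 S" "W u = u"
    and p: "p \<in> ell2_closure S V" "\<And>v. v \<in> ell2_closure S V \<Longrightarrow> ell2_inner S (\<lambda>x. u x - p x) v = 0"
  shows "W p = p"
proof (rule ell2_projection_unique[OF V u(1) _ _ p])
  have VS: "V \<subseteq> ell2 S" using V by (simp add: ell2_subspace_def)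
  have pS: "p \<in> ell2 S" using p(1) by (rule ell2_closureD)
  show "W p \<in> ell2_closure S V" by (rule ell2_closure_op[OF W VS WV(1) p(1)])
  fix v assume v: "v \<in> ell2_closure S V"
  have vS: "v \<in> ell2 S" using v by (rule ell2_closureD)
  have "(\<lambda>x. u x - W p x) = W (\<lambda>x. u x - p x)" by (simp add: op_vec_diff[OF W u(1) pS] u(2))
  then have "ell2_inner S (\<lambda>x. u x - W p x) v = ell2_inner S (\<lambda>x. u x - p x) (op_adj S W v)"
    using op_adj_inner[OF W ell2_diff[OF u(1) pS] vS] by simp
  also have "\<dots> = 0" by (intro p(2) ell2_closure_op[OF op_adj_in[OF W] VS WV(2) v])
  finally show "ell2_inner S (\<lambda>x. u x - W p x) v = 0" .
qed

section \<open>Translation operators of a group\<close>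

definition right_regular :: "('g, 'x) monoid_scheme \<Rightarrow> 'g \<Rightarrow> 'g oper"
  where "right_regular G g = pull (carrier G) (\<lambda>x. x \<otimes>\<^bsub>G\<^esub> g)"

text \<open>By \<open>group_vn_eq\<close> this is the group von Neumann algebra; membership in the
  commutant of explicit operators is easier to check than membership in a bicommutant.\<close>

definition right_vn :: "('g, 'x) monoid_scheme \<Rightarrow> 'g oper set"
  where "right_vn G = commutant (carrier G) (right_regular G ` carrier G)"

context group
begin

abbreviation L2 :: "'a vec set"
  where "L2 \<equiv> ell2 (carrier G)"

lemma left_regular_pull: "left_regular G g = pull (carrier G) (\<lambda>x. inv g \<otimes> x)"
  by (simp add: left_regular_def pull_def)

lemma mult_inv_eq_one:
  assumes "x \<in> carrier G" "y \<in> carrier G" shows "x \<otimes> inv y = \<one> \<longleftrightarrow> x = y"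
proof
  assume "x \<otimes> inv y = \<one>"
  then have "(x \<otimes> inv y) \<otimes> y = y" using assms by simp
  then show "x = y" using assms by (simp add: m_assoc)
qed (use assms in simp)

lemma bij_left_mult: "g \<in> carrier G \<Longrightarrow> bij_betw (\<lambda>x. g \<otimes> x) (carrier G) (carrier G)"
  by (rule bij_betwI[where g = "\<lambda>x. inv g \<otimes> x"]) (auto simp: m_assoc[symmetric])

lemma bij_right_mult: "g \<in> carrier G \<Longrightarrow> bij_betw (\<lambda>x. x \<otimes> g) (carrier G) (carrier G)"
  by (rule bij_betwI[where g = "\<lambda>x. x \<otimes> inv g"]) (auto simp: m_assoc)

lemma left_regular_in [simp, intro]: "g \<in> carrier G \<Longrightarrow> left_regular G g \<in> bounded_ops (carrier G)"
  unfolding left_regular_pull using bij_left_mult[of "inv g"] by (intro pull_in) (auto simp: bij_betw_def)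

lemma right_regular_in [simp, intro]: "g \<in> carrier G \<Longrightarrow> right_regular G g \<in> bounded_ops (carrier G)"
  unfolding right_regular_def using bij_right_mult[of g] by (intro pull_in) (auto simp: bij_betw_def)

lemma left_regular_apply: "u \<in> L2 \<Longrightarrow> x \<in> carrier G \<Longrightarrow> left_regular G g u x = u (inv g \<otimes> x)"
  by (simp add: left_regular_def)

lemma right_regular_apply: "u \<in> L2 \<Longrightarrow> x \<in> carrier G \<Longrightarrow> right_regular G g u x = u (x \<otimes> g)"
  by (simp add: right_regular_def pull_apply)

lemma left_regular_ket:
  assumes "g \<in> carrier G" "x \<in> carrier G"
  shows "left_regular G g (ket x) = ket (g \<otimes> x)"
proof -
  have "inv g \<otimes> y = x \<longleftrightarrow> y = g \<otimes> x" if "y \<in> carrier G" for y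
    using assms that inv_solve_left[of x g y] by metis
  then show ?thesis using assms
    by (simp add: left_regular_def) (auto simp: ket_def fun_eq_iff)
qed

lemma right_regular_ket:
  assumes "g \<in> carrier G" "x \<in> carrier G"
  shows "right_regular G g (ket x) = ket (x \<otimes> inv g)"
proof -
  have "y \<otimes> g = x \<longleftrightarrow> y = x \<otimes> inv g" if "y \<in> carrier G" for y
    using assms that inv_solve_right[of y x g] by metis
  then show ?thesis using assms
    by (simp add: right_regular_def pull_def) (auto simp: ket_def fun_eq_iff)
qed

lemma left_regular_adj:
  assumes "g \<in> carrier G" shows "op_adj (carrier G) (left_regular G g) = left_regular G (inv g)"
proof (rule op_adj_eqI[OF left_regular_in[OF assms] left_regular_in[OF inv_closed[OF assms]]])
  fix u v assume uv: "u \<in> L2" "v \<in> L2"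
  show "ell2_inner (carrier G) (left_regular G g u) v = ell2_inner (carrier G) u (left_regular G (inv g) v)"
    using pull_inner[OF bij_left_mult[OF inv_closed[OF assms]] bij_left_mult[OF assms] _ uv] assms
    by (simp add: left_regular_pull m_assoc[symmetric])
qed

lemma right_regular_adj:
  assumes "g \<in> carrier G" shows "op_adj (carrier G) (right_regular G g) = right_regular G (inv g)"
proof (rule op_adj_eqI[OF right_regular_in[OF assms] right_regular_in[OF inv_closed[OF assms]]])
  fix u v assume uv: "u \<in> L2" "v \<in> L2"
  show "ell2_inner (carrier G) (right_regular G g u) v = ell2_inner (carrier G) u (right_regular G (inv g) v)"
    using pull_inner[OF bij_right_mult[OF assms] bij_right_mult[OF inv_closed[OF assms]] _ uv] assms
    by (simp add: right_regular_def m_assoc)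
qed

lemma left_right_commute:
  assumes "g \<in> carrier G" "h \<in> carrier G" "u \<in> L2"
  shows "left_regular G g (right_regular G h u) = right_regular G h (left_regular G g u)"
proof
  have "right_regular G h u \<in> L2" "left_regular G g u \<in> L2" using assms op_in_ell2 by blast+
  then show "left_regular G g (right_regular G h u) x = right_regular G h (left_regular G g u) x" for x
    using assms by (cases "x \<in> carrier G") (auto simp: right_regular_def pull_def left_regular_def m_assoc)
qed

lemma left_image_bounded: "K \<subseteq> carrier G \<Longrightarrow> left_regular G ` K \<subseteq> bounded_ops (carrier G)"
  by auto

lemma right_image_bounded: "right_regular G ` carrier G \<subseteq> bounded_ops (carrier G)"
  by auto

section \<open>Fourier coefficients and the commutation theorem\<close>

lemma right_vn_iff:
  "T \<in> right_vn G \<longleftrightarrow> T \<in> bounded_ops (carrier G) \<and>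
    (\<forall>g\<in>carrier G. \<forall>u\<in>L2. T (right_regular G g u) = right_regular G g (T u))"
  unfolding right_vn_def commutant_iff[OF right_image_bounded] by auto

lemma right_vn_bounded: "T \<in> right_vn G \<Longrightarrow> T \<in> bounded_ops (carrier G)"
  by (simp add: right_vn_iff)

text \<open>Operators commuting with right translations are left convolutions: an entry depends on
  \<open>y \<otimes> inv x\<close> only, and \<open>T (ket \<one>)\<close> is the function of
  Fourier coefficients that determines T.\<close>

lemma right_vn_matrix:
  assumes "T \<in> right_vn G" "x \<in> carrier G" "y \<in> carrier G"
  shows "T (ket x) y = T (ket \<one>) (y \<otimes> inv x)"
proof -
  have "T (ket x) = T (right_regular G (inv x) (ket \<one>))" using assms by (simp add: right_regular_ket)
  also have "\<dots> = right_regular G (inv x) (T (ket \<one>))" using assms by (simp add: right_vn_iff)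
  finally show ?thesis
    using assms op_in_ell2[OF right_vn_bounded[OF assms(1)], of "ket \<one>"] by (simp add: right_regular_apply)
qed

lemma left_commutant_matrix:
  assumes "T \<in> commutant (carrier G) (left_regular G ` K)" "K \<subseteq> carrier G"
    and "k \<in> K" "x \<in> carrier G" "y \<in> carrier G"
  shows "T (ket (k \<otimes> x)) (k \<otimes> y) = T (ket x) y"
proof -
  have k: "k \<in> carrier G" using assms by blast
  have TB: "T \<in> bounded_ops (carrier G)" using assms(1) by (auto simp: commutant_def)
  have "T (ket (k \<otimes> x)) = T (left_regular G k (ket x))" using assms k by (simp add: left_regular_ket)
  also have "\<dots> = left_regular G k (T (ket x))"
    using assms by (auto simp: commutant_iff[OF left_image_bounded])
  finally show ?thesis
    using assms k op_in_ell2[OF TB, of "ket x"] by (simp add: left_regular_apply m_assoc[symmetric])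
qed

lemma left_commutantI:
  assumes T: "T \<in> bounded_ops (carrier G)" and K: "K \<subseteq> carrier G"
    and eq: "\<And>k u x. k \<in> K \<Longrightarrow> u \<in> L2 \<Longrightarrow> x \<in> carrier G \<Longrightarrow> T (left_regular G k u) x = T u (inv k \<otimes> x)"
  shows "T \<in> commutant (carrier G) (left_regular G ` K)"
  unfolding commutant_iff[OF left_image_bounded[OF K]]
proof (intro conjI ballI T)
  fix A u assume "A \<in> left_regular G ` K" and u: "u \<in> L2"
  then obtain k where k: "k \<in> K" "A = left_regular G k" by blast
  have kG: "k \<in> carrier G" using k K by blast
  show "T (A u) = A (T u)"
  proof
    fix x show "T (A u) x = A (T u) x"
    proof (cases "x \<in> carrier G")
      case True
      then show ?thesis using eq[OF k(1) u True] k op_in_ell2[OF T u] by (simp add: left_regular_apply)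
    next
      case False
      then show ?thesis
        using ell2_outside[OF op_in_ell2[OF T op_in_ell2[OF left_regular_in[OF kG] u]] False]
          ell2_outside[OF op_in_ell2[OF left_regular_in[OF kG] op_in_ell2[OF T u]] False] k by simp
    qed
  qed
qed

text \<open>The commutation theorem, in a form that also computes the algebra of a subgroup.\<close>

lemma commutation:
  assumes T: "T \<in> right_vn G" and supp: "\<And>x. x \<in> carrier G - K \<Longrightarrow> T (ket \<one>) x = 0"
    and K: "subgroup K G" and U: "U \<in> commutant (carrier G) (left_regular G ` K)"
  shows "op_mult (carrier G) T U = op_mult (carrier G) U T"
proof -
  have KG: "K \<subseteq> carrier G" using K by (rule subgroup.subset)
  have TB: "T \<in> bounded_ops (carrier G)" by (rule right_vn_bounded[OF T])
  have UB: "U \<in> bounded_ops (carrier G)" using U by (auto simp: commutant_def)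
  show ?thesis
  proof (rule op_eq_ketI[OF op_mult_in[OF TB UB] op_mult_in[OF UB TB]])
    fix h k assume hk: "h \<in> carrier G" "k \<in> carrier G"
    \<comment> \<open>Both products have as entry a sum over the group, and the substitution of k
      x^{-1} h for x matches them term by term. With t = k x^{-1}, the operator T contributes its
      coefficient at t on either side, and invariance of U under left translation by t carries the
      entry at (h, x) to the one at (t h, t x), where t x = k.\<close>
    have bij: "bij_betw (\<lambda>x. k \<otimes> inv x \<otimes> h) (carrier G) (carrier G)"
      by (rule bij_betwI[where g = "\<lambda>y. h \<otimes> inv y \<otimes> k"])
        (use hk in \<open>auto simp: inv_mult_group m_assoc[symmetric]\<close>, (use hk in \<open>simp add: m_assoc\<close>)+)
    have "op_mult (carrier G) T U (ket h) k = T (U (ket h)) k"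
      using hk by (simp add: op_mult_apply)
    also have "\<dots> = (\<Sum>\<^sub>\<infinity>x\<in>carrier G. U (ket h) x * T (ket x) k)"
      using hk by (intro op_matrix[OF TB op_in_ell2[OF UB]]) auto
    also have "\<dots> = (\<Sum>\<^sub>\<infinity>x\<in>carrier G. T (ket h) (k \<otimes> inv x \<otimes> h) * U (ket (k \<otimes> inv x \<otimes> h)) k)"
    proof (rule infsum_cong)
      fix x assume x: "x \<in> carrier G"
      have 1: "T (ket x) k = T (ket \<one>) (k \<otimes> inv x)" using x hk by (intro right_vn_matrix[OF T])
      have 2: "T (ket h) (k \<otimes> inv x \<otimes> h) = T (ket \<one>) (k \<otimes> inv x)"
        using x hk by (subst right_vn_matrix[OF T]) (simp_all add: m_assoc)
      \<comment> \<open>U is invariant under K only; for a quotient outside K the coefficient of T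
        vanishes and both terms are 0.\<close>
      show "U (ket h) x * T (ket x) k = T (ket h) (k \<otimes> inv x \<otimes> h) * U (ket (k \<otimes> inv x \<otimes> h)) k"
      proof (cases "k \<otimes> inv x \<in> K")
        case True
        have "U (ket (k \<otimes> inv x \<otimes> h)) ((k \<otimes> inv x) \<otimes> x) = U (ket h) x"
          by (rule left_commutant_matrix[OF U KG True hk(1) x])
        then have "U (ket (k \<otimes> inv x \<otimes> h)) k = U (ket h) x" using x hk by (simp add: m_assoc)
        then show ?thesis unfolding 1 2 by simp
      next
        case False
        then show ?thesis unfolding 1 2 using supp[of "k \<otimes> inv x"] x hk by simp
      qed
    qed
    also have "\<dots> = (\<Sum>\<^sub>\<infinity>y\<in>carrier G. T (ket h) y * U (ket y) k)"
      by (rule infsum_reindex_bij_betw[OF bij])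
    also have "\<dots> = U (T (ket h)) k"
      using hk by (intro op_matrix[OF UB op_in_ell2[OF TB], symmetric]) auto
    also have "\<dots> = op_mult (carrier G) U T (ket h) k"
      using hk by (simp add: op_mult_apply)
    finally show "op_mult (carrier G) T U (ket h) k = op_mult (carrier G) U T (ket h) k" .
  qed
qed

lemma right_regular_left_commutant:
  assumes "K \<subseteq> carrier G"
  shows "right_regular G ` carrier G \<subseteq> commutant (carrier G) (left_regular G ` K)"
  using assms by (auto simp: commutant_iff[OF left_image_bounded[OF assms]] left_right_commute[OF subsetD[OF assms]])

lemma cutop_left_commutant:
  assumes K: "K \<subseteq> carrier G" and B: "\<And>k x. k \<in> K \<Longrightarrow> x \<in> carrier G \<Longrightarrow> inv k \<otimes> x \<in> B \<longleftrightarrow> x \<in> B"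
  shows "cutop (carrier G) B \<in> commutant (carrier G) (left_regular G ` K)"
proof (rule left_commutantI[OF cutop_in K])
  fix k u x assume k: "k \<in> K" and u: "u \<in> L2" and x: "x \<in> carrier G"
  have kG: "k \<in> carrier G" using k K by blast
  have "left_regular G k u \<in> L2" by (rule op_in_ell2[OF left_regular_in[OF kG] u])
  then show "cutop (carrier G) B (left_regular G k u) x = cutop (carrier G) B u (inv k \<otimes> x)"
    using B[OF k x] u x by (simp add: cutop_apply cut_def left_regular_apply)
qed

text \<open>Right translations and the cut-off to K commute with left translations by K, hence with
  the bicommutant; the cut-off fixes \<open>ket \<one>\<close>, which confines the Fourier support
  to K. The converse is \<open>commutation\<close>. From here on, L(K) is handled through Fourier
  supports alone.\<close>

theorem subgroup_vn_eq:
  assumes K: "subgroup K G"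
  shows "subgroup_vn G K = {T \<in> right_vn G. \<forall>x\<in>carrier G - K. T (ket \<one>) x = 0}"
proof (intro equalityI subsetI)
  have KG: "K \<subseteq> carrier G" using K by (rule subgroup.subset)
  fix T assume T: "T \<in> subgroup_vn G K"
  have 1: "T \<in> right_vn G"
    using T commutant_antimono[OF right_regular_left_commutant[OF KG]]
    unfolding subgroup_vn_def right_vn_def by blast
  have cK: "cutop (carrier G) K \<in> commutant (carrier G) (left_regular G ` K)"
  proof (rule cutop_left_commutant[OF KG])
    fix k x assume k: "k \<in> K" and x: "x \<in> carrier G"
    have "x \<in> K" if "inv k \<otimes> x \<in> K"
    proof -
      have "k \<otimes> (inv k \<otimes> x) \<in> K" using k that by (rule subgroup.m_closed[OF K])
      then show ?thesis using k x KG by (auto simp: m_assoc[symmetric])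
    qed
    then show "inv k \<otimes> x \<in> K \<longleftrightarrow> x \<in> K"
      using k subgroup.m_closed[OF K] subgroup.m_inv_closed[OF K] by blast
  qed
  have o1: "\<one> \<in> K" by (rule subgroup.one_closed[OF K])
  have "T (cutop (carrier G) K (ket \<one>)) = cutop (carrier G) K (T (ket \<one>))"
    using T cK by (auto simp: subgroup_vn_def commutant_iff[OF commutant_bounded])
  moreover have "cut K (ket \<one>) = ket \<one>" using o1 by (auto simp: cut_def ket_def)
  ultimately have "T (ket \<one>) = cut K (T (ket \<one>))"
    using op_in_ell2[OF right_vn_bounded[OF 1], of "ket \<one>"] by (simp add: cutop_apply)
  then have "T (ket \<one>) x = 0" if "x \<notin> K" for x
    using that by (metis cut_def)
  with 1 show "T \<in> {T \<in> right_vn G. \<forall>x\<in>carrier G - K. T (ket \<one>) x = 0}" by simp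
next
  fix T assume "T \<in> {T \<in> right_vn G. \<forall>x\<in>carrier G - K. T (ket \<one>) x = 0}"
  then show "T \<in> subgroup_vn G K"
    using commutation[OF _ _ K, of T] right_vn_bounded[of T]
    by (auto simp: subgroup_vn_def commutant_def[of _ "commutant _ _"])
qed

lemma left_regular_adj_closed:
  assumes "subgroup K G" "A \<in> left_regular G ` K"
  shows "op_adj (carrier G) A \<in> left_regular G ` K"
  using assms subgroup.subset[OF assms(1)] subgroup.m_inv_closed[OF assms(1)]
  by (auto simp: left_regular_adj)

lemma subgroup_vn_von_neumann:
  assumes K: "subgroup K G" shows "von_neumann_algebra (carrier G) (subgroup_vn G K)"
  unfolding subgroup_vn_def
  by (rule von_neumann_commutant[OF commutant_bounded])
    (rule commutant_adj[OF left_image_bounded[OF subgroup.subset[OF K]] left_regular_adj_closed[OF K]])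

lemma left_regular_subgroup_vn: "K \<subseteq> carrier G \<Longrightarrow> k \<in> K \<Longrightarrow> left_regular G k \<in> subgroup_vn G K"
  unfolding subgroup_vn_def using commutant_double_superset[OF left_image_bounded] by blast

lemma subgroup_vn_commutant:
  "K \<subseteq> carrier G \<Longrightarrow> commutant (carrier G) (subgroup_vn G K) = commutant (carrier G) (left_regular G ` K)"
  unfolding subgroup_vn_def by (rule commutant_triple[OF left_image_bounded])

text \<open>The ICC condition relative to A: all nontrivial elements of the whole group are tested,
  but conjugated by A only. One condition thus serves L(K), L(G) and the algebras between
  them.\<close>

definition rel_icc :: "'a set \<Rightarrow> bool"
  where "rel_icc A \<longleftrightarrow> (\<forall>y\<in>carrier G. y \<noteq> \<one> \<longrightarrow> infinite {a \<otimes> y \<otimes> inv a | a. a \<in> A})"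

text \<open>With x = y g, the vector is constant on the conjugation orbit of y translated by g,
  which is infinite unless y is trivial. The case \<open>g = \<one>\<close> serves the centre,
  general g the projection of \<open>ket g\<close>.\<close>

lemma rel_icc_zero:
  assumes A: "rel_icc A" "A \<subseteq> carrier G" and u: "u \<in> L2" and g: "g \<in> carrier G"
    and inv: "\<And>a y. a \<in> A \<Longrightarrow> y \<in> carrier G \<Longrightarrow> u (a \<otimes> y \<otimes> inv a \<otimes> g) = u (y \<otimes> g)"
    and x: "x \<in> carrier G" "x \<noteq> g"
  shows "u x = 0"
proof -
  define y where "y = x \<otimes> inv g"
  have y: "y \<in> carrier G" "y \<noteq> \<one>" "y \<otimes> g = x"
    using x g by (simp_all add: y_def m_assoc mult_inv_eq_one)
  let ?C = "{a \<otimes> y \<otimes> inv a | a. a \<in> A}"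
  have CG: "?C \<subseteq> carrier G" using A(2) y by auto
  have "inj_on (\<lambda>z. z \<otimes> g) ?C"
    using bij_right_mult[OF g] CG by (meson bij_betw_imp_inj_on inj_on_subset)
  then have "infinite ((\<lambda>z. z \<otimes> g) ` ?C)"
    using A(1) y by (auto simp: rel_icc_def dest: finite_imageD)
  moreover have "(\<lambda>z. z \<otimes> g) ` ?C \<subseteq> carrier G" using CG g by auto
  ultimately show ?thesis
    by (rule ell2_constant_on_infinite[OF u]) (use inv y in auto)
qed

theorem subgroup_vn_factor:
  assumes K: "subgroup K G" and A: "A \<subseteq> K" "rel_icc A"
  shows "vn_factor (carrier G) (subgroup_vn G K)"
  unfolding vn_factor_def
proof (intro conjI subgroup_vn_von_neumann[OF K] equalityI subsetI)
  have KG: "K \<subseteq> carrier G" using K by (rule subgroup.subset)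
  fix T assume T: "T \<in> subgroup_vn G K \<inter> commutant (carrier G) (subgroup_vn G K)"
  have TR: "T \<in> right_vn G" using T by (simp add: subgroup_vn_eq[OF K])
  have TL: "T \<in> commutant (carrier G) (left_regular G ` K)" using T by (simp add: subgroup_vn_commutant[OF KG])
  have TB: "T \<in> bounded_ops (carrier G)" by (rule right_vn_bounded[OF TR])
  have t0: "T (ket \<one>) y = 0" if y: "y \<in> carrier G" "y \<noteq> \<one>" for y
  proof (rule rel_icc_zero[OF A(2) _ op_in_ell2[OF TB] one_closed _ y])
    fix a y assume a: "a \<in> A" and y: "y \<in> carrier G"
    have aG: "a \<in> carrier G" using a A KG by blast
    \<comment> \<open>Left invariance moves the entry at (1, y) to (a, a y); being a left
      convolution as well, T has there its coefficient at a y a^{-1}. So the coefficients are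
      constant on A-orbits.\<close>
    have "T (ket (a \<otimes> \<one>)) (a \<otimes> y) = T (ket \<one>) y"
      using a A KG y by (intro left_commutant_matrix[OF TL KG]) auto
    then show "T (ket \<one>) (a \<otimes> y \<otimes> inv a \<otimes> \<one>) = T (ket \<one>) (y \<otimes> \<one>)"
      using right_vn_matrix[OF TR aG, of "a \<otimes> y"] aG y by simp
  qed (use A KG in auto)
  have "T = op_scale (carrier G) (T (ket \<one>) \<one>) (op_id (carrier G))"
  proof (rule op_eq_ketI[OF TB op_scale_in[OF op_id_in]])
    fix x y assume xy: "x \<in> carrier G" "y \<in> carrier G"
    have "op_scale (carrier G) (T (ket \<one>) \<one>) (op_id (carrier G)) (ket x) y = (if y = x then T (ket \<one>) \<one> else 0)"
      using xy by (simp add: op_scale_apply op_id_apply) (simp add: ket_def)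
    then show "T (ket x) y = op_scale (carrier G) (T (ket \<one>) \<one>) (op_id (carrier G)) (ket x) y"
      using xy t0[of "y \<otimes> inv x"] right_vn_matrix[OF TR xy] mult_inv_eq_one[of y x] by auto
  qed
  then show "T \<in> {op_scale (carrier G) c (op_id (carrier G)) | c. True}" by blast
next
  fix T assume "T \<in> {op_scale (carrier G) c (op_id (carrier G)) | c. True}"
  then obtain c where "T = op_scale (carrier G) c (op_id (carrier G))" by blast
  moreover have "subgroup_vn G K \<subseteq> bounded_ops (carrier G)" by (simp add: subgroup_vn_def commutant_bounded)
  ultimately show "T \<in> subgroup_vn G K \<inter> commutant (carrier G) (subgroup_vn G K)"
    by (auto simp: subgroup_vn_def intro!: commutant_scale commutant_id commutant_bounded)
qed

end

section \<open>Invariant means\<close>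

definition mean_on :: "('g, 'x) monoid_scheme \<Rightarrow> (('g \<Rightarrow> real) \<Rightarrow> real) \<Rightarrow> bool"
  where "mean_on G m \<longleftrightarrow>
    (\<forall>u v. bounded (u ` carrier G) \<longrightarrow> bounded (v ` carrier G) \<longrightarrow> m (\<lambda>x. u x + v x) = m u + m v) \<and>
    (\<forall>c u. bounded (u ` carrier G) \<longrightarrow> m (\<lambda>x. c * u x) = c * m u) \<and>
    (\<forall>u. bounded (u ` carrier G) \<longrightarrow> (\<forall>x\<in>carrier G. 0 \<le> u x) \<longrightarrow> 0 \<le> m u) \<and>
    m (\<lambda>x. 1) = 1"

text \<open>\<open>F\<close> may be any set of translations, not only a subgroup. This makes it
  possible to enlarge \<open>F\<close> step by step until it is the whole carrier.\<close>

definition invariant_mean :: "('g, 'x) monoid_scheme \<Rightarrow> 'g set \<Rightarrow> (('g \<Rightarrow> real) \<Rightarrow> real) \<Rightarrow> bool"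
  where "invariant_mean G F m \<longleftrightarrow> mean_on G m \<and>
    (\<forall>g\<in>F. \<forall>u. bounded (u ` carrier G) \<longrightarrow> m (\<lambda>x. u (g \<otimes>\<^bsub>G\<^esub> x)) = m u)"

lemma left_invariant_mean_iff: "left_invariant_mean G m \<longleftrightarrow> invariant_mean G (carrier G) m"
  by (auto simp: left_invariant_mean_def invariant_mean_def mean_on_def)

lemma bounded_real_image_iff: "bounded (u ` X) \<longleftrightarrow> (\<exists>B. \<forall>x\<in>X. \<bar>u x :: real\<bar> \<le> B)"
  by (auto simp: bounded_iff)

lemma bounded_real_add:
  "bounded (u ` X) \<Longrightarrow> bounded (v ` X) \<Longrightarrow> bounded ((\<lambda>x. u x + v x :: real) ` X)"
  by (rule bounded_plus_comp)

lemma bounded_real_scale: "bounded (u ` X) \<Longrightarrow> bounded ((\<lambda>x. c * u x :: real) ` X)"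
  using bounded_scaling[of "u ` X" c] by (simp add: image_image)

lemma bounded_real_const: "bounded ((\<lambda>x. c :: real) ` X)"
  by (rule finite_imp_bounded) (rule finite_subset[of _ "{c}"], auto)

lemma (in group) mult_inv_cancel:
  assumes "x \<in> carrier G" "y \<in> carrier G"
  shows "x \<otimes> (inv x \<otimes> y) = y" "inv x \<otimes> (x \<otimes> y) = y"
  using assms by (simp_all add: m_assoc[symmetric])

lemma (in group) bounded_translate:
  assumes "bounded (u ` carrier G)" "g \<in> carrier G"
  shows "bounded ((\<lambda>x. u (g \<otimes> x)) ` carrier G)"
  by (rule bounded_subset[OF assms(1)]) (use assms(2) in auto)

context
  fixes G :: "('g, 'x) monoid_scheme" and m
  assumes m: "mean_on G m"
begin

lemma mean_add:
  "bounded (u ` carrier G) \<Longrightarrow> bounded (v ` carrier G) \<Longrightarrow> m (\<lambda>x. u x + v x) = m u + m v"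
  using m by (simp add: mean_on_def)

lemma mean_scale: "bounded (u ` carrier G) \<Longrightarrow> m (\<lambda>x. c * u x) = c * m u"
  using m by (simp add: mean_on_def)

lemma mean_nonneg: "bounded (u ` carrier G) \<Longrightarrow> (\<And>x. x \<in> carrier G \<Longrightarrow> 0 \<le> u x) \<Longrightarrow> 0 \<le> m u"
  using m by (simp add: mean_on_def)

lemma mean_const: "m (\<lambda>x. c) = c"
proof -
  have "m (\<lambda>x. c * 1) = c * m (\<lambda>x. 1)" by (rule mean_scale[OF bounded_real_const])
  then show ?thesis using m by (simp add: mean_on_def)
qed

lemma mean_mono:
  assumes "bounded (u ` carrier G)" "bounded (v ` carrier G)" "\<And>x. x \<in> carrier G \<Longrightarrow> u x \<le> v x"
  shows "m u \<le> m v"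
proof -
  have "0 \<le> m (\<lambda>x. v x + -1 * u x)"
    by (rule mean_nonneg[OF bounded_real_add[OF assms(2) bounded_real_scale[OF assms(1)]]]) (use assms(3) in auto)
  also have "\<dots> = m v + -1 * m u"
    by (subst mean_add[OF assms(2) bounded_real_scale[OF assms(1)]]) (simp only: mean_scale[OF assms(1)])
  finally show ?thesis by simp
qed

lemma mean_cong:
  assumes "bounded (u ` carrier G)" "\<And>x. x \<in> carrier G \<Longrightarrow> u x = v x"
  shows "m u = m v"
proof -
  have v: "bounded (v ` carrier G)" using assms by (simp cong: image_cong)
  show ?thesis by (rule antisym) (rule mean_mono, use assms v in auto)+
qed

lemma mean_abs_le:
  assumes "\<And>x. x \<in> carrier G \<Longrightarrow> \<bar>u x\<bar> \<le> B" shows "\<bar>m u\<bar> \<le> B"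
proof -
  have u: "bounded (u ` carrier G)" using assms by (auto simp: bounded_real_image_iff)
  have "m (\<lambda>x. - B) \<le> m u" "m u \<le> m (\<lambda>x. B)"
    by (rule mean_mono[OF bounded_real_const u] mean_mono[OF u bounded_real_const], use assms in \<open>force simp: abs_le_iff\<close>)+
  then show ?thesis unfolding mean_const by linarith
qed

end

lemma closed_mean_on: "closed {m. mean_on G m}"
proof -
  have "{m. mean_on G m} =
    (\<Inter>u\<in>{u. bounded (u ` carrier G)}. \<Inter>v\<in>{u. bounded (u ` carrier G)}. {m. m (\<lambda>x. u x + v x) = m u + m v}) \<inter>
    (\<Inter>c. \<Inter>u\<in>{u. bounded (u ` carrier G)}. {m. m (\<lambda>x. c * u x) = c * m u}) \<inter>
    (\<Inter>u\<in>{u. bounded (u ` carrier G) \<and> (\<forall>x\<in>carrier G. 0 \<le> u x)}. {m. 0 \<le> m u}) \<inter>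
    {m. m (\<lambda>x. 1) = 1}"
    by (auto simp: mean_on_def)
  also have "closed \<dots>"
    by (intro closed_Int closed_INT ballI closed_Collect_eq closed_Collect_le continuous_intros
        continuous_on_product_coordinates)
  finally show ?thesis .
qed

text \<open>The means form a compact set in the product topology (Tychonoff).\<close>

lemma invariant_mean_compactness:
  fixes G :: "('g, 'x) monoid_scheme" (structure)
  assumes G: "group G" and Q: "Q \<subseteq> carrier G"
    and approx: "\<And>F \<epsilon>. finite F \<Longrightarrow> F \<subseteq> Q \<Longrightarrow> \<epsilon> > 0 \<Longrightarrow> \<exists>m. mean_on G m \<and>
      (\<forall>g\<in>F. \<forall>u. (\<forall>x\<in>carrier G. \<bar>u x\<bar> \<le> 1) \<longrightarrow> \<bar>m (\<lambda>x. u (g \<otimes>\<^bsub>G\<^esub> x)) - m u\<bar> \<le> \<epsilon>)"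
  shows "\<exists>m. invariant_mean G Q m"
proof -
  interpret group G by (rule G)
  let ?bd = "\<lambda>u :: 'g \<Rightarrow> real. bounded (u ` carrier G)"
  \<comment> \<open>A mean takes a bounded u into [- b u, b u]. Its values at unbounded functions
    are arbitrary; setting \<open>b u = 0\<close> there normalises them to 0, so that the product
    \<open>Z\<close> of intervals is compact.\<close>
  define b where "b = (\<lambda>u :: 'g \<Rightarrow> real. if ?bd u then SOME B. \<forall>x\<in>carrier G. \<bar>u x\<bar> \<le> B else 0)"
  have b: "\<bar>u x\<bar> \<le> b u" if "?bd u" "x \<in> carrier G" for u x
  proof -
    have "\<exists>B. \<forall>x\<in>carrier G. \<bar>u x\<bar> \<le> B" using that by (simp add: bounded_real_image_iff)
    from someI_ex[OF this] show ?thesis using that by (simp add: b_def)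
  qed
  have b0: "b u \<ge> 0" for u
    using b[of u \<one>] by (cases "?bd u") (auto simp: b_def)
  define Z where "Z = (\<Pi>\<^sub>E u\<in>UNIV. {- b u..b u})"
  have "compactin (product_topology (\<lambda>u. euclidean) UNIV) Z"
    unfolding Z_def by (simp add: compactin_PiE)
  then have "compact Z" by (simp add: euclidean_product_topology)
  then have cZ: "compact (Z \<inter> {m. mean_on G m})" by (intro compact_Int_closed closed_mean_on)
  define I where "I = {(g, u, \<epsilon>). g \<in> Q \<and> ?bd u \<and> \<epsilon> > (0::real)}"
  define f where "f = (\<lambda>(g, u, \<epsilon>). {m :: ('g \<Rightarrow> real) \<Rightarrow> real. \<bar>m (\<lambda>x. u (g \<otimes> x)) - m u\<bar> \<le> \<epsilon>})"
  have "(Z \<inter> {m. mean_on G m}) \<inter> (\<Inter>i\<in>I. f i) \<noteq> {}"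
  proof (rule compact_imp_fip_image[OF cZ])
    fix i assume "i \<in> I"
    obtain g u \<epsilon> where i: "i = (g, u, \<epsilon>)" by (cases i)
    show "closed (f i)"
      unfolding i f_def prod.case
      by (intro closed_Collect_le continuous_intros continuous_on_product_coordinates)
  next
    fix I' assume I': "finite I'" "I' \<subseteq> I"
    \<comment> \<open>Approximate invariance is available for functions bounded by 1. An error
      \<epsilon> for u amounts to an error \<epsilon> / (b u + 1) for u / (b u + 1), which is such a
      function; the element 1 keeps the set nonempty if \<open>I'\<close> is empty.\<close>
    define \<delta> where "\<delta> = Min (insert 1 ((\<lambda>(g, u, \<epsilon>). \<epsilon> / (b u + 1)) ` I'))"
    have \<delta>: "\<delta> > 0" unfolding \<delta>_def using I' b0
      by (subst Min_gr_iff) (auto simp: I_def intro!: divide_pos_pos add_nonneg_pos)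
    have \<delta>le: "\<delta> * (b u + 1) \<le> \<epsilon>" if "(g, u, \<epsilon>) \<in> I'" for g u \<epsilon>
    proof -
      have "\<delta> \<le> \<epsilon> / (b u + 1)" unfolding \<delta>_def using I' that by (intro Min_le) force+
      then show ?thesis using b0[of u] by (simp add: le_divide_eq split: if_splits)
    qed
    obtain m where m: "mean_on G m" and mF: "\<forall>g\<in>fst ` I'. \<forall>u. (\<forall>x\<in>carrier G. \<bar>u x\<bar> \<le> 1) \<longrightarrow>
        \<bar>m (\<lambda>x. u (g \<otimes> x)) - m u\<bar> \<le> \<delta>"
      using approx[of "fst ` I'" \<delta>] I' \<delta> by (force simp: I_def)
    \<comment> \<open>Resetting the irrelevant values to 0 places the mean in
      \<open>Z\<close>.\<close>
    define m' where "m' = (\<lambda>u. if ?bd u then m u else 0)"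
    have m': "m' u = m u" if "?bd u" for u using that by (simp add: m'_def)
    have "mean_on G m'"
      using m by (simp add: mean_on_def m' bounded_real_add bounded_real_scale bounded_real_const)
    moreover have "m' \<in> Z"
    proof -
      have "\<bar>m' u\<bar> \<le> b u" for u
        using mean_abs_le[OF m, of u "b u"] b[of u] b0[of u] by (cases "?bd u") (auto simp: m'_def)
      then show ?thesis by (auto simp: Z_def abs_le_iff minus_le_iff)
    qed
    moreover have "m' \<in> f i" if i: "i \<in> I'" for i
    proof -
      obtain g u \<epsilon> where i': "i = (g, u, \<epsilon>)" by (cases i)
      have g: "g \<in> carrier G" "?bd u" using i I' Q by (auto simp: i' I_def)
      define B where "B = b u + 1"
      have B: "B > 0" using b0[of u] by (simp add: B_def)
      define w where "w = (\<lambda>x. (1 / B) * u x)"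
      have w: "?bd w" unfolding w_def by (rule bounded_real_scale[OF g(2)])
      have "\<bar>w x\<bar> \<le> 1" if "x \<in> carrier G" for x
        using b[OF g(2) that] B by (simp add: w_def abs_mult B_def divide_le_eq)
      then have "\<bar>m (\<lambda>x. w (g \<otimes> x)) - m w\<bar> \<le> \<delta>" using mF i i' by force
      moreover have "m w = (1 / B) * m u" unfolding w_def by (rule mean_scale[OF m g(2)])
      moreover have "m (\<lambda>x. w (g \<otimes> x)) = (1 / B) * m (\<lambda>x. u (g \<otimes> x))"
        unfolding w_def by (rule mean_scale[OF m bounded_translate[OF g(2,1)]])
      ultimately have "\<bar>(1 / B) * (m (\<lambda>x. u (g \<otimes> x)) - m u)\<bar> \<le> \<delta>" by (simp add: right_diff_distrib)
      then have "\<bar>m (\<lambda>x. u (g \<otimes> x)) - m u\<bar> \<le> \<delta> * B" using B by (simp add: abs_mult divide_le_eq)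
      also have "\<dots> \<le> \<epsilon>" unfolding B_def by (rule \<delta>le) (use i i' in simp)
      finally show ?thesis using g by (simp add: f_def i' m' bounded_translate)
    qed
    ultimately show "Z \<inter> {m. mean_on G m} \<inter> (\<Inter>i\<in>I'. f i) \<noteq> {}" by blast
  qed
  then obtain m where m: "mean_on G m" and mf: "\<And>i. i \<in> I \<Longrightarrow> m \<in> f i" by blast
  have "m (\<lambda>x. u (g \<otimes> x)) = m u" if "g \<in> Q" "?bd u" for g u
  proof -
    have "\<bar>m (\<lambda>x. u (g \<otimes> x)) - m u\<bar> \<le> 0 + \<epsilon>" if "\<epsilon> > 0" for \<epsilon>
      using mf[of "(g, u, \<epsilon>)"] \<open>g \<in> Q\<close> \<open>?bd u\<close> that by (simp add: I_def f_def)
    then have "\<bar>m (\<lambda>x. u (g \<otimes> x)) - m u\<bar> \<le> 0" by (rule field_le_epsilon)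
    then show ?thesis by simp
  qed
  with m show ?thesis by (auto simp: invariant_mean_def)
qed

section \<open>Permanence properties of invariant means\<close>

context group
begin

text \<open>The means obtained for different finite sets need not be related to each other;
  compactness extracts one that serves all of them.\<close>

lemma invariant_mean_directed:
  assumes Q: "Q \<subseteq> carrier G"
    and F: "\<And>F. finite F \<Longrightarrow> F \<subseteq> Q \<Longrightarrow> \<exists>m. invariant_mean G F m"
  shows "\<exists>m. invariant_mean G Q m"
proof (rule invariant_mean_compactness[OF is_group Q])
  fix F and \<epsilon> :: real assume "finite F" "F \<subseteq> Q" and \<epsilon>: "\<epsilon> > 0"
  then obtain m where m: "invariant_mean G F m" using F by blast
  have "\<bar>m (\<lambda>x. u (g \<otimes> x)) - m u\<bar> \<le> \<epsilon>" if "g \<in> F" "\<forall>x\<in>carrier G. \<bar>u x\<bar> \<le> 1" for g u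
  proof -
    have "bounded (u ` carrier G)" using that(2) by (auto simp: bounded_real_image_iff)
    then show ?thesis using m that(1) \<epsilon> by (simp add: invariant_mean_def)
  qed
  then show "\<exists>m. mean_on G m \<and>
      (\<forall>g\<in>F. \<forall>u. (\<forall>x\<in>carrier G. \<bar>u x\<bar> \<le> 1) \<longrightarrow> \<bar>m (\<lambda>x. u (g \<otimes> x)) - m u\<bar> \<le> \<epsilon>)"
    using m by (auto simp: invariant_mean_def)
qed

lemma invariant_mean_empty: "\<exists>m. invariant_mean G {} m"
  by (rule exI[of _ "\<lambda>u. u \<one>"]) (simp add: invariant_mean_def mean_on_def)

lemma invariant_mean_mult:
  assumes m: "invariant_mean G F m" and F: "F \<subseteq> carrier G" and a: "a \<in> F" "b \<in> F" and u: "bounded (u ` carrier G)"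
  shows "m (\<lambda>x. u (a \<otimes> b \<otimes> x)) = m u"
proof -
  have aG: "a \<in> carrier G" and bG: "b \<in> carrier G" using F a by auto
  have mm: "mean_on G m" using m by (simp add: invariant_mean_def)
  have "m (\<lambda>x. u (a \<otimes> b \<otimes> x)) = m (\<lambda>x. u (a \<otimes> (b \<otimes> x)))"
    by (rule mean_cong[OF mm bounded_translate[OF u]]) (use aG bG in \<open>auto simp: m_assoc\<close>)
  also have "\<dots> = m (\<lambda>x. u (a \<otimes> x))"
    using m a bounded_translate[OF u aG] unfolding invariant_mean_def by blast
  also have "\<dots> = m u" using m a u by (simp add: invariant_mean_def)
  finally show ?thesis .
qed

text \<open>The usual proof that extensions of amenable groups are amenable: first average over
  translates by \<open>\<phi> q\<close> with m, then over q with mQ. Invariance under K survives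
  because conjugation by \<open>\<phi> q\<close> maps K into itself; invariance under the image of Q
  is that of mQ.\<close>

lemma invariant_mean_extend:
  assumes Q: "group Q" and \<phi>: "\<phi> \<in> hom Q G" and mQ: "left_invariant_mean Q mQ"
    and m: "invariant_mean G K m" and K: "K \<subseteq> carrier G"
    and norm: "\<And>q k. q \<in> carrier Q \<Longrightarrow> k \<in> K \<Longrightarrow> inv (\<phi> q) \<otimes> k \<otimes> \<phi> q \<in> K"
  shows "\<exists>m'. invariant_mean G (K \<union> \<phi> ` carrier Q) m'"
proof -
  interpret Q: group Q by (rule Q)
  have mm: "mean_on G m" using m by (simp add: invariant_mean_def)
  have mmQ: "mean_on Q mQ" using mQ by (simp add: left_invariant_mean_iff invariant_mean_def)
  have \<phi>G: "\<phi> q \<in> carrier G" if "q \<in> carrier Q" for q using \<phi> that by (auto simp: hom_def)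
  define T where "T = (\<lambda>u q. m (\<lambda>x. u (\<phi> q \<otimes> x)))"
  have Tb: "bounded (T u ` carrier Q)" if u: "bounded (u ` carrier G)" for u
  proof -
    obtain B where B: "\<And>x. x \<in> carrier G \<Longrightarrow> \<bar>u x\<bar> \<le> B" using u by (auto simp: bounded_real_image_iff)
    have "\<bar>T u q\<bar> \<le> B" if "q \<in> carrier Q" for q
      unfolding T_def by (rule mean_abs_le[OF mm]) (use B \<phi>G[OF that] in auto)
    then show ?thesis by (auto simp: bounded_real_image_iff)
  qed
  have tr: "bounded ((\<lambda>x. u (\<phi> q \<otimes> x)) ` carrier G)" if "bounded (u ` carrier G)" "q \<in> carrier Q" for u q
    by (rule bounded_translate[OF that(1) \<phi>G[OF that(2)]])
  define m' where "m' = (\<lambda>u. mQ (T u))"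
  have "mean_on G m'"
    unfolding mean_on_def
  proof (intro conjI allI impI)
    fix u v :: "'a \<Rightarrow> real" assume u: "bounded (u ` carrier G)" and v: "bounded (v ` carrier G)"
    have "mQ (T (\<lambda>x. u x + v x)) = mQ (\<lambda>q. T u q + T v q)"
      by (rule mean_cong[OF mmQ Tb[OF bounded_real_add[OF u v]]]) (simp add: T_def mean_add[OF mm tr[OF u] tr[OF v]])
    then show "m' (\<lambda>x. u x + v x) = m' u + m' v"
      by (simp add: m'_def mean_add[OF mmQ Tb[OF u] Tb[OF v]])
  next
    fix c and u :: "'a \<Rightarrow> real" assume u: "bounded (u ` carrier G)"
    have "mQ (T (\<lambda>x. c * u x)) = mQ (\<lambda>q. c * T u q)"
      by (rule mean_cong[OF mmQ Tb[OF bounded_real_scale[OF u]]]) (simp add: T_def mean_scale[OF mm tr[OF u]])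
    then show "m' (\<lambda>x. c * u x) = c * m' u"
      by (simp add: m'_def mean_scale[OF mmQ Tb[OF u]])
  next
    fix u :: "'a \<Rightarrow> real" assume u: "bounded (u ` carrier G)" and "\<forall>x\<in>carrier G. 0 \<le> u x"
    then show "0 \<le> m' u" unfolding m'_def
      by (intro mean_nonneg[OF mmQ Tb[OF u]]) (auto simp: T_def \<phi>G intro!: mean_nonneg[OF mm] tr)
  next
    show "m' (\<lambda>x. 1) = 1" by (simp add: m'_def T_def mean_const[OF mm] mean_const[OF mmQ])
  qed
  moreover have "m' (\<lambda>x. u (k \<otimes> x)) = m' u" if k: "k \<in> K" and u: "bounded (u ` carrier G)" for k u
    unfolding m'_def
  proof (rule mean_cong[OF mmQ Tb[OF bounded_translate[OF u]]])
    show kG: "k \<in> carrier G" using k K by blast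
    fix q assume q: "q \<in> carrier Q"
    note qG = \<phi>G[OF q]
    let ?k = "inv (\<phi> q) \<otimes> k \<otimes> \<phi> q"
    have inv: "m (\<lambda>x. v (?k \<otimes> x)) = m v" if "bounded (v ` carrier G)" for v
      using m norm[OF q k] that unfolding invariant_mean_def by blast
    have "T (\<lambda>x. u (k \<otimes> x)) q = m (\<lambda>x. u (\<phi> q \<otimes> (?k \<otimes> x)))"
      unfolding T_def
    proof (rule mean_cong[OF mm tr[OF bounded_translate[OF u kG] q]])
      fix x assume x: "x \<in> carrier G"
      \<comment> \<open>The translation by k moves past \<open>\<phi> q\<close> as its conjugate
        \<open>?k\<close>, under which m is invariant.\<close>
      have "\<phi> q \<otimes> (?k \<otimes> x) = (\<phi> q \<otimes> inv (\<phi> q)) \<otimes> (k \<otimes> (\<phi> q \<otimes> x))"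
        using x kG qG by (simp add: m_assoc mult_inv_cancel)
      then show "u (k \<otimes> (\<phi> q \<otimes> x)) = u (\<phi> q \<otimes> (?k \<otimes> x))" using x kG qG by simp
    qed
    also have "\<dots> = T u q"
      using inv[OF tr[OF u q]] by (simp add: T_def)
    finally show "T (\<lambda>x. u (k \<otimes> x)) q = T u q" .
  qed
  moreover have "m' (\<lambda>x. u (\<phi> p \<otimes> x)) = m' u" if p: "p \<in> carrier Q" and u: "bounded (u ` carrier G)" for p u
  proof -
    have "mQ (T (\<lambda>x. u (\<phi> p \<otimes> x))) = mQ (\<lambda>q. T u (p \<otimes>\<^bsub>Q\<^esub> q))"
    proof (rule mean_cong[OF mmQ Tb[OF tr[OF u p]]])
      fix q assume q: "q \<in> carrier Q"
      have "\<phi> (p \<otimes>\<^bsub>Q\<^esub> q) = \<phi> p \<otimes> \<phi> q" using \<phi> p q by (simp add: hom_def)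
      then show "T (\<lambda>x. u (\<phi> p \<otimes> x)) q = T u (p \<otimes>\<^bsub>Q\<^esub> q)"
        unfolding T_def by (intro mean_cong[OF mm tr[OF tr[OF u p] q]]) (use p q in \<open>simp add: m_assoc \<phi>G\<close>)
    qed
    also have "\<dots> = mQ (T u)"
      using mQ p Tb[OF u] by (simp add: left_invariant_mean_iff invariant_mean_def)
    finally show ?thesis by (simp add: m'_def)
  qed
  ultimately have "invariant_mean G (K \<union> \<phi> ` carrier Q) m'" by (auto simp: invariant_mean_def)
  then show ?thesis by blast
qed

text \<open>Averaging over the powers g^0, ..., g^(N-1), a Folner set of the cyclic group, makes m
  almost invariant under g, as only the two ends of the sum survive. Invariance under J is kept
  exactly, since a conjugate of f by a power of g is again a composite of translations in J. The
  product of two factors is the form in which commutators deliver it.\<close>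

lemma invariant_mean_power:
  assumes g: "g \<in> carrier G" and m: "invariant_mean G J m" and J: "J \<subseteq> carrier G"
    and norm: "\<And>f i. f \<in> J \<Longrightarrow> \<exists>a\<in>J. \<exists>b\<in>J. inv (g [^] (i::nat)) \<otimes> f \<otimes> g [^] i = a \<otimes> b"
  shows "\<exists>m'. invariant_mean G (insert g J) m'"
proof (rule invariant_mean_compactness[OF is_group])
  show "insert g J \<subseteq> carrier G" using g J by blast
  fix F and \<epsilon> :: real assume F: "finite F" "F \<subseteq> insert g J" and \<epsilon>: "\<epsilon> > 0"
  have mm: "mean_on G m" using m by (simp add: invariant_mean_def)
  \<comment> \<open>The two surviving end terms have absolute value at most 1, so the error is at
    most 2 / N.\<close>
  obtain N :: nat where N: "2 / \<epsilon> < N" using reals_Archimedean2 by blast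
  have N0: "real N > 0" using N \<epsilon> by (smt (verit) divide_pos_pos)
  have tr: "bounded ((\<lambda>x. u (g [^] i \<otimes> x)) ` carrier G)" if "bounded (u ` carrier G)" for u and i :: nat
    by (rule bounded_translate[OF that]) (simp add: g)
  define m' where "m' = (\<lambda>u. (\<Sum>i<N. m (\<lambda>x. u (g [^] i \<otimes> x))) / N)"
  have "mean_on G m'"
    unfolding mean_on_def
  proof (intro conjI allI impI)
    fix u v :: "'a \<Rightarrow> real" assume u: "bounded (u ` carrier G)" and v: "bounded (v ` carrier G)"
    show "m' (\<lambda>x. u x + v x) = m' u + m' v"
      by (simp add: m'_def mean_add[OF mm tr[OF u] tr[OF v]] sum.distrib add_divide_distrib)
  next
    fix c and u :: "'a \<Rightarrow> real" assume u: "bounded (u ` carrier G)"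
    show "m' (\<lambda>x. c * u x) = c * m' u"
      by (simp add: m'_def mean_scale[OF mm tr[OF u]] sum_distrib_left)
  next
    fix u :: "'a \<Rightarrow> real" assume u: "bounded (u ` carrier G)" and "\<forall>x\<in>carrier G. 0 \<le> u x"
    then show "0 \<le> m' u" unfolding m'_def
      by (intro divide_nonneg_nonneg sum_nonneg mean_nonneg[OF mm tr[OF u]]) (auto simp: g)
  next
    show "m' (\<lambda>x. 1) = 1" using N0 by (simp add: m'_def mean_const[OF mm])
  qed
  moreover have "\<bar>m' (\<lambda>x. u (f \<otimes> x)) - m' u\<bar> \<le> \<epsilon>"
    if f: "f \<in> F" and u1: "\<forall>x\<in>carrier G. \<bar>u x\<bar> \<le> 1" for f u
  proof -
    have u: "bounded (u ` carrier G)" using u1 by (auto simp: bounded_real_image_iff)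
    consider "f \<in> J" | "f = g" using f F by blast
    then show ?thesis
    proof cases
      case 1
      have fG: "f \<in> carrier G" using 1 J by blast
      have "m (\<lambda>x. u (f \<otimes> (g [^] i \<otimes> x))) = m (\<lambda>x. u (g [^] i \<otimes> x))" for i :: nat
      proof -
        obtain a b where ab: "a \<in> J" "b \<in> J" "inv (g [^] i) \<otimes> f \<otimes> g [^] i = a \<otimes> b" using norm[OF 1] by blast
        have "m (\<lambda>x. u (f \<otimes> (g [^] i \<otimes> x))) = m (\<lambda>x. u (g [^] i \<otimes> (a \<otimes> b \<otimes> x)))"
        proof (rule mean_cong[OF mm tr[OF bounded_translate[OF u fG]]])
          fix x assume x: "x \<in> carrier G"
          have "g [^] i \<otimes> (a \<otimes> b \<otimes> x) = (g [^] i \<otimes> inv (g [^] i)) \<otimes> (f \<otimes> (g [^] i \<otimes> x))"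
            unfolding ab(3)[symmetric] using x fG g by (simp add: m_assoc mult_inv_cancel)
          then show "u (f \<otimes> (g [^] i \<otimes> x)) = u (g [^] i \<otimes> (a \<otimes> b \<otimes> x))" using x fG g by simp
        qed
        also have "\<dots> = m (\<lambda>x. u (g [^] i \<otimes> x))"
          by (rule invariant_mean_mult[OF m J ab(1,2) tr[OF u]])
        finally show ?thesis .
      qed
      then show ?thesis using \<epsilon> by (simp add: m'_def)
    next
      case 2
      define s where "s = (\<lambda>i::nat. m (\<lambda>x. u (g [^] i \<otimes> x)))"
      have s1: "\<bar>s i\<bar> \<le> 1" for i unfolding s_def by (rule mean_abs_le[OF mm]) (use u1 g in auto)
      have "m (\<lambda>x. u (g \<otimes> (g [^] i \<otimes> x))) = s (Suc i)" for i :: nat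
        unfolding s_def by (rule mean_cong[OF mm tr[OF bounded_translate[OF u g]]])
          (use g in \<open>simp add: m_assoc[symmetric] nat_pow_Suc2[symmetric] del: nat_pow_Suc\<close>)
      then have "m' (\<lambda>x. u (f \<otimes> x)) - m' u = ((\<Sum>i<N. s (Suc i)) - (\<Sum>i<N. s i)) / N"
        by (simp add: m'_def 2 s_def diff_divide_distrib)
      also have "\<dots> = (s N - s 0) / N"
        by (simp add: sum_lessThan_telescope sum_subtractf[symmetric])
      finally have "\<bar>m' (\<lambda>x. u (f \<otimes> x)) - m' u\<bar> = \<bar>s N - s 0\<bar> / N" by simp
      also have "\<dots> \<le> 2 / N" using s1[of N] s1[of 0] by (intro divide_right_mono) auto
      also have "\<dots> \<le> \<epsilon>" using N \<epsilon> N0 by (simp add: field_simps)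
      finally show ?thesis .
    qed
  qed
  ultimately show "\<exists>m. mean_on G m \<and>
      (\<forall>g\<in>F. \<forall>u. (\<forall>x\<in>carrier G. \<bar>u x\<bar> \<le> 1) \<longrightarrow> \<bar>m (\<lambda>x. u (g \<otimes> x)) - m u\<bar> \<le> \<epsilon>)"
    by blast
qed

text \<open>Elements are adjoined one at a time. A conjugate of f by a power of g is f times a
  commutator, and commutators lie in K, which is the product form required by
  \<open>invariant_mean_power\<close>. This replaces the amenability of the abelian
  quotient.\<close>

lemma amenable_of_commutators:
  assumes K: "K \<subseteq> carrier G" and m: "invariant_mean G K m"
    and comm: "\<And>x y. x \<in> carrier G \<Longrightarrow> y \<in> carrier G \<Longrightarrow> inv x \<otimes> inv y \<otimes> x \<otimes> y \<in> K"
  shows "\<exists>m. left_invariant_mean G m"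
  unfolding left_invariant_mean_iff
proof (rule invariant_mean_directed[OF order_refl])
  fix F assume "finite F" "F \<subseteq> carrier G"
  then have "\<exists>m. invariant_mean G (K \<union> F) m"
  proof (induction F)
    case empty
    then show ?case using m by auto
  next
    case (insert g F)
    then obtain m where m: "invariant_mean G (K \<union> F) m" by blast
    have g: "g \<in> carrier G" and KF: "K \<union> F \<subseteq> carrier G" using insert K by auto
    have "\<exists>m'. invariant_mean G (insert g (K \<union> F)) m'"
    proof (rule invariant_mean_power[OF g m KF])
      fix f and i :: nat assume f: "f \<in> K \<union> F"
      have fG: "f \<in> carrier G" using f KF by blast
      have "f \<otimes> (inv f \<otimes> inv (g [^] i) \<otimes> f \<otimes> g [^] i) = (f \<otimes> inv f) \<otimes> (inv (g [^] i) \<otimes> f \<otimes> g [^] i)"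
        using fG g by (simp add: m_assoc mult_inv_cancel)
      then have "inv (g [^] i) \<otimes> f \<otimes> g [^] i = f \<otimes> (inv f \<otimes> inv (g [^] i) \<otimes> f \<otimes> g [^] i)"
        using fG g by simp
      moreover have "inv f \<otimes> inv (g [^] i) \<otimes> f \<otimes> g [^] i \<in> K" using comm[OF fG, of "g [^] i"] g by simp
      ultimately show "\<exists>a\<in>K \<union> F. \<exists>b\<in>K \<union> F. inv (g [^] i) \<otimes> f \<otimes> g [^] i = a \<otimes> b" using f by blast
    qed
    then show ?case by simp
  qed
  then show "\<exists>m. invariant_mean G F m" by (auto simp: invariant_mean_def)
qed

lemma finite_group_mean:
  assumes "finite (carrier G)" shows "\<exists>m. left_invariant_mean G m"
proof
  let ?m = "\<lambda>u. (\<Sum>x\<in>carrier G. u x) / card (carrier G)"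
  have c: "real (card (carrier G)) > 0" using assms one_closed by (auto simp: card_gt_0_iff)
  have "(\<Sum>x\<in>carrier G. u (g \<otimes> x)) = (\<Sum>x\<in>carrier G. u x)" if g: "g \<in> carrier G" for g and u :: "'a \<Rightarrow> real"
    by (rule sum.reindex_bij_betw, rule bij_betwI[where g = "\<lambda>x. inv g \<otimes> x"]) (use g in \<open>auto simp: m_assoc[symmetric]\<close>)
  then show "left_invariant_mean G ?m"
    using c by (auto simp: left_invariant_mean_iff invariant_mean_def mean_on_def sum.distrib add_divide_distrib
        sum_distrib_left[symmetric] intro!: divide_nonneg_nonneg sum_nonneg)
qed

end

section \<open>Maximal subalgebras\<close>

text \<open>Uniqueness makes the chosen projections linear in u; <u, P u> = |P u|^2 together with
  Cauchy-Schwarz makes them contractive.\<close>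

lemma projection_op_ex:
  assumes V: "ell2_subspace S V"
  obtains P where "P \<in> bounded_ops S" "\<And>u. u \<in> ell2 S \<Longrightarrow> P u \<in> ell2_closure S V"
    "\<And>u v. u \<in> ell2 S \<Longrightarrow> v \<in> ell2_closure S V \<Longrightarrow> ell2_inner S (\<lambda>x. u x - P u x) v = 0"
proof -
  let ?W = "ell2_closure S V"
  let ?pr = "\<lambda>u p. p \<in> ?W \<and> (\<forall>v\<in>?W. ell2_inner S (\<lambda>x. u x - p x) v = 0)"
  have W: "ell2_subspace S ?W" by (rule ell2_subspace_closure[OF V])
  define P where "P = (\<lambda>u\<in>ell2 S. SOME p. ?pr u p)"
  have pr: "?pr u (P u)" if "u \<in> ell2 S" for u
  proof -
    obtain p where "p \<in> ?W" "\<And>v. v \<in> ?W \<Longrightarrow> ell2_inner S (\<lambda>x. u x - p x) v = 0"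
      using ell2_projection[OF V \<open>u \<in> ell2 S\<close>] by metis
    then have "?pr u p" by blast
    then show ?thesis using that by (simp add: P_def) (rule someI[of "?pr u"])
  qed
  have PS: "P u \<in> ell2 S" if "u \<in> ell2 S" for u using pr[OF that] by (blast dest: ell2_closureD)
  have uniq: "P u = p" if "u \<in> ell2 S" "p \<in> ?W" "\<And>v. v \<in> ?W \<Longrightarrow> ell2_inner S (\<lambda>x. u x - p x) v = 0" for u p
    by (rule ell2_projection_unique[OF V that(1)]) (use pr[OF that(1)] that in auto)
  have "P \<in> bounded_ops S"
  proof (rule bounded_opsI[where C = 1])
    show "P \<in> extensional (ell2 S)" by (simp add: P_def)
    show "P u \<in> ell2 S" if "u \<in> ell2 S" for u by (rule PS[OF that])
    show "P (\<lambda>x. u x + v x) = (\<lambda>x. P u x + P v x)" if u: "u \<in> ell2 S" and v: "v \<in> ell2 S" for u v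
    proof (rule uniq)
      show "(\<lambda>x. u x + v x) \<in> ell2 S" using u v by simp
      show "(\<lambda>x. P u x + P v x) \<in> ?W" using pr[OF u] pr[OF v] by (intro ell2_subspace_add[OF W]) auto
      fix w assume w: "w \<in> ?W"
      have "ell2_inner S (\<lambda>x. (u x - P u x) + (v x - P v x)) w = 0"
        using pr[OF u] pr[OF v] u v w PS
        by (subst ell2_inner_add_left) (auto dest: ell2_closureD)
      then show "ell2_inner S (\<lambda>x. (u x + v x) - (P u x + P v x)) w = 0" by (simp add: algebra_simps)
    qed
    show "P (\<lambda>x. c * u x) = (\<lambda>x. c * P u x)" if u: "u \<in> ell2 S" for c u
    proof (rule uniq)
      show "(\<lambda>x. c * u x) \<in> ell2 S" using u by simp
      show "(\<lambda>x. c * P u x) \<in> ?W" using pr[OF u] by (intro ell2_subspace_scale[OF W]) auto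
      fix w assume w: "w \<in> ?W"
      have "ell2_inner S (\<lambda>x. c * (u x - P u x)) w = 0"
        using pr[OF u] w by (simp only: ell2_inner_scale_left) simp
      then show "ell2_inner S (\<lambda>x. c * u x - c * P u x) w = 0" by (simp add: right_diff_distrib)
    qed
    show "ell2_norm S (P u) \<le> 1 * ell2_norm S u" if u: "u \<in> ell2 S" for u
    proof -
      have "ell2_inner S u (P u) - ell2_inner S (P u) (P u) = 0"
        using pr[OF u] ell2_inner_diff_left[OF u PS[OF u] PS[OF u]] by simp
      then have "cmod (ell2_inner S u (P u)) = (ell2_norm S (P u))\<^sup>2" by (simp add: ell2_inner_self norm_power)
      then have "ell2_norm S (P u) * ell2_norm S (P u) \<le> ell2_norm S u * ell2_norm S (P u)"
        using ell2_Cauchy_Schwarz[OF u PS[OF u]] by (simp add: power2_eq_square)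
      then show ?thesis
        using mult_right_le_imp_le[of "ell2_norm S (P u)" "ell2_norm S (P u)" "ell2_norm S u"]
        by (cases "ell2_norm S (P u) = 0") (simp_all add: less_le)
    qed
  qed
  with pr show ?thesis using that by blast
qed

text \<open>Serves the denominator in the coupling constant. The closure of M\<xi> is stable under M
  and its adjoints, so the projection onto it commutes with M; it contains \<xi> because M contains
  the identity, so the projection is nonzero for nonzero \<xi>.\<close>

lemma cyclic_projection:
  assumes M: "von_neumann_algebra S M" and \<xi>: "\<xi> \<in> ell2 S"
  shows "op_projection S (cyclic_projection S M \<xi>)" "cyclic_projection S M \<xi> \<in> commutant S M"
    "cyclic_projection S M \<xi> \<xi> = \<xi>"
proof -
  have MB: "M \<subseteq> bounded_ops S" and Madj: "\<And>T. T \<in> M \<Longrightarrow> op_adj S T \<in> M"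
    and MM: "commutant S (commutant S M) = M" using M by (auto simp: von_neumann_algebra_def)
  note mcl = commutant_id[OF commutant_bounded[of S M]] commutant_add[OF commutant_bounded[of S M]]
    commutant_scale[OF commutant_bounded[of S M]] commutant_mult[OF commutant_bounded[of S M]]
  note mcl = mcl[unfolded MM]
  define V where "V = {T \<xi> | T. T \<in> M}"
  have VI: "T \<xi> \<in> V" if "T \<in> M" for T using that by (auto simp: V_def)
  have VE: "\<exists>T. T \<in> M \<and> v = T \<xi>" if "v \<in> V" for v using that by (auto simp: V_def)
  have VS: "V \<subseteq> ell2 S" using MB op_in_ell2[OF _ \<xi>] by (auto simp: V_def)
  have V: "ell2_subspace S V"
    unfolding ell2_subspace_def
  proof (intro conjI VS ballI allI)
    show "(\<lambda>x. 0) \<in> V" using VI[OF mcl(3)[OF mcl(1), of 0]] by (simp add: op_scale_apply \<xi>)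
    fix u assume "u \<in> V"
    then obtain A where A: "A \<in> M" "u = A \<xi>" using VE by blast
    show "(\<lambda>x. c * u x) \<in> V" for c
      using VI[OF mcl(3)[OF A(1), of c]] by (simp add: op_scale_apply \<xi> A(2))
    fix v assume "v \<in> V"
    then obtain B where B: "B \<in> M" "v = B \<xi>" using VE by blast
    show "(\<lambda>x. u x + v x) \<in> V"
      using VI[OF mcl(2)[OF A(1) B(1)]] by (simp add: op_add_apply \<xi> A(2) B(2))
  qed
  let ?W = "ell2_closure S V"
  obtain P where P: "P \<in> bounded_ops S" and PW: "\<And>u. u \<in> ell2 S \<Longrightarrow> P u \<in> ?W"
    and Po: "\<And>u v. u \<in> ell2 S \<Longrightarrow> v \<in> ?W \<Longrightarrow> ell2_inner S (\<lambda>x. u x - P u x) v = 0"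
    using projection_op_ex[OF V] by metis
  note PS = op_in_ell2[OF P]
  have WS: "v \<in> ell2 S" if "v \<in> ?W" for v using that by (rule ell2_closureD)
  have uniq: "P u = p" if "u \<in> ell2 S" "p \<in> ?W" "\<And>v. v \<in> ?W \<Longrightarrow> ell2_inner S (\<lambda>x. u x - p x) v = 0" for u p
    by (rule ell2_projection_unique[OF V that(1) PW[OF that(1)] Po[OF that(1)] that(2,3)])
  have Pid: "P u = u" if "u \<in> ?W" for u
    by (rule uniq[OF WS[OF that] that]) simp
  have Pin: "ell2_inner S u v = ell2_inner S (P u) v" if "u \<in> ell2 S" "v \<in> ?W" for u v
    using Po[OF that] ell2_inner_diff_left[OF that(1) PS[OF that(1)] WS[OF that(2)]] by simp
  have Padj: "op_adj S P = P"
  proof (rule op_adj_eqI[OF P P])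
    fix u v assume u: "u \<in> ell2 S" and v: "v \<in> ell2 S"
    have "ell2_inner S (P u) v = cnj (ell2_inner S v (P u))" by (rule ell2_inner_commute)
    also have "\<dots> = cnj (ell2_inner S (P v) (P u))" by (simp add: Pin[OF v PW[OF u]])
    also have "\<dots> = ell2_inner S (P u) (P v)" by (rule ell2_inner_commute[symmetric])
    also have "\<dots> = ell2_inner S u (P v)" by (simp add: Pin[OF u PW[OF v]])
    finally show "ell2_inner S (P u) v = ell2_inner S u (P v)" .
  qed
  have proj: "op_projection S P"
    using P Padj by (auto simp: op_projection_def op_mult_apply Pid[OF PW] intro!: op_eqI[of _ S])
  have im: "P ` ell2 S = ?W"
    using PW Pid WS by (auto simp: image_iff) metis
  have eq: "cyclic_projection S M \<xi> = P"
    unfolding cyclic_projection_def V_def[symmetric]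
  proof (rule the_equality)
    show "op_projection S P \<and> P ` ell2 S = ?W" using proj im by blast
    \<comment> \<open>A self-adjoint idempotent Q annihilates u - Q u, so u - Q u is orthogonal to
      the range; projections with equal ranges therefore coincide.\<close>
    fix Q assume "op_projection S Q \<and> Q ` ell2 S = ?W"
    then have Q: "Q \<in> bounded_ops S" "op_adj S Q = Q" "op_mult S Q Q = Q" and Qim: "Q ` ell2 S = ?W"
      by (auto simp: op_projection_def)
    note QS = op_in_ell2[OF Q(1)]
    have QQ: "Q (Q u) = Q u" if "u \<in> ell2 S" for u using fun_cong[OF Q(3), of u] that by (simp add: op_mult_apply)
    show "Q = P"
    proof (rule op_eqI[OF Q(1) P])
      fix u assume u: "u \<in> ell2 S"
      have "P u = Q u"
      proof (rule uniq[OF u])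
        show "Q u \<in> ?W" using Qim u by blast
        fix v assume "v \<in> ?W"
        then obtain w where w: "w \<in> ell2 S" "v = Q w" using Qim by blast
        have "ell2_inner S (\<lambda>x. u x - Q u x) v = ell2_inner S (Q (\<lambda>x. u x - Q u x)) w"
          using op_adj_inner[OF Q(1) ell2_diff[OF u QS[OF u]] w(1)] by (simp add: w(2) Q(2))
        also have "Q (\<lambda>x. u x - Q u x) = (\<lambda>x. 0)" by (simp add: op_vec_diff[OF Q(1) u QS[OF u]] QQ[OF u])
        finally show "ell2_inner S (\<lambda>x. u x - Q u x) v = 0" by simp
      qed
      then show "Q u = P u" by simp
    qed
  qed
  show "op_projection S (cyclic_projection S M \<xi>)" using eq proj by simp
  have MV: "T v \<in> V" if T: "T \<in> M" and "v \<in> V" for T v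
  proof -
    obtain A where A: "A \<in> M" "v = A \<xi>" using VE \<open>v \<in> V\<close> by blast
    show ?thesis using VI[OF mcl(4)[OF T A(1)]] by (simp add: op_mult_apply \<xi> A(2))
  qed
  have "P (T u) = T (P u)" if T: "T \<in> M" and u: "u \<in> ell2 S" for T u
  proof (rule uniq)
    have TB: "T \<in> bounded_ops S" using T MB by blast
    show Tu: "T u \<in> ell2 S" by (rule op_in_ell2[OF TB u])
    show "T (P u) \<in> ?W" by (rule ell2_closure_op[OF TB VS MV[OF T] PW[OF u]])
    fix v assume v: "v \<in> ?W"
    have av: "op_adj S T v \<in> ?W"
      by (rule ell2_closure_op[OF op_adj_in[OF TB] VS MV[OF Madj[OF T]] v])
    have "(\<lambda>x. T u x - T (P u) x) = T (\<lambda>x. u x - P u x)" by (simp add: op_vec_diff[OF TB u PS[OF u]])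
    then have "ell2_inner S (\<lambda>x. T u x - T (P u) x) v = ell2_inner S (\<lambda>x. u x - P u x) (op_adj S T v)"
      using op_adj_inner[OF TB ell2_diff[OF u PS[OF u]] WS[OF v]] by simp
    also have "\<dots> = 0" by (rule Po[OF u av])
    finally show "ell2_inner S (\<lambda>x. T u x - T (P u) x) v = 0" .
  qed
  then show "cyclic_projection S M \<xi> \<in> commutant S M"
    using eq P by (simp add: commutant_iff[OF MB])
  have "\<xi> \<in> V" using VI[OF mcl(1)] by (simp add: op_id_apply \<xi>)
  then show "cyclic_projection S M \<xi> \<xi> = \<xi>" using eq Pid ell2_closure_superset[OF VS] by simp
qed

section \<open>Algebras between L(K) and the group algebra\<close>

context group
begin

lemma group_vn_eq: "group_vn G = right_vn G"
  unfolding group_vn_def subgroup_vn_eq[OF subgroup_self] by simp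

lemma bij_mult_inv: 
  assumes "k \<in> carrier G" shows "bij_betw (\<lambda>x. k \<otimes> inv x) (carrier G) (carrier G)"
  by (rule bij_betwI[where g = "\<lambda>y. inv y \<otimes> k"])
    (use assms in \<open>auto simp: inv_mult_group m_assoc[symmetric]\<close>, use assms in \<open>simp_all add: m_assoc\<close>)

text \<open>As the trace vector is tracial, \<open>p\<^sub>n\<delta> \<longlonglongrightarrow> x\<delta>\<close> forces both \<open>p\<^sub>n \<longlonglongrightarrow> x\<close> and \<open>p\<^sub>n\<^sup>* \<longlonglongrightarrow> x\<^sup>*\<close> on basis
  vectors, so that \<open>x\<close> commutes with the commutant of the \<open>p\<^sub>n\<close>.\<close>

lemma vn_mem_closure:
  assumes P: "von_neumann_algebra (carrier G) P" and PR: "P \<subseteq> right_vn G" and X: "X \<in> right_vn G"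
    and cl: "X (ket \<one>) \<in> ell2_closure (carrier G) ((\<lambda>T. T (ket \<one>)) ` P)"
  shows "X \<in> P"
proof -
  let ?S = "carrier G"
  have PB: "P \<subseteq> bounded_ops ?S" and PP: "commutant ?S (commutant ?S P) = P"
    using P by (auto simp: von_neumann_algebra_def)
  have XB: "X \<in> bounded_ops ?S" by (rule right_vn_bounded[OF X])
  have "op_mult ?S X T = op_mult ?S T X" if T: "T \<in> commutant ?S P" for T
  proof -
    have TB: "T \<in> bounded_ops ?S" and comm: "\<And>p u. p \<in> P \<Longrightarrow> u \<in> L2 \<Longrightarrow> T (p u) = p (T u)"
      using T by (auto simp: commutant_iff[OF PB])
    obtain C where C: "C \<ge> 0" "\<And>u. u \<in> L2 \<Longrightarrow> ell2_norm ?S (T u) \<le> C * ell2_norm ?S u"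
      using op_bound[OF TB] by blast
    show ?thesis
    proof (rule op_eq_ketI[OF op_mult_in[OF XB TB] op_mult_in[OF TB XB]])
      fix h k assume h: "h \<in> ?S" and k: "k \<in> ?S"
      have kh: "ket h \<in> L2" and kk: "ket k \<in> L2" using h k by auto
      define w where "w = T (ket h)"
      have w: "w \<in> L2" unfolding w_def by (rule op_in_ell2[OF TB kh])
      have "cmod (X w k - T (X (ket h)) k) \<le> 0 + \<epsilon>" if \<epsilon>: "\<epsilon> > 0" for \<epsilon>
      proof -
        \<comment> \<open>The two errors estimated below are C and |w| times the norm of
          \<open>D\<close>; the summand 1 keeps s positive.\<close>
        define s where "s = C + ell2_norm ?S w + 1"
        have s: "s > 0" using C(1) ell2_norm_nonneg[of ?S w] unfolding s_def by linarith
        have "\<epsilon> / s > 0" using s \<epsilon> by simp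
        then obtain p where p: "p \<in> P" and pD: "ell2_norm ?S (\<lambda>x. X (ket \<one>) x - p (ket \<one>) x) < \<epsilon> / s"
          using ell2_closure_approx[OF cl] by blast
        define D where "D = (\<lambda>x. X (ket \<one>) x - p (ket \<one>) x)"
        have pR: "p \<in> right_vn G" using p PR by blast
        have pB: "p \<in> bounded_ops ?S" by (rule right_vn_bounded[OF pR])
        note XS = op_in_ell2[OF XB] and pS = op_in_ell2[OF pB]
        \<comment> \<open>Every column of X - p is a right translate of the column at
          \<open>\<one>\<close>.\<close>
        have n1: "ell2_norm ?S (\<lambda>x. X (ket h) x - p (ket h) x) = ell2_norm ?S D"
        proof -
          have "(\<Sum>\<^sub>\<infinity>x\<in>?S. (cmod (X (ket h) x - p (ket h) x))\<^sup>2) = (\<Sum>\<^sub>\<infinity>x\<in>?S. (cmod (D (x \<otimes> inv h)))\<^sup>2)"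
            by (rule infsum_cong) (simp add: D_def right_vn_matrix[OF X h] right_vn_matrix[OF pR h])
          also have "\<dots> = (\<Sum>\<^sub>\<infinity>x\<in>?S. (cmod (D x))\<^sup>2)"
            by (rule infsum_reindex_bij_betw[OF bij_right_mult[OF inv_closed[OF h]]])
          finally show ?thesis by (simp add: ell2_norm_def)
        qed
        \<comment> \<open>Up to conjugation, row k of X - p is \<open>D\<close> composed with the
          bijection x to k x^{-1}. Traciality enters here: one norm controls the operator and its
          adjoint on basis vectors.\<close>
        have n2: "ell2_norm ?S (\<lambda>x. op_adj ?S X (ket k) x - op_adj ?S p (ket k) x) = ell2_norm ?S D"
        proof -
          have "(\<Sum>\<^sub>\<infinity>x\<in>?S. (cmod (op_adj ?S X (ket k) x - op_adj ?S p (ket k) x))\<^sup>2)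
              = (\<Sum>\<^sub>\<infinity>x\<in>?S. (cmod (D (k \<otimes> inv x)))\<^sup>2)"
          proof (rule infsum_cong)
            fix x assume x: "x \<in> ?S"
            have "op_adj ?S X (ket k) x - op_adj ?S p (ket k) x = cnj (D (k \<otimes> inv x))"
              by (simp add: op_adj_ket[OF XB x k] op_adj_ket[OF pB x k] D_def
                  right_vn_matrix[OF X x k] right_vn_matrix[OF pR x k])
            then show "(cmod (op_adj ?S X (ket k) x - op_adj ?S p (ket k) x))\<^sup>2 = (cmod (D (k \<otimes> inv x)))\<^sup>2"
              by simp
          qed
          also have "\<dots> = (\<Sum>\<^sub>\<infinity>x\<in>?S. (cmod (D x))\<^sup>2)"
            by (rule infsum_reindex_bij_betw[OF bij_mult_inv[OF k]])
          finally show ?thesis by (simp add: ell2_norm_def)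
        qed
        have e1: "cmod (T (p (ket h)) k - T (X (ket h)) k) \<le> C * ell2_norm ?S D"
        proof -
          have d: "(\<lambda>x. X (ket h) x - p (ket h) x) \<in> L2" using XS[OF kh] pS[OF kh] by simp
          have "T (X (ket h)) k - T (p (ket h)) k = T (\<lambda>x. X (ket h) x - p (ket h) x) k"
            by (simp add: op_vec_diff[OF TB XS[OF kh] pS[OF kh]])
          then have "cmod (T (p (ket h)) k - T (X (ket h)) k) = cmod (T (\<lambda>x. X (ket h) x - p (ket h) x) k)"
            by (simp add: norm_minus_commute)
          also have "\<dots> \<le> ell2_norm ?S (T (\<lambda>x. X (ket h) x - p (ket h) x))"
            by (rule ell2_coord_le[OF op_in_ell2[OF TB d]])
          also have "\<dots> \<le> C * ell2_norm ?S D" using C(2)[OF d] by (simp add: n1)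
          finally show ?thesis .
        qed
        have e2: "cmod (X w k - p w k) \<le> ell2_norm ?S w * ell2_norm ?S D"
        proof -
          note aS = op_in_ell2[OF op_adj_in[OF XB] kk] op_in_ell2[OF op_adj_in[OF pB] kk]
          have "X w k - p w k = ell2_inner ?S (X w) (ket k) - ell2_inner ?S (p w) (ket k)"
            using k by (simp add: ell2_inner_ket)
          also have "\<dots> = ell2_inner ?S w (\<lambda>x. op_adj ?S X (ket k) x - op_adj ?S p (ket k) x)"
            by (simp add: op_adj_inner[OF XB w kk] op_adj_inner[OF pB w kk] ell2_inner_diff_right aS w)
          finally show ?thesis
            using ell2_Cauchy_Schwarz[OF w ell2_diff[OF aS]] by (simp add: n2)
        qed
        \<comment> \<open>As T commutes with p, the commutator of X and T at \<open>ket h\<close> is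
          (X - p) w + T (p - X) (ket h), one term for each of the two errors.\<close>
        have "T (p (ket h)) = p w" unfolding w_def by (rule comm[OF p kh])
        then have "cmod (X w k - T (X (ket h)) k) \<le> C * ell2_norm ?S D + ell2_norm ?S w * ell2_norm ?S D"
          using norm_triangle_ineq[of "X w k - p w k" "p w k - T (X (ket h)) k"] e1 e2 by simp
        also have "\<dots> \<le> s * ell2_norm ?S D" unfolding s_def by (simp add: distrib_right)
        also have "\<dots> \<le> s * (\<epsilon> / s)" using pD s unfolding D_def by (intro mult_left_mono) auto
        also have "\<dots> = \<epsilon>" using s by simp
        finally show ?thesis by simp
      qed
      then have "cmod (X w k - T (X (ket h)) k) \<le> 0" by (rule field_le_epsilon)
      then show "op_mult ?S X T (ket h) k = op_mult ?S T X (ket h) k"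
        using kh by (simp add: op_mult_apply w_def)
    qed
  qed
  then have "X \<in> commutant ?S (commutant ?S P)" using XB by (simp add: commutant_def[of ?S "commutant ?S P"])
  then show ?thesis by (simp add: PP)
qed

text \<open>The projection of \<open>\<delta>\<^sub>g\<close> onto the closure of \<open>P\<delta>\<close> is fixed by \<open>\<delta>\<^sub>x \<mapsto> \<delta>\<^bsub>axb\<^esub>\<close> with \<open>b = g\<^sup>-\<^sup>1a\<^sup>-\<^sup>1g\<close>,
  hence a multiple of \<open>\<delta>\<^sub>g\<close>.\<close>

lemma intermediate_dichotomy:
  assumes K: "subgroup K G" and A: "A \<subseteq> K" "rel_icc A"
    and Ainv: "\<And>a. a \<in> A \<Longrightarrow> inv a \<in> A"
    and Anorm: "\<And>a g. a \<in> A \<Longrightarrow> g \<in> carrier G \<Longrightarrow> inv g \<otimes> a \<otimes> g \<in> A"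
    and P: "von_neumann_algebra (carrier G) P" "subgroup_vn G K \<subseteq> P" "P \<subseteq> right_vn G"
    and g: "g \<in> carrier G"
  shows "left_regular G g \<in> P \<or> (\<forall>T\<in>P. T (ket \<one>) g = 0)"
proof -
  let ?S = "carrier G"
  have KG: "K \<subseteq> ?S" using K by (rule subgroup.subset)
  have PP: "commutant ?S (commutant ?S P) = P" using P by (auto simp: von_neumann_algebra_def)
  note mcl = commutant_id[OF commutant_bounded[of ?S P]] commutant_add[OF commutant_bounded[of ?S P]]
    commutant_scale[OF commutant_bounded[of ?S P]] commutant_mult[OF commutant_bounded[of ?S P]]
  note mcl = mcl[unfolded PP]
  have PB: "T \<in> bounded_ops ?S" if "T \<in> P" for T using that P(3) right_vn_bounded by blast
  have k1: "ket \<one> \<in> L2" by simp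
  have lamP: "left_regular G a \<in> P" if "a \<in> K" for a using left_regular_subgroup_vn[OF KG that] P(2) by blast
  define V where "V = (\<lambda>T. T (ket \<one>)) ` P"
  have VI: "T (ket \<one>) \<in> V" if "T \<in> P" for T using that by (auto simp: V_def)
  have VE: "\<exists>T. T \<in> P \<and> v = T (ket \<one>)" if "v \<in> V" for v using that by (auto simp: V_def)
  have VS: "V \<subseteq> L2" using op_in_ell2[OF PB k1] by (auto simp: V_def)
  have V: "ell2_subspace ?S V"
    unfolding ell2_subspace_def
  proof (intro conjI VS ballI allI)
    show "(\<lambda>x. 0) \<in> V" using VI[OF mcl(3)[OF mcl(1), of 0]] by (simp add: op_scale_apply k1)
    fix u assume "u \<in> V"
    then obtain A where A: "A \<in> P" "u = A (ket \<one>)" using VE by blast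
    show "(\<lambda>x. c * u x) \<in> V" for c
      using VI[OF mcl(3)[OF A(1), of c]] by (simp add: op_scale_apply k1 A(2))
    fix v assume "v \<in> V"
    then obtain B where B: "B \<in> P" "v = B (ket \<one>)" using VE by blast
    show "(\<lambda>x. u x + v x) \<in> V"
      using VI[OF mcl(2)[OF A(1) B(1)]] by (simp add: op_add_apply k1 A(2) B(2))
  qed
  obtain \<xi> where \<xi>: "\<xi> \<in> ell2_closure ?S V" "\<And>v. v \<in> ell2_closure ?S V \<Longrightarrow> ell2_inner ?S (\<lambda>x. ket g x - \<xi> x) v = 0"
    using ell2_projection[OF V ell2_ket[OF g]] by metis
  have \<xi>S: "\<xi> \<in> L2" by (rule ell2_closureD[OF \<xi>(1)])
  have lV: "left_regular G a v \<in> V" if a: "a \<in> A" and v: "v \<in> V" for a v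
  proof -
    obtain T where T: "T \<in> P" "v = T (ket \<one>)" using VE[OF v] by blast
    have "op_mult ?S (left_regular G a) T \<in> P" using a A by (intro mcl(4) lamP T) auto
    from VI[OF this] show ?thesis by (simp add: op_mult_apply k1 T(2))
  qed
  have rV: "right_regular G b v \<in> V" if b: "b \<in> A" and v: "v \<in> V" for b v
  proof -
    obtain T where T: "T \<in> P" "v = T (ket \<one>)" using VE[OF v] by blast
    have bG: "b \<in> ?S" and ib: "inv b \<in> K" using b A Ainv KG by auto
    have "op_mult ?S T (left_regular G (inv b)) \<in> P" using ib by (intro mcl(4) lamP T)
    then have "T (left_regular G (inv b) (ket \<one>)) \<in> V" using VI by (fastforce simp: op_mult_apply k1)
    moreover have "left_regular G (inv b) (ket \<one>) = right_regular G b (ket \<one>)"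
      using bG by (simp add: left_regular_ket right_regular_ket)
    moreover have "T (right_regular G b (ket \<one>)) = right_regular G b (T (ket \<one>))"
      using T P(3) bG by (auto simp: right_vn_iff)
    ultimately show ?thesis by (simp add: T(2))
  qed
  have inv: "\<xi> (a \<otimes> y \<otimes> inv a \<otimes> g) = \<xi> (y \<otimes> g)" if a: "a \<in> A" and y: "y \<in> ?S" for a y
  proof -
    define c where "c = inv a"
    have c: "c \<in> A" unfolding c_def by (rule Ainv[OF a])
    define b where "b = inv g \<otimes> c \<otimes> g"
    have b: "b \<in> A" unfolding b_def by (rule Anorm[OF c g])
    have aG: "a \<in> ?S" and cG: "c \<in> ?S" and bG: "b \<in> ?S" using a b c A KG by auto
    \<comment> \<open>W maps \<open>ket x\<close> to the basis vector at c x b^{-1}, and b is chosen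
      so that \<open>ket g\<close> is fixed. With c the inverse of a, the value of
      \<open>W \<xi>\<close> at y g is that of \<xi> at a y a^{-1} g.\<close>
    define W where "W = op_mult ?S (left_regular G c) (right_regular G b)"
    have WB: "W \<in> bounded_ops ?S" unfolding W_def by (intro op_mult_in left_regular_in right_regular_in cG bG)
    have Wadj: "op_adj ?S W = op_mult ?S (right_regular G (inv b)) (left_regular G (inv c))"
    proof (rule op_adj_eqI[OF WB op_mult_in[OF right_regular_in left_regular_in]])
      fix u v assume uv: "u \<in> L2" "v \<in> L2"
      have ru: "right_regular G b u \<in> L2" and lv: "left_regular G (inv c) v \<in> L2"
        using op_in_ell2[OF right_regular_in[OF bG] uv(1)] op_in_ell2[OF left_regular_in[OF inv_closed[OF cG]] uv(2)] by auto
      show "ell2_inner ?S (W u) v = ell2_inner ?S u (op_mult ?S (right_regular G (inv b)) (left_regular G (inv c)) v)"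
        using op_adj_inner[OF left_regular_in[OF cG] ru uv(2)] op_adj_inner[OF right_regular_in[OF bG] uv(1) lv]
        by (simp add: W_def op_mult_apply uv left_regular_adj[OF cG] right_regular_adj[OF bG])
    qed (use bG cG in auto)
    have Wk: "W (ket g) = ket g"
    proof -
      have "c \<otimes> (g \<otimes> inv b) = g"
        using g cG by (simp add: b_def inv_mult_group m_assoc) (simp add: m_assoc[symmetric])
      then show ?thesis using g cG bG by (simp add: W_def op_mult_apply left_regular_ket right_regular_ket)
    qed
    have "W \<xi> = \<xi>"
    proof (rule ell2_projection_invariant[OF V WB _ _ ell2_ket[OF g] Wk \<xi>])
      fix v assume v: "v \<in> V"
      have vS: "v \<in> L2" using v VS by blast
      show "W v \<in> V" using lV[OF c rV[OF b v]] by (simp add: W_def op_mult_apply vS)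
      show "op_adj ?S W v \<in> V" using rV[OF Ainv[OF b] lV[OF Ainv[OF c] v]] by (simp add: Wadj op_mult_apply vS)
    qed
    then have "\<xi> (y \<otimes> g) = W \<xi> (y \<otimes> g)" by simp
    also have "\<dots> = \<xi> (inv c \<otimes> (y \<otimes> g) \<otimes> b)"
      using y g bG cG op_in_ell2[OF right_regular_in[OF bG] \<xi>S]
      by (simp add: W_def op_mult_apply \<xi>S left_regular_apply right_regular_apply)
    also have "inv c \<otimes> (y \<otimes> g) \<otimes> b = a \<otimes> y \<otimes> inv a \<otimes> g"
      using y g aG by (simp add: b_def c_def m_assoc) (simp add: m_assoc[symmetric])
    finally show ?thesis by simp
  qed
  define c where "c = \<xi> g"
  have \<xi>c: "\<xi> = (\<lambda>x. c * ket g x)"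
  proof
    fix x show "\<xi> x = c * ket g x"
    proof (cases "x \<in> ?S \<and> x \<noteq> g")
      case True
      then have "\<xi> x = 0" using A KG by (intro rel_icc_zero[OF A(2) _ \<xi>S g inv]) auto
      then show ?thesis using True by (simp add: ket_def)
    next
      case False
      then consider "x = g" | "x \<notin> ?S" by blast
      then show ?thesis
      proof cases
        case 1
        then show ?thesis by (simp add: c_def ket_def)
      next
        case 2
        then have "x \<noteq> g" using g by blast
        with 2 show ?thesis by (simp add: ell2_outside[OF \<xi>S] ket_def)
      qed
    qed
  qed
  \<comment> \<open>The projection c \<open>ket g\<close> is orthogonal to its own error (1 - c)
    \<open>ket g\<close>, which leaves only c = 0 and c = 1.\<close>
  have "ell2_inner ?S (\<lambda>x. ket g x - \<xi> x) \<xi> = 0" by (rule \<xi>(2)[OF \<xi>(1)])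
  then have "ell2_inner ?S (\<lambda>x. ket g x - c * ket g x) (\<lambda>x. c * ket g x) = 0" by (simp only: \<xi>c)
  moreover have "(\<lambda>x. ket g x - c * ket g x) = (\<lambda>x. (1 - c) * ket g x)" by (simp add: left_diff_distrib)
  ultimately have "ell2_inner ?S (\<lambda>x. (1 - c) * ket g x) (\<lambda>x. c * ket g x) = 0" by simp
  then have "(1 - c) * (cnj c * ell2_inner ?S (ket g) (ket g)) = 0"
    by (simp only: ell2_inner_scale_left ell2_inner_scale_right)
  moreover have "ell2_inner ?S (ket g) (ket g) = 1" using g by (simp add: ell2_inner_ket) (simp add: ket_def)
  ultimately have "c = 1 \<or> c = 0" by auto
  then show ?thesis
  proof
    assume "c = 1"
    then have "ket g \<in> ell2_closure ?S V" using \<xi>(1) \<xi>c by simp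
    moreover have "left_regular G g (ket \<one>) = ket g" using g by (simp add: left_regular_ket)
    moreover have "left_regular G g \<in> right_vn G" using g by (auto simp: right_vn_iff left_right_commute)
    ultimately show ?thesis using vn_mem_closure[OF P(1,3)] by (simp add: V_def)
  next
    assume "c = 0"
    then have \<xi>0: "\<xi> = (\<lambda>x. 0)" using \<xi>c by simp
    have "T (ket \<one>) g = 0" if T: "T \<in> P" for T
    proof -
      have "ell2_inner ?S (ket g) (T (ket \<one>)) = 0"
        using \<xi>(2)[OF ell2_closure_superset[OF VS VI[OF T]]] by (simp add: \<xi>0)
      then show ?thesis using g by (simp add: ell2_inner_ket_left)
    qed
    then show ?thesis by blast
  qed
qed

theorem subgroup_vn_maximal:
  assumes K: "subgroup K G" and A: "A \<subseteq> K" "rel_icc A"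
    and Ainv: "\<And>a. a \<in> A \<Longrightarrow> inv a \<in> A"
    and Anorm: "\<And>a g. a \<in> A \<Longrightarrow> g \<in> carrier G \<Longrightarrow> inv g \<otimes> a \<otimes> g \<in> A"
    and max: "\<And>L. subgroup L G \<Longrightarrow> K \<subseteq> L \<Longrightarrow> L = K \<or> L = carrier G"
  shows "maximal_vn_subalgebra (carrier G) (subgroup_vn G K) (group_vn G)"
  unfolding maximal_vn_subalgebra_def
proof (intro conjI allI impI)
  let ?S = "carrier G"
  have KG: "K \<subseteq> ?S" using K by (rule subgroup.subset)
  show "von_neumann_algebra ?S (subgroup_vn G K)" by (rule subgroup_vn_von_neumann[OF K])
  show "von_neumann_algebra ?S (group_vn G)"
    unfolding group_vn_def by (rule subgroup_vn_von_neumann[OF subgroup_self])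
  show "subgroup_vn G K \<subseteq> group_vn G" by (auto simp: subgroup_vn_eq[OF K] group_vn_eq)
  fix P assume "von_neumann_algebra ?S P \<and> subgroup_vn G K \<subseteq> P \<and> P \<subseteq> group_vn G"
  then have P: "von_neumann_algebra ?S P" "subgroup_vn G K \<subseteq> P" "P \<subseteq> right_vn G" by (auto simp: group_vn_eq)
  have PP: "commutant ?S (commutant ?S P) = P" and Padj: "\<And>T. T \<in> P \<Longrightarrow> op_adj ?S T \<in> P"
    using P by (auto simp: von_neumann_algebra_def)
  note mult = commutant_mult[OF commutant_bounded[of ?S P], unfolded PP]
  \<comment> \<open>By the dichotomy, no element of P has a nonzero coefficient off L, so L
    determines P.\<close>
  define L where "L = {g \<in> ?S. left_regular G g \<in> P}"
  have KL: "K \<subseteq> L" using KG P(2) left_regular_subgroup_vn[OF KG] by (auto simp: L_def)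
  have L: "subgroup L G"
  proof (rule subgroupI)
    show "L \<subseteq> ?S" by (auto simp: L_def)
    show "L \<noteq> {}" using KL subgroup.one_closed[OF K] by blast
    show "inv a \<in> L" if "a \<in> L" for a
      using that Padj[of "left_regular G a"] by (simp add: L_def left_regular_adj)
    show "a \<otimes> b \<in> L" if a: "a \<in> L" and b: "b \<in> L" for a b
    proof -
      have ab: "a \<in> ?S" "b \<in> ?S" using a b by (auto simp: L_def)
      have "op_mult ?S (left_regular G a) (left_regular G b) = left_regular G (a \<otimes> b)"
        by (rule op_eq_ketI[of _ ?S])
          (use ab in \<open>auto simp: op_mult_apply left_regular_ket m_assoc intro!: op_mult_in\<close>)
      then show ?thesis using mult[of "left_regular G a" "left_regular G b"] a b by (simp add: L_def)
    qed
  qed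
  from max[OF L KL] show "P = subgroup_vn G K \<or> P = group_vn G"
  proof
    assume "L = K"
    have "T \<in> subgroup_vn G K" if T: "T \<in> P" for T
    proof -
      have "T (ket \<one>) x = 0" if x: "x \<in> ?S - K" for x
      proof -
        have "left_regular G x \<notin> P" using x \<open>L = K\<close> by (auto simp: L_def)
        then show ?thesis using intermediate_dichotomy[OF K A Ainv Anorm P, of x] x T by blast
      qed
      then show ?thesis using T P(3) by (auto simp: subgroup_vn_eq[OF K])
    qed
    then show ?thesis using P(2) by blast
  next
    assume "L = ?S"
    then have "left_regular G ` ?S \<subseteq> P" by (auto simp: L_def)
    then have "group_vn G \<subseteq> commutant ?S (commutant ?S P)"
      unfolding group_vn_def subgroup_vn_def by (intro commutant_antimono)
    then show ?thesis using P(3) by (auto simp: PP group_vn_eq)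
  qed
qed

end

section \<open>Conditional expectations onto algebras of subgroups\<close>

definition cmean :: "(('g \<Rightarrow> real) \<Rightarrow> real) \<Rightarrow> ('g \<Rightarrow> complex) \<Rightarrow> complex"
  where "cmean m f = Complex (m (\<lambda>x. Re (f x))) (m (\<lambda>x. Im (f x)))"

lemma bounded_Re_Im:
  assumes "bounded (f ` X)"
  shows "bounded ((\<lambda>x. Re (f x)) ` X)" "bounded ((\<lambda>x. Im (f x)) ` X)"
proof -
  obtain B where "\<forall>x\<in>X. cmod (f x) \<le> B" using assms by (auto simp: bounded_iff)
  then show "bounded ((\<lambda>x. Re (f x)) ` X)" "bounded ((\<lambda>x. Im (f x)) ` X)"
    unfolding bounded_real_image_iff
    by (meson abs_Re_le_cmod abs_Im_le_cmod order_trans)+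
qed

context
  fixes G :: "('g, 'x) monoid_scheme" and m
  assumes m: "mean_on G m"
begin

lemma cmean_add:
  assumes "bounded (f ` carrier G)" "bounded (g ` carrier G)"
  shows "cmean m (\<lambda>x. f x + g x) = cmean m f + cmean m g"
  by (simp add: cmean_def mean_add[OF m] bounded_Re_Im assms complex_eq_iff)

lemma cmean_scale:
  assumes "bounded (f ` carrier G)" shows "cmean m (\<lambda>x. c * f x) = c * cmean m f"
proof -
  note b = bounded_Re_Im[OF assms]
  have "m (\<lambda>x. Re c * Re (f x) + - Im c * Im (f x)) = Re c * m (\<lambda>x. Re (f x)) + - Im c * m (\<lambda>x. Im (f x))"
    by (simp only: mean_add[OF m] mean_scale[OF m] bounded_real_scale b)
  moreover have "m (\<lambda>x. Re c * Im (f x) + Im c * Re (f x)) = Re c * m (\<lambda>x. Im (f x)) + Im c * m (\<lambda>x. Re (f x))"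
    by (simp only: mean_add[OF m] mean_scale[OF m] bounded_real_scale b)
  ultimately show ?thesis by (simp add: cmean_def complex_eq_iff)
qed

lemma cmean_const: "cmean m (\<lambda>x. c) = c"
  by (simp add: cmean_def mean_const[OF m])

lemma cmean_cong:
  assumes "bounded (f ` carrier G)" "\<And>x. x \<in> carrier G \<Longrightarrow> f x = g x"
  shows "cmean m f = cmean m g"
  unfolding cmean_def
  by (intro arg_cong2[where f = Complex] mean_cong[OF m] bounded_Re_Im assms(1)) (simp_all add: assms(2))

text \<open>The constant 2 comes from estimating real and imaginary part separately; it suffices for
  the averaged form to be bounded.\<close>

lemma cmean_le:
  assumes "\<And>x. x \<in> carrier G \<Longrightarrow> cmod (f x) \<le> B"
  shows "cmod (cmean m f) \<le> 2 * B"
proof -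
  have "\<bar>m (\<lambda>x. Re (f x))\<bar> \<le> B"
    by (rule mean_abs_le[OF m]) (meson assms abs_Re_le_cmod order_trans)
  moreover have "\<bar>m (\<lambda>x. Im (f x))\<bar> \<le> B"
    by (rule mean_abs_le[OF m]) (meson assms abs_Im_le_cmod order_trans)
  ultimately show ?thesis using cmod_le[of "cmean m f"] by (simp add: cmean_def)
qed

lemma cmean_nonneg:
  assumes "bounded (f ` carrier G)" "\<And>x. x \<in> carrier G \<Longrightarrow> f x \<in> \<real>\<^sub>\<ge>\<^sub>0"
  shows "cmean m f \<in> \<real>\<^sub>\<ge>\<^sub>0"
proof -
  have "m (\<lambda>x. Im (f x)) = m (\<lambda>x. 0)"
    by (rule mean_cong[OF m bounded_Re_Im(2)[OF assms(1)]]) (use assms(2) in \<open>auto simp: complex_nonneg_Reals_iff\<close>)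
  moreover have "0 \<le> m (\<lambda>x. Re (f x))"
    by (rule mean_nonneg[OF m bounded_Re_Im(1)[OF assms(1)]]) (use assms(2) in \<open>auto simp: complex_nonneg_Reals_iff\<close>)
  ultimately show ?thesis by (simp add: cmean_def complex_nonneg_Reals_iff mean_const[OF m])
qed

end

lemma cut_Un_norm:
  assumes "u \<in> ell2 S" "A \<inter> B = {}"
  shows "(ell2_norm S (cut (A \<union> B) u))\<^sup>2 = (ell2_norm S (cut A u))\<^sup>2 + (ell2_norm S (cut B u))\<^sup>2"
proof -
  have "(\<Sum>\<^sub>\<infinity>x\<in>S. (cmod (cut (A \<union> B) u x))\<^sup>2) = (\<Sum>\<^sub>\<infinity>x\<in>S. (cmod (cut A u x))\<^sup>2 + (cmod (cut B u x))\<^sup>2)"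
    by (rule infsum_cong) (use assms(2) in \<open>auto simp: cut_def\<close>)
  also have "\<dots> = (\<Sum>\<^sub>\<infinity>x\<in>S. (cmod (cut A u x))\<^sup>2) + (\<Sum>\<^sub>\<infinity>x\<in>S. (cmod (cut B u x))\<^sup>2)"
    by (intro infsum_add ell2_summable ell2_cut assms(1))
  finally show ?thesis by (simp add: ell2_norm_power2)
qed

lemma cut_disjoint_norm:
  assumes u: "u \<in> ell2 S" and D: "finite D" "\<And>A B. A \<in> D \<Longrightarrow> B \<in> D \<Longrightarrow> A \<noteq> B \<Longrightarrow> A \<inter> B = {}"
  shows "(\<Sum>A\<in>D. (ell2_norm S (cut A u))\<^sup>2) = (ell2_norm S (cut (\<Union>D) u))\<^sup>2"
  using D
proof (induction D)
  case empty
  then show ?case by (simp add: cut_def)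
next
  case (insert A D)
  have "A \<inter> \<Union>D = {}" using insert by fastforce
  moreover have "(\<Sum>A\<in>D. (ell2_norm S (cut A u))\<^sup>2) = (ell2_norm S (cut (\<Union>D) u))\<^sup>2"
    using insert by simp
  ultimately show ?case using insert(1,2) cut_Un_norm[OF u, of A "\<Union>D"] by simp
qed

section \<open>Averaging over right translations\<close>

context group
begin

lemma right_regular_mult:
  assumes "g \<in> carrier G" "h \<in> carrier G" "u \<in> L2"
  shows "right_regular G g (right_regular G h u) = right_regular G (g \<otimes> h) u"
  using assms op_in_ell2[OF right_regular_in[OF assms(2)] assms(3)]
  by (auto simp: right_regular_def pull_def m_assoc fun_eq_iff)

lemma right_regular_one: "u \<in> L2 \<Longrightarrow> right_regular G \<one> u = u"
  by (auto simp: right_regular_def pull_def fun_eq_iff ell2_outside)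

lemma right_regular_inner:
  assumes "g \<in> carrier G" "u \<in> L2" "v \<in> L2"
  shows "ell2_inner (carrier G) (right_regular G g u) v = ell2_inner (carrier G) u (right_regular G (inv g) v)"
  using op_adj_inner[OF right_regular_in[OF assms(1)] assms(2,3)] assms(1) by (simp add: right_regular_adj)

lemma right_regular_norm:
  assumes "g \<in> carrier G" "u \<in> L2"
  shows "ell2_norm (carrier G) (right_regular G g u) = ell2_norm (carrier G) u"
proof -
  have "(\<Sum>\<^sub>\<infinity>x\<in>carrier G. (cmod (right_regular G g u x))\<^sup>2) = (\<Sum>\<^sub>\<infinity>x\<in>carrier G. (cmod (u (x \<otimes> g)))\<^sup>2)"
    by (rule infsum_cong) (simp add: right_regular_apply assms)
  also have "\<dots> = (\<Sum>\<^sub>\<infinity>x\<in>carrier G. (cmod (u x))\<^sup>2)"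
    by (rule infsum_reindex_bij_betw[OF bij_right_mult[OF assms(1)]])
  finally show ?thesis by (simp add: ell2_norm_def)
qed

text \<open>The matrix coefficient at u, v of T conjugated by the right translation by g, with one
  unitary moved to v.\<close>

definition conj_coeff :: "'a oper \<Rightarrow> 'a vec \<Rightarrow> 'a vec \<Rightarrow> 'a \<Rightarrow> complex"
  where "conj_coeff T u v g =
    ell2_inner (carrier G) (T (right_regular G (inv g) u)) (right_regular G (inv g) v)"

lemma conj_coeff_bound:
  assumes T: "T \<in> bounded_ops (carrier G)"
  obtains C where "C \<ge> 0" "\<forall>u\<in>L2. \<forall>v\<in>L2. \<forall>g\<in>carrier G.
    cmod (conj_coeff T u v g) \<le> C * ell2_norm (carrier G) u * ell2_norm (carrier G) v"
proof -
  let ?S = "carrier G"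
  obtain C where C: "C \<ge> 0" "\<And>u. u \<in> L2 \<Longrightarrow> ell2_norm ?S (T u) \<le> C * ell2_norm ?S u"
    using op_bound[OF T] by blast
  have "cmod (conj_coeff T u v g) \<le> C * ell2_norm ?S u * ell2_norm ?S v"
    if u: "u \<in> L2" and v: "v \<in> L2" and g: "g \<in> ?S" for u v g
  proof -
    note R = op_in_ell2[OF right_regular_in[OF inv_closed[OF g]]]
    have "cmod (conj_coeff T u v g) \<le> ell2_norm ?S (T (right_regular G (inv g) u)) * ell2_norm ?S v"
      using ell2_Cauchy_Schwarz[OF op_in_ell2[OF T R[OF u]] R[OF v]] g v
      by (simp add: conj_coeff_def right_regular_norm)
    also have "\<dots> \<le> C * ell2_norm ?S u * ell2_norm ?S v"
      using C(2)[OF R[OF u]] g u by (intro mult_right_mono) (simp_all add: right_regular_norm)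
    finally show ?thesis .
  qed
  with C(1) show ?thesis by (intro that[of C]) auto
qed

lemma conj_coeff_bounded:
  assumes "T \<in> bounded_ops (carrier G)" "u \<in> L2" "v \<in> L2"
  shows "bounded (conj_coeff T u v ` carrier G)"
proof -
  obtain C where "C \<ge> 0" and C: "\<forall>u\<in>L2. \<forall>v\<in>L2. \<forall>g\<in>carrier G.
    cmod (conj_coeff T u v g) \<le> C * ell2_norm (carrier G) u * ell2_norm (carrier G) v"
    using conj_coeff_bound[OF assms(1)] .
  show ?thesis
    unfolding bounded_iff using C assms(2,3)
    by (intro exI[of _ "C * ell2_norm (carrier G) u * ell2_norm (carrier G) v"]) auto
qed

text \<open>A mean applies to scalar functions only, so the conjugates of T are averaged weakly: the
  mean of their coefficients is a bounded form, and this is its operator.\<close>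

definition average :: "(('a \<Rightarrow> real) \<Rightarrow> real) \<Rightarrow> 'a oper \<Rightarrow> 'a oper"
  where "average m T = (SOME A. A \<in> bounded_ops (carrier G) \<and>
    (\<forall>u\<in>L2. \<forall>v\<in>L2. ell2_inner (carrier G) (A u) v = cmean m (conj_coeff T u v)))"

context
  fixes m assumes lim: "left_invariant_mean G m"
begin

lemma left_invariant_mean_on: "mean_on G m"
  using lim by (simp add: left_invariant_mean_iff invariant_mean_def)

lemma average_spec:
  assumes T: "T \<in> bounded_ops (carrier G)"
  shows "average m T \<in> bounded_ops (carrier G) \<and>
    (\<forall>u\<in>L2. \<forall>v\<in>L2. ell2_inner (carrier G) (average m T u) v = cmean m (conj_coeff T u v))"
proof -
  let ?S = "carrier G"
  obtain C where C: "C \<ge> 0" "\<forall>u\<in>L2. \<forall>v\<in>L2. \<forall>g\<in>carrier G.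
    cmod (conj_coeff T u v g) \<le> C * ell2_norm (carrier G) u * ell2_norm (carrier G) v"
    using conj_coeff_bound[OF T] .
  note R = op_in_ell2[OF right_regular_in[OF inv_closed]] and Ra = op_vec_add[OF right_regular_in[OF inv_closed]]
    and Rs = op_vec_scale[OF right_regular_in[OF inv_closed]]
  note TS = op_in_ell2[OF T] and bd = conj_coeff_bounded[OF T]
  have "\<exists>A. A \<in> bounded_ops ?S \<and> (\<forall>u\<in>L2. \<forall>v\<in>L2. ell2_inner ?S (A u) v = cmean m (conj_coeff T u v))"
  proof (rule bounded_form_op[where S = ?S and B = "\<lambda>u v. cmean m (conj_coeff T u v)" and C = "2 * C"])
    fix u u' v assume u: "u \<in> L2" "u' \<in> L2" "v \<in> L2"
    have "cmean m (conj_coeff T (\<lambda>x. u x + u' x) v) = cmean m (\<lambda>g. conj_coeff T u v g + conj_coeff T u' v g)"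
      by (rule cmean_cong[OF left_invariant_mean_on bd[OF ell2_add[OF u(1,2)] u(3)]])
        (simp add: conj_coeff_def Ra[OF _ u(1,2)] op_vec_add[OF T] R u ell2_inner_add_left TS)
    then show "cmean m (conj_coeff T (\<lambda>x. u x + u' x) v) = cmean m (conj_coeff T u v) + cmean m (conj_coeff T u' v)"
      by (simp add: cmean_add[OF left_invariant_mean_on] bd u)
  next
    fix u v v' assume u: "u \<in> L2" "v \<in> L2" "v' \<in> L2"
    have "cmean m (conj_coeff T u (\<lambda>x. v x + v' x)) = cmean m (\<lambda>g. conj_coeff T u v g + conj_coeff T u v' g)"
      by (rule cmean_cong[OF left_invariant_mean_on bd[OF u(1) ell2_add[OF u(2,3)]]])
        (simp add: conj_coeff_def Ra[OF _ u(2,3)] R u ell2_inner_add_right TS)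
    then show "cmean m (conj_coeff T u (\<lambda>x. v x + v' x)) = cmean m (conj_coeff T u v) + cmean m (conj_coeff T u v')"
      by (simp add: cmean_add[OF left_invariant_mean_on] bd u)
  next
    fix c u v assume u: "u \<in> L2" "v \<in> L2"
    have "cmean m (conj_coeff T (\<lambda>x. c * u x) v) = cmean m (\<lambda>g. c * conj_coeff T u v g)"
      by (rule cmean_cong[OF left_invariant_mean_on bd[OF ell2_scale[OF u(1)] u(2)]])
        (simp add: conj_coeff_def Rs[OF _ u(1)] op_vec_scale[OF T] R u ell2_inner_scale_left)
    then show "cmean m (conj_coeff T (\<lambda>x. c * u x) v) = c * cmean m (conj_coeff T u v)"
      by (simp add: cmean_scale[OF left_invariant_mean_on] bd u)
    have "cmean m (conj_coeff T u (\<lambda>x. c * v x)) = cmean m (\<lambda>g. cnj c * conj_coeff T u v g)"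
      by (rule cmean_cong[OF left_invariant_mean_on bd[OF u(1) ell2_scale[OF u(2)]]])
        (simp add: conj_coeff_def Rs[OF _ u(2)] R u ell2_inner_scale_right)
    then show "cmean m (conj_coeff T u (\<lambda>x. c * v x)) = cnj c * cmean m (conj_coeff T u v)"
      by (simp add: cmean_scale[OF left_invariant_mean_on] bd u)
  next
    fix u v assume u: "u \<in> L2" "v \<in> L2"
    have "cmod (cmean m (conj_coeff T u v)) \<le> 2 * (C * ell2_norm ?S u * ell2_norm ?S v)"
      by (rule cmean_le[OF left_invariant_mean_on]) (use C(2) u in blast)
    then show "cmod (cmean m (conj_coeff T u v)) \<le> 2 * C * ell2_norm ?S u * ell2_norm ?S v" by (simp add: mult_ac)
  next
    show "0 \<le> 2 * C" using C by simp
  next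
    fix A assume "A \<in> bounded_ops ?S" "\<forall>u\<in>L2. \<forall>v\<in>L2. ell2_inner ?S (A u) v = cmean m (conj_coeff T u v)"
    then show ?thesis by blast
  qed
  from someI_ex[OF this] show ?thesis unfolding average_def .
qed

lemma average_in: "T \<in> bounded_ops (carrier G) \<Longrightarrow> average m T \<in> bounded_ops (carrier G)"
  using average_spec by blast

lemma average_inner:
  "T \<in> bounded_ops (carrier G) \<Longrightarrow> u \<in> L2 \<Longrightarrow> v \<in> L2 \<Longrightarrow>
    ell2_inner (carrier G) (average m T u) v = cmean m (conj_coeff T u v)"
  using average_spec by blast

lemma average_eqI:
  assumes T: "T \<in> bounded_ops (carrier G)" and A: "A \<in> bounded_ops (carrier G)"
    and eq: "\<And>u v. u \<in> L2 \<Longrightarrow> v \<in> L2 \<Longrightarrow> cmean m (conj_coeff T u v) = ell2_inner (carrier G) (A u) v"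
  shows "average m T = A"
proof (rule op_eqI[OF average_in[OF T] A])
  fix u assume u: "u \<in> L2"
  show "average m T u = A u"
    by (rule ell2_eqI[OF op_in_ell2[OF average_in[OF T] u] op_in_ell2[OF A u]])
      (simp add: average_inner[OF T u] eq u)
qed

text \<open>Left invariance permits replacing g by h g. The translation by h then cancels in the
  first argument of the coefficient and reappears as translation by \<open>inv h\<close> in the
  second.\<close>

lemma average_right_vn:
  assumes T: "T \<in> bounded_ops (carrier G)" shows "average m T \<in> right_vn G"
  unfolding right_vn_iff
proof (intro conjI ballI average_in[OF T])
  let ?S = "carrier G"
  fix h u assume h: "h \<in> ?S" and u: "u \<in> L2"
  note avS = op_in_ell2[OF average_in[OF T]]
  have ru: "right_regular G h u \<in> L2" by (rule op_in_ell2[OF right_regular_in[OF h] u])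
  show "average m T (right_regular G h u) = right_regular G h (average m T u)"
  proof (rule ell2_eqI[OF avS[OF ru] op_in_ell2[OF right_regular_in[OF h] avS[OF u]]])
    fix v assume v: "v \<in> L2"
    have rv: "right_regular G (inv h) v \<in> L2" by (rule op_in_ell2[OF right_regular_in[OF inv_closed[OF h]] v])
    let ?F = "conj_coeff T (right_regular G h u) v"
    note b = bounded_Re_Im[OF conj_coeff_bounded[OF T ru v]]
    have inv: "m (\<lambda>x. w (h \<otimes> x)) = m w" if "bounded (w ` ?S)" for w
      using lim h that unfolding left_invariant_mean_def by blast
    have "ell2_inner ?S (average m T (right_regular G h u)) v = cmean m ?F" by (rule average_inner[OF T ru v])
    also have "\<dots> = cmean m (\<lambda>g. ?F (h \<otimes> g))" by (simp add: cmean_def inv[OF b(1)] inv[OF b(2)])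
    also have "\<dots> = cmean m (conj_coeff T u (right_regular G (inv h) v))"
    proof (rule cmean_cong[OF left_invariant_mean_on, symmetric])
      show "bounded (conj_coeff T u (right_regular G (inv h) v) ` ?S)" by (rule conj_coeff_bounded[OF T u rv])
      fix g assume g: "g \<in> ?S"
      have "inv g \<otimes> inv h \<otimes> h = inv g" using g h by (simp add: m_assoc)
      then show "conj_coeff T u (right_regular G (inv h) v) g = ?F (h \<otimes> g)"
        using g h u v by (simp add: conj_coeff_def right_regular_mult inv_mult_group)
    qed
    also have "\<dots> = ell2_inner ?S (average m T u) (right_regular G (inv h) v)"
      by (rule average_inner[OF T u rv, symmetric])
    also have "\<dots> = ell2_inner ?S (right_regular G h (average m T u)) v"
      by (rule right_regular_inner[OF h avS[OF u] v, symmetric])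
    finally show "ell2_inner ?S (average m T (right_regular G h u)) v
      = ell2_inner ?S (right_regular G h (average m T u)) v" .
  qed
qed

lemma average_add:
  assumes T: "T \<in> bounded_ops (carrier G)" and R: "R \<in> bounded_ops (carrier G)"
  shows "average m (op_add (carrier G) T R) = op_add (carrier G) (average m T) (average m R)"
proof (rule average_eqI[OF op_add_in[OF T R] op_add_in[OF average_in[OF T] average_in[OF R]]])
  fix u v assume u: "u \<in> L2" "v \<in> L2"
  note mem = op_in_ell2[OF right_regular_in[OF inv_closed]]
  have "cmean m (conj_coeff (op_add (carrier G) T R) u v) = cmean m (\<lambda>g. conj_coeff T u v g + conj_coeff R u v g)"
    by (rule cmean_cong[OF left_invariant_mean_on conj_coeff_bounded[OF op_add_in[OF T R] u]])
      (simp add: conj_coeff_def op_add_apply mem u ell2_inner_add_left op_in_ell2[OF T] op_in_ell2[OF R])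
  then show "cmean m (conj_coeff (op_add (carrier G) T R) u v)
      = ell2_inner (carrier G) (op_add (carrier G) (average m T) (average m R) u) v"
    by (simp add: cmean_add[OF left_invariant_mean_on] conj_coeff_bounded T R u op_add_apply ell2_inner_add_left
        op_in_ell2[OF average_in[OF T]] op_in_ell2[OF average_in[OF R]] average_inner)
qed

lemma average_scale:
  assumes T: "T \<in> bounded_ops (carrier G)"
  shows "average m (op_scale (carrier G) c T) = op_scale (carrier G) c (average m T)"
proof (rule average_eqI[OF op_scale_in[OF T] op_scale_in[OF average_in[OF T]]])
  fix u v assume u: "u \<in> L2" "v \<in> L2"
  note mem = op_in_ell2[OF right_regular_in[OF inv_closed]]
  have "cmean m (conj_coeff (op_scale (carrier G) c T) u v) = cmean m (\<lambda>g. c * conj_coeff T u v g)"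
    by (rule cmean_cong[OF left_invariant_mean_on conj_coeff_bounded[OF op_scale_in[OF T] u]])
      (simp add: conj_coeff_def op_scale_apply mem u ell2_inner_scale_left)
  then show "cmean m (conj_coeff (op_scale (carrier G) c T) u v)
      = ell2_inner (carrier G) (op_scale (carrier G) c (average m T) u) v"
    by (simp add: cmean_scale[OF left_invariant_mean_on] conj_coeff_bounded T u op_scale_apply ell2_inner_scale_left average_inner)
qed

lemma average_positive:
  assumes "op_positive (carrier G) T" shows "op_positive (carrier G) (average m T)"
proof -
  have T: "T \<in> bounded_ops (carrier G)" and pos: "\<And>u. u \<in> L2 \<Longrightarrow> ell2_inner (carrier G) (T u) u \<in> \<real>\<^sub>\<ge>\<^sub>0"
    using assms by (auto simp: op_positive_def)
  have "ell2_inner (carrier G) (average m T u) u \<in> \<real>\<^sub>\<ge>\<^sub>0" if u: "u \<in> L2" for u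
    unfolding average_inner[OF T u u]
    by (rule cmean_nonneg[OF left_invariant_mean_on conj_coeff_bounded[OF T u u]])
      (simp add: conj_coeff_def pos op_in_ell2[OF right_regular_in[OF inv_closed]] u)
  then show ?thesis by (simp add: op_positive_def average_in[OF T])
qed

text \<open>B and the adjoint of A commute with right translations, so before averaging B is
  absorbed into u and A, as its adjoint, into v.\<close>

lemma average_bimodule:
  assumes A: "A \<in> right_vn G" and B: "B \<in> right_vn G" and T: "T \<in> bounded_ops (carrier G)"
  shows "average m (op_mult (carrier G) A (op_mult (carrier G) T B))
    = op_mult (carrier G) A (op_mult (carrier G) (average m T) B)"
proof -
  let ?S = "carrier G"
  have AB: "A \<in> bounded_ops ?S" and BB: "B \<in> bounded_ops ?S" using A B by (auto dest: right_vn_bounded)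
  have TB: "op_mult ?S A (op_mult ?S T B) \<in> bounded_ops ?S" by (intro op_mult_in AB BB T)
  note mem = op_in_ell2[OF right_regular_in[OF inv_closed]]
  have aA: "op_adj ?S A \<in> right_vn G"
    using A unfolding right_vn_def
    by (rule commutant_adj[OF right_image_bounded, rotated]) (auto simp: right_regular_adj)
  show ?thesis
  proof (rule average_eqI[OF TB])
    show "op_mult ?S A (op_mult ?S (average m T) B) \<in> bounded_ops ?S"
      by (intro op_mult_in AB BB average_in T)
    fix u v assume u: "u \<in> L2" and v: "v \<in> L2"
    have Bu: "B u \<in> L2" by (rule op_in_ell2[OF BB u])
    have av: "op_adj ?S A v \<in> L2" by (rule op_in_ell2[OF op_adj_in[OF AB] v])
    have "cmean m (conj_coeff (op_mult ?S A (op_mult ?S T B)) u v) = cmean m (conj_coeff T (B u) (op_adj ?S A v))"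
    proof (rule cmean_cong[OF left_invariant_mean_on conj_coeff_bounded[OF TB u v]])
      fix g assume g: "g \<in> ?S"
      note r = mem[OF g u] mem[OF g v] mem[OF g Bu] op_in_ell2[OF BB mem[OF g u]]
      have 1: "B (right_regular G (inv g) u) = right_regular G (inv g) (B u)"
        using B g u by (simp add: right_vn_iff)
      have 2: "op_adj ?S A (right_regular G (inv g) v) = right_regular G (inv g) (op_adj ?S A v)"
        using aA g v by (simp add: right_vn_iff)
      show "conj_coeff (op_mult ?S A (op_mult ?S T B)) u v g = conj_coeff T (B u) (op_adj ?S A v) g"
        by (simp add: conj_coeff_def op_mult_apply r op_adj_inner[OF AB op_in_ell2[OF T r(4)] r(2)] 1 2
            op_adj_inner[OF AB op_in_ell2[OF T r(3)] r(2)])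
    qed
    also have "\<dots> = ell2_inner ?S (average m T (B u)) (op_adj ?S A v)"
      by (rule average_inner[OF T Bu av, symmetric])
    also have "\<dots> = ell2_inner ?S (A (average m T (B u))) v"
      by (rule op_adj_inner[OF AB op_in_ell2[OF average_in[OF T] Bu] v, symmetric])
    finally show "cmean m (conj_coeff (op_mult ?S A (op_mult ?S T B)) u v)
      = ell2_inner ?S (op_mult ?S A (op_mult ?S (average m T) B) u) v"
      by (simp add: op_mult_apply u)
  qed
qed

lemma average_id:
  assumes A: "A \<in> right_vn G" shows "average m A = A"
proof -
  have AB: "A \<in> bounded_ops (carrier G)" by (rule right_vn_bounded[OF A])
  show ?thesis
  proof (rule average_eqI[OF AB AB])
    fix u v assume u: "u \<in> L2" and v: "v \<in> L2"
    have "cmean m (conj_coeff A u v) = cmean m (\<lambda>g. ell2_inner (carrier G) (A u) v)"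
    proof (rule cmean_cong[OF left_invariant_mean_on conj_coeff_bounded[OF AB u v]])
      fix g assume g: "g \<in> carrier G"
      have Au: "A u \<in> L2" by (rule op_in_ell2[OF AB u])
      have "A (right_regular G (inv g) u) = right_regular G (inv g) (A u)" using A g u by (simp add: right_vn_iff)
      then show "conj_coeff A u v g = ell2_inner (carrier G) (A u) v"
        using g v Au op_in_ell2[OF right_regular_in[OF inv_closed[OF g]] v]
        by (simp add: conj_coeff_def right_regular_inner right_regular_mult right_regular_one)
    qed
    then show "cmean m (conj_coeff A u v) = ell2_inner (carrier G) (A u) v" by (simp add: cmean_const[OF left_invariant_mean_on])
  qed
qed

end

section \<open>Compression to the blocks of cosets\<close>

definition rcos :: "'a set \<Rightarrow> 'a \<Rightarrow> 'a set"
  where "rcos K x = {y \<in> carrier G. y \<otimes> inv x \<in> K}"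

context
  fixes K assumes K: "subgroup K G"
begin

lemma rcos_subgroup_subset: "K \<subseteq> carrier G"
  using K by (rule subgroup.subset)

lemma rcos_self: "x \<in> carrier G \<Longrightarrow> x \<in> rcos K x"
  using subgroup.one_closed[OF K] by (simp add: rcos_def)

lemma rcos_eq:
  assumes x: "x \<in> carrier G" and y: "y \<in> rcos K x" shows "rcos K y = rcos K x"
proof -
  have yG: "y \<in> carrier G" and yx: "y \<otimes> inv x \<in> K" using y by (auto simp: rcos_def)
  have "z \<otimes> inv y \<in> K \<longleftrightarrow> z \<otimes> inv x \<in> K" if z: "z \<in> carrier G" for z
  proof
    assume "z \<otimes> inv y \<in> K"
    from subgroup.m_closed[OF K this yx] show "z \<otimes> inv x \<in> K"
      using x yG z by (simp add: m_assoc mult_inv_cancel)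
  next
    assume "z \<otimes> inv x \<in> K"
    from subgroup.m_closed[OF K this subgroup.m_inv_closed[OF K yx]] show "z \<otimes> inv y \<in> K"
      using x yG z by (simp add: m_assoc inv_mult_group mult_inv_cancel)
  qed
  then show ?thesis by (auto simp: rcos_def)
qed

lemma rcos_disjoint:
  assumes "x \<in> carrier G" "y \<in> carrier G" "rcos K x \<noteq> rcos K y"
  shows "rcos K x \<inter> rcos K y = {}"
  using assms rcos_eq by blast

text \<open>The sum over right cosets d = K x of the corners of T cut off to d on both sides,
  written coordinatewise: row x reads only the coset of x. On a left convolution it erases the
  Fourier coefficients off K, so it extends the trace preserving expectation onto L(K) to all
  bounded operators.\<close>

definition block_diag :: "'a oper \<Rightarrow> 'a oper"
  where "block_diag T = (\<lambda>u\<in>L2. \<lambda>x. if x \<in> carrier G then T (cut (rcos K x) u) x else 0)"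

lemma block_diag_apply:
  "u \<in> L2 \<Longrightarrow> x \<in> carrier G \<Longrightarrow> block_diag T u x = T (cut (rcos K x) u) x"
  by (simp add: block_diag_def)

lemma cut_add: "cut B (\<lambda>x. u x + v x) = (\<lambda>x. cut B u x + cut B v x)"
  by (auto simp: cut_def)

lemma cut_scale: "cut B (\<lambda>x. c * u x) = (\<lambda>x. c * cut B u x)"
  by (auto simp: cut_def)

text \<open>A finite set of rows is grouped by cosets. The rows in d see only
  \<open>cut d u\<close>, and the pieces of u in different cosets are orthogonal, so their squared
  norms add up to at most that of u; the bound of T is retained.\<close>

lemma block_diag_in:
  assumes T: "T \<in> bounded_ops (carrier G)" shows "block_diag T \<in> bounded_ops (carrier G)"
proof -
  let ?S = "carrier G"
  obtain C where C: "C \<ge> 0" "\<And>u. u \<in> L2 \<Longrightarrow> ell2_norm ?S (T u) \<le> C * ell2_norm ?S u"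
    using op_bound[OF T] by blast
  have part: "(\<Sum>x\<in>F. (cmod (block_diag T u x))\<^sup>2) \<le> (C * ell2_norm ?S u)\<^sup>2"
    if F: "finite F" "F \<subseteq> ?S" and u: "u \<in> L2" for F u
  proof -
    have "(\<Sum>x\<in>F. (cmod (block_diag T u x))\<^sup>2)
        = (\<Sum>d\<in>rcos K ` F. \<Sum>x\<in>{x \<in> F. rcos K x = d}. (cmod (block_diag T u x))\<^sup>2)"
      by (rule sum.image_gen[OF F(1)])
    also have "\<dots> \<le> (\<Sum>d\<in>rcos K ` F. C\<^sup>2 * (ell2_norm ?S (cut d u))\<^sup>2)"
    proof (rule sum_mono)
      fix d assume "d \<in> rcos K ` F"
      have "(\<Sum>x\<in>{x \<in> F. rcos K x = d}. (cmod (block_diag T u x))\<^sup>2)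
          = (\<Sum>x\<in>{x \<in> F. rcos K x = d}. (cmod (T (cut d u) x))\<^sup>2)"
        by (rule sum.cong) (use F u in \<open>auto simp: block_diag_apply\<close>)
      also have "\<dots> \<le> (ell2_norm ?S (T (cut d u)))\<^sup>2"
        by (rule ell2_finite_sum_le[OF op_in_ell2[OF T ell2_cut[OF u]]]) (use F in auto)
      also have "\<dots> \<le> (C * ell2_norm ?S (cut d u))\<^sup>2"
        by (rule power_mono[OF C(2)[OF ell2_cut[OF u]]]) simp
      finally show "(\<Sum>x\<in>{x \<in> F. rcos K x = d}. (cmod (block_diag T u x))\<^sup>2) \<le> C\<^sup>2 * (ell2_norm ?S (cut d u))\<^sup>2"
        by (simp add: power_mult_distrib)
    qed
    also have "\<dots> = C\<^sup>2 * (ell2_norm ?S (cut (\<Union>(rcos K ` F)) u))\<^sup>2"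
    proof -
      have "A \<inter> B = {}" if "A \<in> rcos K ` F" "B \<in> rcos K ` F" "A \<noteq> B" for A B
        using that F rcos_disjoint by blast
      then show ?thesis using F by (simp add: sum_distrib_left[symmetric] cut_disjoint_norm[OF u])
    qed
    also have "\<dots> \<le> C\<^sup>2 * (ell2_norm ?S u)\<^sup>2"
      by (intro mult_left_mono power_mono cut_norm_le u) auto
    finally show ?thesis by (simp add: power_mult_distrib)
  qed
  have mem: "block_diag T u \<in> L2 \<and> ell2_norm ?S (block_diag T u) \<le> C * ell2_norm ?S u" if u: "u \<in> L2" for u
    using ell2_boundI[of ?S "block_diag T u" "C * ell2_norm ?S u"] part[OF _ _ u] C(1) u
    by (auto simp: block_diag_def)
  show ?thesis
  proof (rule bounded_opsI[where C = C])
    show "block_diag T \<in> extensional L2" by (simp add: block_diag_def)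
    show "block_diag T (\<lambda>x. u x + v x) = (\<lambda>x. block_diag T u x + block_diag T v x)"
      if "u \<in> L2" "v \<in> L2" for u v
      using that by (auto simp: block_diag_def cut_add op_vec_add[OF T] fun_eq_iff)
    show "block_diag T (\<lambda>x. c * u x) = (\<lambda>x. c * block_diag T u x)" if "u \<in> L2" for c u
      using that by (auto simp: block_diag_def cut_scale op_vec_scale[OF T] fun_eq_iff)
  qed (use mem in auto)
qed

lemma block_diag_add:
  "block_diag (op_add (carrier G) T R) = op_add (carrier G) (block_diag T) (block_diag R)"
  by (auto simp: block_diag_def op_add_def fun_eq_iff)

lemma block_diag_scale:
  "block_diag (op_scale (carrier G) c T) = op_scale (carrier G) c (block_diag T)"
  by (auto simp: block_diag_def op_scale_def fun_eq_iff)

text \<open>The quadratic form of the compression is the sum over the cosets d of the form of T at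
  \<open>cut d u\<close>.\<close>

lemma block_diag_positive:
  assumes "op_positive (carrier G) T" shows "op_positive (carrier G) (block_diag T)"
proof -
  let ?S = "carrier G"
  have T: "T \<in> bounded_ops ?S" and pos: "\<And>u. u \<in> L2 \<Longrightarrow> ell2_inner ?S (T u) u \<in> \<real>\<^sub>\<ge>\<^sub>0"
    using assms by (auto simp: op_positive_def)
  have "ell2_inner ?S (block_diag T u) u \<in> \<real>\<^sub>\<ge>\<^sub>0" if u: "u \<in> L2" for u
  proof -
    define f where "f = (\<lambda>x. block_diag T u x * cnj (u x))"
    let ?D = "rcos K ` ?S"
    have fst: "fst p = rcos K (snd p)" if p: "p \<in> Sigma ?D (\<lambda>d. d)" for p
    proof -
      obtain z where "z \<in> ?S" "fst p = rcos K z" using p by auto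
      moreover have "snd p \<in> fst p" using p by auto
      ultimately show ?thesis using rcos_eq[of z "snd p"] by simp
    qed
    \<comment> \<open>Cosets partition the group; pairing each element with its coset turns the sum
      over the group into an iterated sum.\<close>
    have bij: "bij_betw snd (Sigma ?D (\<lambda>d. d)) ?S"
      unfolding bij_betw_def
    proof
      show "inj_on snd (Sigma ?D (\<lambda>d. d))"
        by (rule inj_onI) (metis fst prod_eqI)
      show "snd ` (Sigma ?D (\<lambda>d. d)) = ?S"
      proof
        show "snd ` (Sigma ?D (\<lambda>d. d)) \<subseteq> ?S" by (auto simp: rcos_def)
        show "?S \<subseteq> snd ` (Sigma ?D (\<lambda>d. d))"
        proof
          fix x assume x: "x \<in> ?S"
          have "(rcos K x, x) \<in> Sigma ?D (\<lambda>d. d)" using x rcos_self[OF x] by auto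
          then show "x \<in> snd ` (Sigma ?D (\<lambda>d. d))" by (metis image_eqI snd_conv)
        qed
      qed
    qed
    have fS: "f summable_on ?S"
      unfolding f_def by (rule ell2_inner_summable[OF op_in_ell2[OF block_diag_in[OF T] u] u])
    then have "(\<lambda>p. f (snd p)) summable_on (Sigma ?D (\<lambda>d. d))"
      by (simp add: summable_on_reindex_bij_betw[OF bij])
    then have sig: "(\<lambda>(d, x). f x) summable_on (Sigma ?D (\<lambda>d. d))" by (simp add: case_prod_unfold)
    have "ell2_inner ?S (block_diag T u) u = infsum (\<lambda>p. f (snd p)) (Sigma ?D (\<lambda>d. d))"
      unfolding ell2_inner_def f_def by (rule infsum_reindex_bij_betw[OF bij, symmetric])
    also have "\<dots> = (\<Sum>\<^sub>\<infinity>d\<in>?D. \<Sum>\<^sub>\<infinity>x\<in>d. f x)"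
      using infsum_Sigma'_banach[OF sig] by (simp add: case_prod_unfold)
    also have "\<dots> = (\<Sum>\<^sub>\<infinity>d\<in>?D. ell2_inner ?S (T (cut d u)) (cut d u))"
    proof (rule infsum_cong)
      fix d assume "d \<in> ?D"
      then obtain z where z: "z \<in> ?S" "d = rcos K z" by blast
      have dS: "d \<subseteq> ?S" by (auto simp: z rcos_def)
      show "(\<Sum>\<^sub>\<infinity>x\<in>d. f x) = ell2_inner ?S (T (cut d u)) (cut d u)"
        unfolding ell2_inner_def
      proof (rule infsum_cong_neutral)
        fix x assume "x \<in> d \<inter> ?S"
        then show "f x = T (cut d u) x * cnj (cut d u x)"
          using rcos_eq[OF z(1)] u by (simp add: f_def block_diag_apply z(2)) (simp add: cut_def)
      qed (use dS in \<open>auto simp: cut_def\<close>)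
    qed
    \<comment> \<open>By convention a sum that fails to converge is 0, which is nonnegative
      too.\<close>
    also have "\<dots> \<in> \<real>\<^sub>\<ge>\<^sub>0"
    proof (cases "(\<lambda>d. ell2_inner ?S (T (cut d u)) (cut d u)) summable_on ?D")
      case True
      then have "0 \<le> (\<Sum>\<^sub>\<infinity>d\<in>?D. ell2_inner ?S (T (cut d u)) (cut d u))"
        by (rule infsum_nonneg_complex)
          (use pos[OF ell2_cut[OF u]] in \<open>auto simp: complex_nonneg_Reals_iff less_eq_complex_def\<close>)
      then show ?thesis by (simp add: complex_nonneg_Reals_iff less_eq_complex_def)
    qed (simp add: infsum_not_exists)
    finally show ?thesis .
  qed
  then show ?thesis by (simp add: op_positive_def block_diag_in[OF T])
qed

text \<open>Left translation by K preserves every right coset, so the cut-offs to these lie in the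
  commutant of L(K): elements of L(K) are block diagonal.\<close>

lemma subgroup_vn_cut:
  assumes A: "A \<in> subgroup_vn G K" and z: "z \<in> carrier G" and u: "u \<in> L2"
  shows "A (cut (rcos K z) u) = cut (rcos K z) (A u)"
proof -
  have "cutop (carrier G) (rcos K z) \<in> commutant (carrier G) (left_regular G ` K)"
  proof (rule cutop_left_commutant[OF rcos_subgroup_subset])
    fix k x assume k: "k \<in> K" and x: "x \<in> carrier G"
    have kG: "k \<in> carrier G" using k rcos_subgroup_subset by blast
    have "inv k \<otimes> (x \<otimes> inv z) \<in> K \<longleftrightarrow> x \<otimes> inv z \<in> K"
    proof
      assume "inv k \<otimes> (x \<otimes> inv z) \<in> K"
      from subgroup.m_closed[OF K k this] show "x \<otimes> inv z \<in> K" using kG x z by (simp add: mult_inv_cancel)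
    next
      assume "x \<otimes> inv z \<in> K"
      then show "inv k \<otimes> (x \<otimes> inv z) \<in> K" by (rule subgroup.m_closed[OF K subgroup.m_inv_closed[OF K k]])
    qed
    then show "inv k \<otimes> x \<in> rcos K z \<longleftrightarrow> x \<in> rcos K z"
      using kG x z by (simp add: rcos_def m_assoc)
  qed
  then have "A (cutop (carrier G) (rcos K z) u) = cutop (carrier G) (rcos K z) (A u)"
    using A u unfolding subgroup_vn_def commutant_iff[OF commutant_bounded] by blast
  moreover have "A \<in> bounded_ops (carrier G)" using A by (auto simp: subgroup_vn_def commutant_def[of _ "commutant _ _"])
  ultimately show ?thesis using u by (simp add: cutop_apply op_in_ell2)
qed

lemma subgroup_vn_bounded: "A \<in> subgroup_vn G K \<Longrightarrow> A \<in> bounded_ops (carrier G)"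
  by (auto simp: subgroup_vn_def commutant_def[of _ "commutant _ _"])

lemma block_diag_id:
  assumes A: "A \<in> subgroup_vn G K" shows "block_diag A = A"
proof (rule op_eqI[OF block_diag_in[OF subgroup_vn_bounded[OF A]] subgroup_vn_bounded[OF A]])
  fix u assume u: "u \<in> L2"
  show "block_diag A u = A u"
  proof
    fix x show "block_diag A u x = A u x"
    proof (cases "x \<in> carrier G")
      case True
      then show ?thesis
        by (simp add: block_diag_apply u subgroup_vn_cut[OF A True u]) (simp add: cut_def rcos_self)
    next
      case False
      then show ?thesis
        using ell2_outside[OF op_in_ell2[OF subgroup_vn_bounded[OF A] u]] u by (simp add: block_diag_def)
    qed
  qed
qed

text \<open>A and B preserve the blocks, so they may be moved across the cut-offs.\<close>

lemma block_diag_bimodule: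
  assumes A: "A \<in> subgroup_vn G K" and B: "B \<in> subgroup_vn G K" and T: "T \<in> bounded_ops (carrier G)"
  shows "block_diag (op_mult (carrier G) A (op_mult (carrier G) T B))
    = op_mult (carrier G) A (op_mult (carrier G) (block_diag T) B)"
proof -
  let ?S = "carrier G"
  note AB = subgroup_vn_bounded[OF A] and BB = subgroup_vn_bounded[OF B]
  have b1: "op_mult ?S A (op_mult ?S T B) \<in> bounded_ops ?S" by (intro op_mult_in AB BB T)
  have b2: "op_mult ?S A (op_mult ?S (block_diag T) B) \<in> bounded_ops ?S" by (intro op_mult_in AB BB block_diag_in T)
  show ?thesis
  proof (rule op_eqI[OF block_diag_in[OF b1] b2])
    fix u assume u: "u \<in> L2"
    note L = op_in_ell2[OF block_diag_in[OF b1] u] op_in_ell2[OF b2 u]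
    show "block_diag (op_mult ?S A (op_mult ?S T B)) u = op_mult ?S A (op_mult ?S (block_diag T) B) u"
    proof
      fix x show "block_diag (op_mult ?S A (op_mult ?S T B)) u x = op_mult ?S A (op_mult ?S (block_diag T) B) u x"
      proof (cases "x \<in> ?S")
        case x: True
        define w where "w = B u"
        have w: "w \<in> L2" unfolding w_def by (rule op_in_ell2[OF BB u])
        let ?d = "rcos K x"
        have Tw: "T (cut ?d w) \<in> L2" by (rule op_in_ell2[OF T ell2_cut[OF w]])
        have bw: "block_diag T w \<in> L2" by (rule op_in_ell2[OF block_diag_in[OF T] w])
        \<comment> \<open>All rows in one coset use the same cut-off of w, so within the block the
          compression agrees with T applied to \<open>cut ?d w\<close>.\<close>
        have "cut ?d (block_diag T w) = cut ?d (T (cut ?d w))"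
        proof
          fix y show "cut ?d (block_diag T w) y = cut ?d (T (cut ?d w)) y"
          proof (cases "y \<in> ?d")
            case True
            then have "y \<in> ?S" by (simp add: rcos_def)
            then show ?thesis using True rcos_eq[OF x True] w by (simp add: cut_def[of _ "block_diag T w"] cut_def[of _ "T _"] block_diag_apply)
          qed (simp add: cut_def)
        qed
        then have eq: "cut ?d (A (block_diag T w)) = cut ?d (A (T (cut ?d w)))"
          by (simp add: subgroup_vn_cut[OF A x bw, symmetric] subgroup_vn_cut[OF A x Tw, symmetric])
        have "A (block_diag T w) x = A (T (cut ?d w)) x"
          using fun_cong[OF eq, of x] rcos_self[OF x] by (simp add: cut_def[of _ "A _"])
        then show ?thesis
          using x u w by (simp add: block_diag_apply op_mult_apply subgroup_vn_cut[OF B x u] w_def)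
      next
        case False
        then show ?thesis using ell2_outside[OF L(1) False] ell2_outside[OF L(2) False] by simp
      qed
    qed
  qed
qed

text \<open>Right translations permute the right cosets, so the compression of X still commutes with
  them. For x outside K the coset of x misses \<open>\<one>\<close>, which kills the coefficient at
  x.\<close>

lemma block_diag_right_vn:
  assumes X: "X \<in> right_vn G" shows "block_diag X \<in> subgroup_vn G K"
  unfolding subgroup_vn_eq[OF K]
proof (intro CollectI conjI ballI)
  let ?S = "carrier G"
  have XB: "X \<in> bounded_ops ?S" by (rule right_vn_bounded[OF X])
  note bS = op_in_ell2[OF block_diag_in[OF XB]]
  show "block_diag X \<in> right_vn G"
    unfolding right_vn_iff
  proof (intro conjI ballI block_diag_in[OF XB])
    fix h u assume h: "h \<in> ?S" and u: "u \<in> L2"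
    note rh = op_in_ell2[OF right_regular_in[OF h]]
    show "block_diag X (right_regular G h u) = right_regular G h (block_diag X u)"
    proof
      fix x show "block_diag X (right_regular G h u) x = right_regular G h (block_diag X u) x"
      proof (cases "x \<in> ?S")
        case x: True
        have "cut (rcos K x) (right_regular G h u) = right_regular G h (cut (rcos K (x \<otimes> h)) u)"
        proof
          fix y show "cut (rcos K x) (right_regular G h u) y = right_regular G h (cut (rcos K (x \<otimes> h)) u) y"
          proof (cases "y \<in> ?S")
            case True
            then have "y \<otimes> h \<in> rcos K (x \<otimes> h) \<longleftrightarrow> y \<in> rcos K x"
              using x h by (simp add: rcos_def inv_mult_group m_assoc mult_inv_cancel)
            then show ?thesis using True u
              by (simp add: right_regular_apply) (simp add: cut_def right_regular_apply)
          next
            case False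
            then show ?thesis using ell2_outside[OF rh[OF u] False] ell2_outside[OF rh[OF ell2_cut[OF u]] False]
              by (simp add: cut_def)
          qed
        qed
        moreover have "X (right_regular G h (cut (rcos K (x \<otimes> h)) u)) = right_regular G h (X (cut (rcos K (x \<otimes> h)) u))"
          using X h ell2_cut[OF u] unfolding right_vn_iff by blast
        ultimately show ?thesis
          using x h u by (simp add: block_diag_apply rh right_regular_apply op_in_ell2[OF XB] bS)
      next
        case False
        then show ?thesis using ell2_outside[OF bS[OF rh[OF u]] False] ell2_outside[OF rh[OF bS[OF u]] False] by simp
      qed
    qed
  qed
  fix x assume x: "x \<in> ?S - K"
  have "\<one> \<notin> rcos K x" using x subgroup.m_inv_closed[OF K, of "inv x"] by (auto simp: rcos_def)
  then have "cut (rcos K x) (ket \<one>) = (\<lambda>x. 0)" by (auto simp: cut_def ket_def)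
  then show "block_diag X (ket \<one>) x = 0" using x by (simp add: block_diag_apply op_vec_zero[OF XB])
qed

end

text \<open>Averaging lands in the algebra of the whole group and compression then in L(K).
  Averaging fixes L(K) and respects its multiplications because L(K) lies inside
  \<open>right_vn\<close>.\<close>

theorem subgroup_vn_amenable:
  assumes lim: "left_invariant_mean G m" and K: "subgroup K G"
  shows "amenable_vn (carrier G) (subgroup_vn G K)"
  unfolding amenable_vn_def
proof (intro conjI exI)
  let ?S = "carrier G" and ?E = "\<lambda>T. block_diag K (average m T)"
  have NR: "A \<in> right_vn G" if "A \<in> subgroup_vn G K" for A using that by (simp add: subgroup_vn_eq[OF K])
  show "von_neumann_algebra ?S (subgroup_vn G K)" by (rule subgroup_vn_von_neumann[OF K])
  show "conditional_expectation ?S (subgroup_vn G K) ?E"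
    unfolding conditional_expectation_def
  proof (intro conjI ballI allI impI)
    show "?E T \<in> subgroup_vn G K" if "T \<in> bounded_ops ?S" for T
      by (rule block_diag_right_vn[OF K average_right_vn[OF lim that]])
    show "?E (op_add ?S T R) = op_add ?S (?E T) (?E R)" if "T \<in> bounded_ops ?S" "R \<in> bounded_ops ?S" for T R
      by (simp add: average_add[OF lim that] block_diag_add[OF K])
    show "?E (op_scale ?S c T) = op_scale ?S c (?E T)" if "T \<in> bounded_ops ?S" for c T
      by (simp add: average_scale[OF lim that] block_diag_scale[OF K])
    show "op_positive ?S (?E T)" if "op_positive ?S T" for T
      by (rule block_diag_positive[OF K average_positive[OF lim that]])
    show "?E A = A" if "A \<in> subgroup_vn G K" for A
      by (simp add: average_id[OF lim NR[OF that]] block_diag_id[OF K that])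
    show "?E (op_mult ?S A (op_mult ?S T B)) = op_mult ?S A (op_mult ?S (?E T) B)"
      if "A \<in> subgroup_vn G K" "B \<in> subgroup_vn G K" "T \<in> bounded_ops ?S" for A B T
      by (simp add: average_bimodule[OF lim NR[OF that(1)] NR[OF that(2)] that(3)]
          block_diag_bimodule[OF K that(1,2) average_in[OF lim that(3)]])
  qed
qed

end

section \<open>The index\<close>

context group
begin

text \<open>Sliding the cosets \<open>K\<gamma>\<^sub>i\<close> to \<open>K\<gamma>\<^bsub>i+1\<^esub>\<close> gives an isometry in the commutant that is not unitary.\<close>

lemma not_finite_left_commutant:
  fixes \<gamma> :: "nat \<Rightarrow> 'a"
  assumes K: "subgroup K G" and \<gamma>: "\<And>i. \<gamma> i \<in> carrier G"
    and sep: "\<And>i j. i \<noteq> j \<Longrightarrow> \<gamma> i \<otimes> inv \<gamma> j \<notin> K"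
  shows "\<not> finite_vn (carrier G) (commutant (carrier G) (left_regular G ` K))"
proof
  let ?S = "carrier G"
  assume fin: "finite_vn ?S (commutant ?S (left_regular G ` K))"
  have KG: "K \<subseteq> ?S" using K by (rule subgroup.subset)
  note Kc = subgroup.m_closed[OF K] and Ki = subgroup.m_inv_closed[OF K]
  have uniq: "i = j" if x: "x \<in> ?S" and i: "x \<otimes> inv \<gamma> i \<in> K" and j: "x \<otimes> inv \<gamma> j \<in> K" for x i j
  proof (rule ccontr)
    assume "i \<noteq> j"
    have "inv (x \<otimes> inv \<gamma> i) \<otimes> (x \<otimes> inv \<gamma> j) \<in> K" by (intro Kc Ki i j)
    then have "\<gamma> i \<otimes> inv \<gamma> j \<in> K"
      using x \<gamma> by (simp add: inv_mult_group m_assoc mult_inv_cancel)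
    with sep[OF \<open>i \<noteq> j\<close>] show False by simp
  qed
  define E where "E = {x \<in> ?S. \<exists>i. x \<otimes> inv \<gamma> i \<in> K}"
  \<comment> \<open>By \<open>sep\<close> the cosets of the representatives are disjoint, so the
    index is unique where it exists.\<close>
  define ix where "ix = (\<lambda>x. SOME i. x \<otimes> inv \<gamma> i \<in> K)"
  have ix: "x \<otimes> inv \<gamma> (ix x) \<in> K" if "x \<in> E" for x
    using that someI_ex[of "\<lambda>i. x \<otimes> inv \<gamma> i \<in> K"] by (simp add: E_def ix_def)
  have ixI: "ix x = i" "x \<in> E" if "x \<in> ?S" "x \<otimes> inv \<gamma> i \<in> K" for x i
  proof -
    show "x \<in> E" using that by (auto simp: E_def)
    from ix[OF this] show "ix x = i" using uniq that by blast
  qed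
  have ES: "x \<in> ?S" if "x \<in> E" for x using that by (simp add: E_def)
  \<comment> \<open>Writing x = k \<gamma>_i with k in K, f replaces \<gamma>_i by \<gamma>_{i+1};
    points in no listed coset stay fixed. The map is injective, commutes with left multiplication by
    K and misses the coset of \<open>\<gamma> 0\<close>.\<close>
  define f where "f = (\<lambda>x. if x \<in> E then x \<otimes> inv \<gamma> (ix x) \<otimes> \<gamma> (Suc (ix x)) else x)"
  have fS: "f x \<in> ?S" if "x \<in> ?S" for x using that \<gamma> by (simp add: f_def)
  have fE: "f x \<in> E" "ix (f x) = Suc (ix x)" if x: "x \<in> E" for x
  proof -
    have xS: "x \<in> ?S" by (rule ES[OF x])
    have "f x \<otimes> inv \<gamma> (Suc (ix x)) = x \<otimes> inv \<gamma> (ix x)" using x xS \<gamma> by (simp add: f_def m_assoc)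
    then have "f x \<otimes> inv \<gamma> (Suc (ix x)) \<in> K" using ix[OF x] by simp
    from ixI[OF fS[OF xS] this] show "f x \<in> E" "ix (f x) = Suc (ix x)" by auto
  qed
  have fnE: "f x = x" if "x \<notin> E" for x using that by (simp add: f_def)
  have inj: "inj_on f ?S"
  proof (rule inj_onI)
    fix x y assume x: "x \<in> ?S" and y: "y \<in> ?S" and eq: "f x = f y"
    have E: "x \<in> E \<longleftrightarrow> y \<in> E" using fE(1) fnE eq by metis
    show "x = y"
    proof (cases "x \<in> E")
      case True
      then have yE: "y \<in> E" using E by simp
      have "Suc (ix x) = Suc (ix y)" using fE(2)[OF True] fE(2)[OF yE] eq by simp
      then have "x \<otimes> (inv \<gamma> (ix x) \<otimes> \<gamma> (Suc (ix x))) = y \<otimes> (inv \<gamma> (ix x) \<otimes> \<gamma> (Suc (ix x)))"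
        using eq True yE x y \<gamma> by (simp add: f_def m_assoc)
      then show ?thesis using x y \<gamma> by simp
    next
      case False
      then show ?thesis using E eq fnE by simp
    qed
  qed
  have g0: "\<gamma> 0 \<in> E" "ix (\<gamma> 0) = 0"
    using ixI[of "\<gamma> 0" 0] \<gamma> subgroup.one_closed[OF K] by auto
  have notin: "f x \<noteq> \<gamma> 0" if "x \<in> ?S" for x
    using fE[of x] fnE[of x] g0 by (cases "x \<in> E") auto
  have fK: "f (k \<otimes> x) = k \<otimes> f x" if k: "k \<in> K" and x: "x \<in> ?S" for k x
  proof -
    have kG: "k \<in> ?S" using k KG by blast
    have iff: "k \<otimes> x \<otimes> inv \<gamma> i \<in> K \<longleftrightarrow> x \<otimes> inv \<gamma> i \<in> K" for i
    proof
      assume "k \<otimes> x \<otimes> inv \<gamma> i \<in> K"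
      from Kc[OF Ki[OF k] this] show "x \<otimes> inv \<gamma> i \<in> K" using kG x \<gamma> by (simp add: m_assoc mult_inv_cancel)
    next
      assume "x \<otimes> inv \<gamma> i \<in> K"
      from Kc[OF k this] show "k \<otimes> x \<otimes> inv \<gamma> i \<in> K" using kG x \<gamma> by (simp add: m_assoc)
    qed
    have "k \<otimes> x \<in> E \<longleftrightarrow> x \<in> E" and "ix (k \<otimes> x) = ix x" using kG x by (simp_all add: E_def ix_def iff)
    then show ?thesis using kG x \<gamma> by (simp add: f_def m_assoc)
  qed
  define W where "W = pull ?S f"
  have WB: "W \<in> bounded_ops ?S" unfolding W_def using inj fS by (intro pull_in) auto
  have WC: "W \<in> commutant ?S (left_regular G ` K)"
  proof (rule left_commutantI[OF WB KG])
    fix k u x assume k: "k \<in> K" and u: "u \<in> L2" and x: "x \<in> ?S"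
    have kG: "k \<in> ?S" using k KG by blast
    have "left_regular G k u \<in> L2" by (rule op_in_ell2[OF left_regular_in[OF kG] u])
    then show "W (left_regular G k u) x = W u (inv k \<otimes> x)"
      using x kG u fS fK[OF Ki[OF k] x] by (simp add: W_def pull_apply left_regular_apply)
  qed
  \<comment> \<open>Reading coordinates through f is the adjoint of moving basis vectors: V is the
    isometry taking \<open>ket x\<close> to \<open>ket (f x)\<close>, and W annihilates
    \<open>ket (\<gamma> 0)\<close> because \<open>\<gamma> 0\<close> is not a value of f.\<close>
  define V where "V = op_adj ?S W"
  have VB: "V \<in> bounded_ops ?S" unfolding V_def by (rule op_adj_in[OF WB])
  have VC: "V \<in> commutant ?S (left_regular G ` K)"
    unfolding V_def by (rule commutant_adj[OF left_image_bounded[OF KG] left_regular_adj_closed[OF K] WC])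
  have adjV: "op_adj ?S V = W" unfolding V_def by (rule op_adj_adj[OF WB])
  have Wket: "W (ket y) x = ket y (f x)" if "x \<in> ?S" "y \<in> ?S" for x y
    using that by (simp add: W_def pull_apply)
  have Vket: "V (ket x) = ket (f x)" if x: "x \<in> ?S" for x
  proof
    fix y show "V (ket x) y = ket (f x) y"
    proof (cases "y \<in> ?S")
      case True
      then show ?thesis
        unfolding V_def op_adj_ket[OF WB True x] Wket[OF x True] by (auto simp: ket_def)
    next
      case False
      then have "y \<noteq> f x" using fS[OF x] by blast
      then show ?thesis using ell2_outside[OF op_in_ell2[OF VB ell2_ket[OF x]] False] by (simp add: ket_def)
    qed
  qed
  have "op_mult ?S (op_adj ?S V) V = op_id ?S"
  proof (rule op_eq_ketI)
    show "op_mult ?S (op_adj ?S V) V \<in> bounded_ops ?S" unfolding adjV by (rule op_mult_in[OF WB VB])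
    fix x y assume xy: "x \<in> ?S" "y \<in> ?S"
    have "ket (f x) (f y) = ket x y" using inj_on_eq_iff[OF inj xy] by (auto simp: ket_def)
    then show "op_mult ?S (op_adj ?S V) V (ket x) y = op_id ?S (ket x) y"
      using xy by (simp add: op_mult_apply op_id_apply adjV Vket Wket fS)
  qed simp
  then have "op_mult ?S V (op_adj ?S V) = op_id ?S" using fin VC by (auto simp: finite_vn_def)
  then have "op_mult ?S V W (ket (\<gamma> 0)) = ket (\<gamma> 0)" using \<gamma> by (simp add: adjV op_id_apply)
  moreover have "W (ket (\<gamma> 0)) = (\<lambda>x. 0)"
  proof
    fix x show "W (ket (\<gamma> 0)) x = 0"
      using notin[of x] \<gamma> by (simp add: W_def pull_apply) (simp add: ket_def)
  qed
  ultimately have "ket (\<gamma> 0) = (\<lambda>x. 0)" using \<gamma> by (simp add: op_mult_apply op_vec_zero[OF VB])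
  from fun_cong[OF this, of "\<gamma> 0"] show False by (simp add: ket_def)
qed

section \<open>The commutant of the group algebra: trace, finiteness, coupling constant\<close>

abbreviation left_commutant :: "'a oper set"
  where "left_commutant \<equiv> commutant (carrier G) (left_regular G ` carrier G)"

lemma left_commutant_von_neumann: "von_neumann_algebra (carrier G) left_commutant"
  by (rule von_neumann_commutant[OF left_image_bounded[OF order_refl] left_regular_adj_closed[OF subgroup_self]])

text \<open>The mirror image of \<open>right_vn_matrix\<close>: these operators are right
  convolutions.\<close>

lemma left_commutant_coeff:
  assumes "T \<in> left_commutant" "x \<in> carrier G" "y \<in> carrier G"
  shows "T (ket x) y = T (ket \<one>) (inv x \<otimes> y)"
  using left_commutant_matrix[OF assms(1) order_refl assms(2) one_closed, of "inv x \<otimes> y"] assms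
  by (simp add: mult_inv_cancel)

text \<open>The state of the vector \<open>ket \<one>\<close>. It is faithful because T is
  determined by \<open>T (ket \<one>)\<close>, and tracial because exchanging the factors amounts to
  inverting the summation variable.\<close>

lemma left_commutant_trace: "faithful_tracial_state (carrier G) left_commutant (\<lambda>T. T (ket \<one>) \<one>)"
  unfolding faithful_tracial_state_def
proof (intro conjI ballI allI impI)
  let ?S = "carrier G"
  have k1: "ket \<one> \<in> L2" by simp
  have TB: "T \<in> bounded_ops ?S" if "T \<in> left_commutant" for T using that by (simp add: commutant_def)
  show "op_add ?S A B (ket \<one>) \<one> = A (ket \<one>) \<one> + B (ket \<one>) \<one>" for A B by (simp add: op_add_apply)
  show "op_scale ?S c A (ket \<one>) \<one> = c * A (ket \<one>) \<one>" for c A by (simp add: op_scale_apply)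
  show "op_id ?S (ket \<one>) \<one> = 1" by (simp add: op_id_apply) (simp add: ket_def)
  have sq: "op_mult ?S (op_adj ?S A) A (ket \<one>) \<one> = of_real ((ell2_norm ?S (A (ket \<one>)))\<^sup>2)"
    if A: "A \<in> left_commutant" for A
  proof -
    note AS = op_in_ell2[OF TB[OF A] k1]
    have "op_mult ?S (op_adj ?S A) A (ket \<one>) \<one> = ell2_inner ?S (op_adj ?S A (A (ket \<one>))) (ket \<one>)"
      by (simp add: op_mult_apply ell2_inner_ket)
    also have "\<dots> = ell2_inner ?S (A (ket \<one>)) (A (ket \<one>))" by (rule op_adj_inner_left[OF TB[OF A] AS k1])
    finally show ?thesis by (simp add: ell2_inner_self)
  qed
  show "op_mult ?S (op_adj ?S A) A (ket \<one>) \<one> \<in> \<real>\<^sub>\<ge>\<^sub>0" if "A \<in> left_commutant" for A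
    unfolding sq[OF that] by (simp del: of_real_power)
  show "A = (\<lambda>u\<in>L2. \<lambda>x. 0)" if A: "A \<in> left_commutant" and z: "op_mult ?S (op_adj ?S A) A (ket \<one>) \<one> = 0" for A
  proof (rule op_eq_ketI[OF TB[OF A]])
    have "op_scale ?S 0 (op_id ?S) = (\<lambda>u\<in>L2. \<lambda>x. 0)" by (simp add: op_scale_def)
    then show "(\<lambda>u\<in>L2. \<lambda>x. 0) \<in> bounded_ops ?S" using op_scale_in[OF op_id_in] by metis
    fix x y assume xy: "x \<in> ?S" "y \<in> ?S"
    have "ell2_norm ?S (A (ket \<one>)) = 0" using z by (simp add: sq[OF A])
    then have "A (ket \<one>) = (\<lambda>x. 0)" by (rule ell2_norm_eq_0D[OF op_in_ell2[OF TB[OF A] k1]])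
    then show "A (ket x) y = (\<lambda>u\<in>L2. \<lambda>x. 0) (ket x) y"
      using xy by (simp add: left_commutant_coeff[OF A])
  qed
  show "op_mult ?S A B (ket \<one>) \<one> = op_mult ?S B A (ket \<one>) \<one>"
    if A: "A \<in> left_commutant" and B: "B \<in> left_commutant" for A B
  proof -
    have *: "op_mult ?S A B (ket \<one>) \<one> = (\<Sum>\<^sub>\<infinity>x\<in>?S. B (ket \<one>) x * A (ket \<one>) (inv x))"
      if "A \<in> left_commutant" "B \<in> left_commutant" for A B
    proof -
      have "op_mult ?S A B (ket \<one>) \<one> = (\<Sum>\<^sub>\<infinity>x\<in>?S. B (ket \<one>) x * A (ket x) \<one>)"
        unfolding op_mult_apply[OF k1] by (rule op_matrix[OF TB[OF that(1)] op_in_ell2[OF TB[OF that(2)] k1] one_closed])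
      also have "\<dots> = (\<Sum>\<^sub>\<infinity>x\<in>?S. B (ket \<one>) x * A (ket \<one>) (inv x))"
        by (rule infsum_cong) (simp add: left_commutant_coeff[OF that(1), of _ \<one>])
      finally show ?thesis .
    qed
    have bij: "bij_betw (\<lambda>x. inv x) ?S ?S" by (rule bij_betwI[where g = "\<lambda>x. inv x"]) auto
    have "op_mult ?S B A (ket \<one>) \<one> = (\<Sum>\<^sub>\<infinity>x\<in>?S. A (ket \<one>) (inv x) * B (ket \<one>) (inv (inv x)))"
      unfolding *[OF B A] by (rule infsum_reindex_bij_betw[OF bij, symmetric])
    also have "\<dots> = op_mult ?S A B (ket \<one>) \<one>"
      unfolding *[OF A B] by (rule infsum_cong) (simp add: mult.commute)
    finally show ?thesis by simp
  qed
qed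

text \<open>For an isometry V, the trace of the range projection is 1. So the unit vector
  \<open>ket \<one>\<close> and its image \<open>V w\<close> under that projection have inner
  product 1 and norm 1, hence coincide; since elements are determined by their value at
  \<open>ket \<one>\<close>, the range projection is the identity.\<close>

lemma left_commutant_finite: "finite_vn (carrier G) left_commutant"
  unfolding finite_vn_def
proof (intro conjI left_commutant_von_neumann ballI impI)
  let ?S = "carrier G"
  fix V assume V: "V \<in> left_commutant" and iso: "op_mult ?S (op_adj ?S V) V = op_id ?S"
  have k1: "ket \<one> \<in> L2" by simp
  have VB: "V \<in> bounded_ops ?S" using V by (simp add: commutant_def)
  have aV: "op_adj ?S V \<in> left_commutant"
    using left_commutant_von_neumann V by (simp add: von_neumann_algebra_def)
  have aB: "op_adj ?S V \<in> bounded_ops ?S" by (rule op_adj_in[OF VB])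
  have VV: "op_mult ?S V (op_adj ?S V) \<in> left_commutant"
    by (rule commutant_mult[OF left_image_bounded[OF order_refl] V aV])
  define w where "w = op_adj ?S V (ket \<one>)"
  have w: "w \<in> L2" unfolding w_def by (rule op_in_ell2[OF aB k1])
  have Vw: "V w \<in> L2" by (rule op_in_ell2[OF VB w])
  have Viso: "op_adj ?S V (V w) = w"
    using fun_cong[OF iso, of w] by (simp add: op_mult_apply op_id_apply w)
  have n1: "ell2_norm ?S (ket \<one>) = 1"
  proof -
    have "complex_of_real ((ell2_norm ?S (ket \<one>))\<^sup>2) = 1"
      unfolding ell2_inner_self[symmetric] by (simp add: ell2_inner_ket) (simp add: ket_def)
    then have "(ell2_norm ?S (ket \<one>))\<^sup>2 = 1" using of_real_eq_1_iff by blast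
    then show ?thesis using ell2_norm_nonneg[of ?S "ket \<one>"] by (simp add: power2_eq_1_iff)
  qed
  have i1: "ell2_inner ?S (ket \<one>) (V w) = 1"
  proof -
    have "op_mult ?S V (op_adj ?S V) (ket \<one>) \<one> = op_mult ?S (op_adj ?S V) V (ket \<one>) \<one>"
      using left_commutant_trace V aV unfolding faithful_tracial_state_def by blast
    also have "\<dots> = 1" unfolding iso by (simp add: op_id_apply) (simp add: ket_def)
    finally show ?thesis by (simp add: ell2_inner_ket_left op_mult_apply w_def)
  qed
  have n2: "(ell2_norm ?S (V w))\<^sup>2 = 1"
  proof -
    have "ell2_inner ?S (V w) (V w) = ell2_inner ?S w w"
      using op_adj_inner[OF VB w Vw] by (simp add: Viso)
    also have "\<dots> = ell2_inner ?S (ket \<one>) (V w)"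
      using op_adj_inner_left[OF VB k1 w] by (simp add: w_def)
    finally show ?thesis unfolding ell2_inner_self i1 using of_real_eq_1_iff by blast
  qed
  have "(ell2_norm ?S (\<lambda>x. ket \<one> x - V w x))\<^sup>2 = 0"
    by (simp add: ell2_norm_power2_diff[OF k1 Vw] n1 n2 i1)
  then have "(\<lambda>x. ket \<one> x - V w x) = (\<lambda>x. 0)" by (intro ell2_norm_eq_0D[OF ell2_diff[OF k1 Vw]]) simp
  then have "V w = ket \<one>" by (simp add: fun_eq_iff)
  then have eq1: "op_mult ?S V (op_adj ?S V) (ket \<one>) = ket \<one>" by (simp add: op_mult_apply w_def)
  show "op_mult ?S V (op_adj ?S V) = op_id ?S"
  proof (rule op_eq_ketI[OF op_mult_in[OF VB aB] op_id_in])
    fix x y assume xy: "x \<in> ?S" "y \<in> ?S"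
    have "ket \<one> (inv x \<otimes> y) = ket x y"
    proof -
      have "inv x \<otimes> y = \<one> \<longleftrightarrow> y = x" using xy inv_solve_left'[of "\<one>" y x] mult_inv_cancel(1)[OF xy] by auto
      then show ?thesis by (simp add: ket_def)
    qed
    then show "op_mult ?S V (op_adj ?S V) (ket x) y = op_id ?S (ket x) y"
      using xy by (simp add: left_commutant_coeff[OF VV xy] eq1 op_id_apply)
  qed
qed

text \<open>A quotient of finite quantities is infinite only if the denominator vanishes. The
  denominator is the trace of a nonzero projection, positive for every faithful trace; thus the
  claim holds whatever vector and trace the choice operators select.\<close>

lemma coupling_constant_group_vn: "coupling_constant (carrier G) (group_vn G) \<noteq> \<infinity>"
proof -
  let ?S = "carrier G"
  have comm: "commutant ?S (group_vn G) = left_commutant"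
    unfolding group_vn_def by (rule subgroup_vn_commutant[OF order_refl])
  define \<xi> where "\<xi> = (SOME \<xi>. \<xi> \<in> L2 \<and> \<xi> \<noteq> (\<lambda>x. 0))"
  have "ket \<one> \<noteq> (\<lambda>x. 0)" by (auto simp: ket_def fun_eq_iff)
  then have "ket \<one> \<in> L2 \<and> ket \<one> \<noteq> (\<lambda>x. 0)" by simp
  then have \<xi>: "\<xi> \<in> L2" "\<xi> \<noteq> (\<lambda>x. 0)"
    unfolding \<xi>_def using someI[of "\<lambda>\<xi>. \<xi> \<in> L2 \<and> \<xi> \<noteq> (\<lambda>x. 0)"] by blast+
  have vn: "von_neumann_algebra ?S (group_vn G)"
    unfolding group_vn_def by (rule subgroup_vn_von_neumann[OF subgroup_self])
  define P where "P = cyclic_projection ?S (group_vn G) \<xi>"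
  note cp = cyclic_projection[OF vn \<xi>(1), folded P_def]
  define \<tau> where "\<tau> = factor_trace ?S left_commutant"
  have \<tau>: "faithful_tracial_state ?S left_commutant \<tau>"
    unfolding \<tau>_def factor_trace_def by (rule someI[of "faithful_tracial_state ?S left_commutant", OF left_commutant_trace])
  have PL: "P \<in> left_commutant" using cp(2) by (simp add: comm)
  have PP: "op_mult ?S (op_adj ?S P) P = P" using cp(1) by (simp add: op_projection_def)
  have "P \<noteq> (\<lambda>u\<in>L2. \<lambda>x. 0)" using cp(3) \<xi> by auto
  then have "\<tau> P \<noteq> 0" and "\<tau> P \<in> \<real>\<^sub>\<ge>\<^sub>0"
    using \<tau> PL PP unfolding faithful_tracial_state_def by metis+
  then have pos: "Re (\<tau> P) > 0" by (auto simp: complex_nonneg_Reals_iff complex_eq_iff less_le)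
  have "coupling_constant ?S (group_vn G)
    = ennreal (Re (factor_trace ?S (group_vn G) (cyclic_projection ?S left_commutant \<xi>))) / ennreal (Re (\<tau> P))"
    by (simp add: coupling_constant_def comm left_commutant_finite Let_def \<xi>_def[symmetric] P_def \<tau>_def)
  then show ?thesis using pos by (simp add: ennreal_divide_eq_top_iff)
qed

theorem jones_index_infinite:
  fixes \<gamma> :: "nat \<Rightarrow> 'a"
  assumes K: "subgroup K G" and \<gamma>: "\<And>i. \<gamma> i \<in> carrier G"
    and sep: "\<And>i j. i \<noteq> j \<Longrightarrow> \<gamma> i \<otimes> inv \<gamma> j \<notin> K"
  shows "jones_index (carrier G) (group_vn G) (subgroup_vn G K) = \<infinity>"
proof -
  have "coupling_constant (carrier G) (subgroup_vn G K) = \<infinity>"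
    using not_finite_left_commutant[OF K \<gamma> sep]
    by (simp add: coupling_constant_def subgroup_vn_commutant[OF subgroup.subset[OF K]])
  \<comment> \<open>In \<open>ennreal\<close> the quotient of \<infinity> by \<infinity> is 0, so
    finiteness of the denominator matters.\<close>
  then show ?thesis
    using coupling_constant_group_vn by (simp add: jones_index_def ennreal_top_divide)
qed

end

section \<open>Houghton groups\<close>

text \<open>Eventual translation with the exceptional set replaced by a threshold common to all
  rays. Carrying the translation vector m explicitly lets composition add and inversion negate
  it.\<close>

definition shifts :: "nat \<Rightarrow> (nat \<times> nat \<Rightarrow> nat \<times> nat) \<Rightarrow> (nat \<Rightarrow> int) \<Rightarrow> bool"
  where "shifts n \<sigma> m \<longleftrightarrow>
    (\<exists>B. \<forall>i\<in>{1..n}. \<forall>k\<ge>B. 0 \<le> int k + m i \<and> \<sigma> (k, i) = (nat (int k + m i), i))"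

lemma eventual_translation_shifts:
  assumes "eventual_translation n \<sigma>" shows "\<exists>m. shifts n \<sigma> m"
proof -
  obtain m K where K: "finite K" and
    eq: "\<And>k i. (k, i) \<in> Omega n - K \<Longrightarrow> snd (\<sigma> (k, i)) = i \<and> int (fst (\<sigma> (k, i))) = int k + m i"
    using assms unfolding eventual_translation_def by blast
  define B where "B = Suc (Max (insert 0 (fst ` K)))"
  have "0 \<le> int k + m i \<and> \<sigma> (k, i) = (nat (int k + m i), i)" if i: "i \<in> {1..n}" and k: "k \<ge> B" for k i
  proof -
    have "(k, i) \<notin> K"
    proof
      assume "(k, i) \<in> K"
      then have "k \<le> Max (insert 0 (fst ` K))" using K by (intro Max_ge) force+
      then show False using k by (simp add: B_def)
    qed
    then have "snd (\<sigma> (k, i)) = i" "int (fst (\<sigma> (k, i))) = int k + m i"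
      using eq[of k i] i by (auto simp: Omega_def)
    then show ?thesis by (metis nat_int of_nat_0_le_iff prod.collapse)
  qed
  then show ?thesis unfolding shifts_def by blast
qed

text \<open>The threshold B controls the symmetric differences: a point of ray i leaves the ray only
  below B, and a point (j, i) can be missed only if j < B + m i.\<close>

lemma shifts_houghton:
  assumes \<sigma>: "\<sigma> permutes Omega n" and m: "shifts n \<sigma> m"
  shows "\<sigma> \<in> carrier (houghton_group n)"
proof -
  obtain B where B: "\<And>i k. i \<in> {1..n} \<Longrightarrow> k \<ge> B \<Longrightarrow> 0 \<le> int k + m i \<and> \<sigma> (k, i) = (nat (int k + m i), i)"
    using m unfolding shifts_def by blast
  have "eventual_translation n \<sigma>"
    unfolding eventual_translation_def
  proof (intro exI conjI allI impI)
    show "finite ({..<B} \<times> {1..n})" by simp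
    show "{..<B} \<times> {1..n} \<subseteq> Omega n" by (auto simp: Omega_def)
    fix k i assume "(k, i) \<in> Omega n - {..<B} \<times> {1..n}"
    then show "snd (\<sigma> (k, i)) = i" "int (fst (\<sigma> (k, i))) = int k + m i"
      using B[of i k] by (auto simp: Omega_def)
  qed
  moreover have "finite (sym_diff (\<sigma> ` (UNIV \<times> {i})) (UNIV \<times> {i}))" if i: "i \<in> {1..n}" for i
  proof (rule finite_subset)
    show "finite (\<sigma> ` ({..<B} \<times> {i}) \<union> {..<nat (int B + m i)} \<times> {i})" by simp
    show "sym_diff (\<sigma> ` (UNIV \<times> {i})) (UNIV \<times> {i}) \<subseteq> \<sigma> ` ({..<B} \<times> {i}) \<union> {..<nat (int B + m i)} \<times> {i}"
    proof
      fix p assume "p \<in> sym_diff (\<sigma> ` (UNIV \<times> {i})) (UNIV \<times> {i})"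
      then have "(\<exists>k. p = \<sigma> (k, i) \<and> snd p \<noteq> i) \<or> (\<exists>j. p = (j, i) \<and> p \<notin> \<sigma> ` (UNIV \<times> {i}))"
        by (cases p) auto
      then consider (a) k where "p = \<sigma> (k, i)" "snd p \<noteq> i" | (b) j where "p = (j, i)" "p \<notin> \<sigma> ` (UNIV \<times> {i})"
        by blast
      then show "p \<in> \<sigma> ` ({..<B} \<times> {i}) \<union> {..<nat (int B + m i)} \<times> {i}"
      proof cases
        case a
        then have "k < B" using B[OF i, of k] by (metis leI snd_conv)
        then show ?thesis using a by auto
      next
        case b
        have "j < nat (int B + m i)"
        proof (rule ccontr)
          assume "\<not> j < nat (int B + m i)"
          then have j: "int j - m i \<ge> int B" by linarith
          define k where "k = nat (int j - m i)"
          have k: "k \<ge> B" "int k = int j - m i" using j by (auto simp: k_def)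
          have "\<sigma> (k, i) = p" using B[OF i k(1)] k(2) b(1) by simp
          then show False using b(2) by blast
        qed
        then show ?thesis using b by auto
      qed
    qed
  qed
  ultimately show ?thesis using \<sigma> by (simp add: houghton_group_def)
qed

lemma houghton_iff:
  "\<sigma> \<in> carrier (houghton_group n) \<longleftrightarrow> \<sigma> permutes Omega n \<and> (\<exists>m. shifts n \<sigma> m)"
proof
  assume "\<sigma> \<in> carrier (houghton_group n)"
  then have "\<sigma> permutes Omega n" "eventual_translation n \<sigma>" by (simp_all add: houghton_group_def)
  with eventual_translation_shifts[OF this(2)] show "\<sigma> permutes Omega n \<and> (\<exists>m. shifts n \<sigma> m)" by blast
next
  assume "\<sigma> permutes Omega n \<and> (\<exists>m. shifts n \<sigma> m)"
  then obtain m where "\<sigma> permutes Omega n" "shifts n \<sigma> m" by blast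
  then show "\<sigma> \<in> carrier (houghton_group n)" by (rule shifts_houghton)
qed

section \<open>Translation vectors under composition and inversion\<close>

lemma shift_le_sum:
  fixes m :: "nat \<Rightarrow> int"
  assumes "i \<in> {1..n}" shows "\<bar>m i\<bar> \<le> (\<Sum>i\<in>{1..n}. \<bar>m i\<bar>)"
  by (rule member_le_sum[OF assms]) auto

lemma shifts_comp:
  assumes "shifts n \<sigma> m" "shifts n \<tau> m'"
  shows "shifts n (\<sigma> \<circ> \<tau>) (\<lambda>i. m' i + m i)"
proof -
  obtain B where B: "\<And>i k. i \<in> {1..n} \<Longrightarrow> k \<ge> B \<Longrightarrow> 0 \<le> int k + m i \<and> \<sigma> (k, i) = (nat (int k + m i), i)"
    using assms(1) unfolding shifts_def by blast
  obtain B' where B': "\<And>i k. i \<in> {1..n} \<Longrightarrow> k \<ge> B' \<Longrightarrow> 0 \<le> int k + m' i \<and> \<tau> (k, i) = (nat (int k + m' i), i)"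
    using assms(2) unfolding shifts_def by blast
  \<comment> \<open>c dominates the translation of \<tau> on every ray, so that points beyond B + B'
    + c are still beyond B after applying \<tau>.\<close>
  define c where "c = nat (\<Sum>i\<in>{1..n}. \<bar>m' i\<bar>)"
  have "0 \<le> int k + (m' i + m i) \<and> (\<sigma> \<circ> \<tau>) (k, i) = (nat (int k + (m' i + m i)), i)"
    if i: "i \<in> {1..n}" and k: "k \<ge> B + B' + c" for i k
  proof -
    have c: "\<bar>m' i\<bar> \<le> int c" using shift_le_sum[OF i, of m'] by (simp add: c_def)
    define j where "j = nat (int k + m' i)"
    have j: "int j = int k + m' i" "\<tau> (k, i) = (j, i)" using B'[OF i, of k] k by (auto simp: j_def)
    have "j \<ge> B" using j c k by linarith
    with B[OF i this] j show ?thesis by (simp add: add.assoc)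
  qed
  then show ?thesis unfolding shifts_def by blast
qed

lemma shifts_inv:
  assumes \<sigma>: "\<sigma> permutes Omega n" and m: "shifts n \<sigma> m"
  shows "shifts n (Hilbert_Choice.inv \<sigma>) (\<lambda>i. - m i)"
proof -
  obtain B where B: "\<And>i k. i \<in> {1..n} \<Longrightarrow> k \<ge> B \<Longrightarrow> 0 \<le> int k + m i \<and> \<sigma> (k, i) = (nat (int k + m i), i)"
    using m unfolding shifts_def by blast
  define c where "c = nat (\<Sum>i\<in>{1..n}. \<bar>m i\<bar>)"
  have "0 \<le> int k + - m i \<and> Hilbert_Choice.inv \<sigma> (k, i) = (nat (int k + - m i), i)"
    if i: "i \<in> {1..n}" and k: "k \<ge> B + c" for i k
  proof -
    have c: "\<bar>m i\<bar> \<le> int c" using shift_le_sum[OF i, of m] by (simp add: c_def)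
    define j where "j = nat (int k - m i)"
    have pos: "int k - m i \<ge> int B" using c k by linarith
    then have j: "int j = int k - m i" "j \<ge> B" by (auto simp: j_def)
    have "\<sigma> (j, i) = (k, i)" using B[OF i j(2)] j(1) by simp
    then have "Hilbert_Choice.inv \<sigma> (k, i) = (j, i)"
      using permutes_inverses(2)[OF \<sigma>, of "(j, i)"] by simp
    then show ?thesis using pos by (simp add: j_def)
  qed
  then show ?thesis unfolding shifts_def by blast
qed

lemma shifts_zero_support:
  assumes \<sigma>: "\<sigma> permutes Omega n" and m: "shifts n \<sigma> (\<lambda>i. 0)"
  shows "finite {x. \<sigma> x \<noteq> x}"
proof -
  obtain B where B: "\<And>i k. i \<in> {1..n} \<Longrightarrow> k \<ge> B \<Longrightarrow> \<sigma> (k, i) = (k, i)"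
    using m unfolding shifts_def by fastforce
  have "{x. \<sigma> x \<noteq> x} \<subseteq> {..<B} \<times> {1..n}"
  proof
    fix p assume p: "p \<in> {x. \<sigma> x \<noteq> x}"
    obtain k i where ki: "p = (k, i)" by (cases p)
    have "(k, i) \<in> Omega n" using p \<sigma> by (auto simp: ki permutes_def)
    then have i: "i \<in> {1..n}" by (simp add: Omega_def)
    then show "p \<in> {..<B} \<times> {1..n}" using B[OF i, of k] p by (auto simp: ki not_le[symmetric])
  qed
  then show ?thesis by (rule finite_subset) simp
qed

lemma finite_support_houghton:
  assumes \<sigma>: "\<sigma> permutes Omega n" and fin: "finite {x. \<sigma> x \<noteq> x}"
  shows "\<sigma> \<in> carrier (houghton_group n)"
proof (rule shifts_houghton[OF \<sigma>])
  define B where "B = Suc (Max (insert 0 (fst ` {x. \<sigma> x \<noteq> x})))"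
  have "\<sigma> (k, i) = (k, i)" if k: "k \<ge> B" for k i
  proof (rule ccontr)
    assume "\<sigma> (k, i) \<noteq> (k, i)"
    then have "k \<le> Max (insert 0 (fst ` {x. \<sigma> x \<noteq> x}))" using fin by (intro Max_ge) force+
    then show False using k by (simp add: B_def)
  qed
  then show "shifts n \<sigma> (\<lambda>i. 0)" unfolding shifts_def by (intro exI[of _ B]) auto
qed

section \<open>Group structure and amenability of Houghton groups\<close>

lemma houghton_simps [simp]:
  "\<sigma> \<otimes>\<^bsub>houghton_group n\<^esub> \<tau> = \<sigma> \<circ> \<tau>" "\<one>\<^bsub>houghton_group n\<^esub> = id"
  by (simp_all add: houghton_group_def)

lemma houghton_permutes: "\<sigma> \<in> carrier (houghton_group n) \<Longrightarrow> \<sigma> permutes Omega n"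
  by (simp add: houghton_group_def)

lemma houghton_inv_closed:
  "\<sigma> \<in> carrier (houghton_group n) \<Longrightarrow> Hilbert_Choice.inv \<sigma> \<in> carrier (houghton_group n)"
  unfolding houghton_iff using permutes_inv shifts_inv by blast

lemma houghton_group: "group (houghton_group n)"
proof (rule groupI)
  fix \<sigma> \<tau> assume "\<sigma> \<in> carrier (houghton_group n)" "\<tau> \<in> carrier (houghton_group n)"
  then show "\<sigma> \<otimes>\<^bsub>houghton_group n\<^esub> \<tau> \<in> carrier (houghton_group n)"
    using permutes_compose shifts_comp unfolding houghton_iff houghton_simps by blast
next
  show "\<one>\<^bsub>houghton_group n\<^esub> \<in> carrier (houghton_group n)"
    by (simp add: finite_support_houghton permutes_id)
next
  fix \<sigma> assume \<sigma>: "\<sigma> \<in> carrier (houghton_group n)"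
  have "Hilbert_Choice.inv \<sigma> \<circ> \<sigma> = id" using permutes_inv_o[OF houghton_permutes[OF \<sigma>]] by simp
  then show "\<exists>\<tau>\<in>carrier (houghton_group n). \<tau> \<otimes>\<^bsub>houghton_group n\<^esub> \<sigma> = \<one>\<^bsub>houghton_group n\<^esub>"
    using houghton_inv_closed[OF \<sigma>] by auto
qed (auto simp: o_assoc)

lemma houghton_inv:
  assumes "\<sigma> \<in> carrier (houghton_group n)"
  shows "inv\<^bsub>houghton_group n\<^esub> \<sigma> = Hilbert_Choice.inv \<sigma>"
  using permutes_inv_o[OF houghton_permutes[OF assms]] houghton_inv_closed[OF assms] assms
  by (intro group.inv_equality[OF houghton_group]) auto

text \<open>The finitary permutations form a locally finite group: finitely many of them live in the
  symmetric group of their joint support, which is finite and has the uniform mean. Commutators then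
  bring in the rest.\<close>

theorem houghton_amenable: "\<exists>m. left_invariant_mean (houghton_group n) m"
proof -
  let ?G = "houghton_group n"
  interpret group ?G by (rule houghton_group)
  define K where "K = {\<sigma> \<in> carrier ?G. finite {x. \<sigma> x \<noteq> x}}"
  have KG: "K \<subseteq> carrier ?G" by (auto simp: K_def)
  have "\<exists>m. invariant_mean ?G K m"
  proof (rule invariant_mean_directed[OF KG])
    fix F assume F: "finite F" "F \<subseteq> K"
    define S where "S = (\<Union>\<sigma>\<in>F. {x. \<sigma> x \<noteq> x})"
    have S: "finite S" using F by (auto simp: S_def K_def)
    have F\<Omega>: "\<sigma> permutes Omega n" if "\<sigma> \<in> F" for \<sigma> using that F KG houghton_permutes by blast
    have S\<Omega>: "S \<subseteq> Omega n"
      using F\<Omega> by (auto simp: S_def permutes_def)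
    define Q :: "(nat \<times> nat \<Rightarrow> nat \<times> nat) monoid" where "Q = \<lparr>carrier = {\<sigma>. \<sigma> permutes S}, mult = (\<circ>), one = id\<rparr>"
    have Q: "group Q"
    proof (rule groupI)
      fix \<sigma> assume "\<sigma> \<in> carrier Q"
      then have \<sigma>: "\<sigma> permutes S" by (simp add: Q_def)
      show "\<exists>\<tau>\<in>carrier Q. \<tau> \<otimes>\<^bsub>Q\<^esub> \<sigma> = \<one>\<^bsub>Q\<^esub>"
        using permutes_inv[OF \<sigma>] permutes_inv_o(2)[OF \<sigma>]
        by (intro bexI[of _ "Hilbert_Choice.inv \<sigma>"]) (simp_all add: Q_def)
    qed (auto simp: Q_def permutes_compose permutes_id o_assoc)
    have "finite (carrier Q)" using finite_permutations[OF S] by (simp add: Q_def)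
    then obtain mQ where mQ: "left_invariant_mean Q mQ" using group.finite_group_mean[OF Q] by blast
    have QG: "\<sigma> \<in> carrier ?G" if "\<sigma> permutes S" for \<sigma>
    proof (rule finite_support_houghton)
      show "\<sigma> permutes Omega n" using that S\<Omega> by (rule permutes_subset)
      have "{x. \<sigma> x \<noteq> x} \<subseteq> S" using that by (auto simp: permutes_def)
      then show "finite {x. \<sigma> x \<noteq> x}" using S by (rule finite_subset)
    qed
    have hom: "(\<lambda>\<sigma>. \<sigma>) \<in> hom Q ?G" using QG by (auto simp: hom_def Q_def)
    obtain m0 where m0: "invariant_mean ?G {} m0" using invariant_mean_empty by blast
    obtain m where m: "invariant_mean ?G ({} \<union> (\<lambda>\<sigma>. \<sigma>) ` carrier Q) m"
      using invariant_mean_extend[OF Q hom mQ m0] by auto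
    have "\<sigma> permutes S" if \<sigma>: "\<sigma> \<in> F" for \<sigma>
      using F\<Omega>[OF \<sigma>] \<sigma> by (auto simp: permutes_def S_def)
    then have "F \<subseteq> carrier Q" by (auto simp: Q_def)
    then show "\<exists>m. invariant_mean ?G F m" using m by (auto simp: invariant_mean_def)
  qed
  then obtain m where m: "invariant_mean ?G K m" by blast
  show ?thesis
  proof (rule amenable_of_commutators[OF KG m])
    fix \<sigma> \<tau> assume \<sigma>: "\<sigma> \<in> carrier ?G" and \<tau>: "\<tau> \<in> carrier ?G"
    obtain a where a: "shifts n \<sigma> a" using \<sigma> by (auto simp: houghton_iff)
    obtain b where b: "shifts n \<tau> b" using \<tau> by (auto simp: houghton_iff)
    let ?c = "inv\<^bsub>?G\<^esub> \<sigma> \<otimes>\<^bsub>?G\<^esub> inv\<^bsub>?G\<^esub> \<tau> \<otimes>\<^bsub>?G\<^esub> \<sigma> \<otimes>\<^bsub>?G\<^esub> \<tau>"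
    have c: "?c \<in> carrier ?G" using \<sigma> \<tau> by (intro m_closed inv_closed)
    \<comment> \<open>The translation vector is additive, so it cancels on a commutator; a
      permutation with translation vector 0 is finitary.\<close>
    have "shifts n ?c (\<lambda>i. b i + (a i + (- b i + - a i)))"
      unfolding houghton_simps houghton_inv[OF \<sigma>] houghton_inv[OF \<tau>]
      by (intro shifts_comp shifts_inv houghton_permutes[OF \<sigma>] houghton_permutes[OF \<tau>] a b)
    then have "shifts n ?c (\<lambda>i. 0)" by simp
    then have "finite {x. ?c x \<noteq> x}" by (rule shifts_zero_support[OF houghton_permutes[OF c]])
    then show "?c \<in> K" using c by (simp add: K_def)
  qed
qed

section \<open>Point stabilizers: maximality and infinite index\<close>

lemma transpose_houghton:
  assumes "a \<in> Omega n" "b \<in> Omega n"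
  shows "Transposition.transpose a b \<in> carrier (houghton_group n)"
proof (rule finite_support_houghton[OF permutes_swap_id[OF assms]])
  have "{x. Transposition.transpose a b x \<noteq> x} \<subseteq> {a, b}" by (auto simp: Transposition.transpose_def)
  then show "finite {x. Transposition.transpose a b x \<noteq> x}" by (rule finite_subset) simp
qed

lemma houghton_stabilizer:
  "stabilizer (houghton_group n) (\<lambda>\<sigma>. \<sigma>) \<omega> = {\<sigma> \<in> carrier (houghton_group n). \<sigma> \<omega> = \<omega>}"
  by (simp add: stabilizer_def)

lemma houghton_stabilizer_subgroup: "subgroup (stabilizer (houghton_group n) (\<lambda>\<sigma>. \<sigma>) \<omega>) (houghton_group n)"
proof -
  interpret group "houghton_group n" by (rule houghton_group)
  show ?thesis
  proof (rule subgroupI)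
    show "stabilizer (houghton_group n) (\<lambda>\<sigma>. \<sigma>) \<omega> \<noteq> {}"
      using one_closed by (force simp: houghton_stabilizer)
    fix \<sigma> assume \<sigma>: "\<sigma> \<in> stabilizer (houghton_group n) (\<lambda>\<sigma>. \<sigma>) \<omega>"
    then have s: "\<sigma> \<in> carrier (houghton_group n)" "\<sigma> \<omega> = \<omega>" by (auto simp: houghton_stabilizer)
    have "Hilbert_Choice.inv \<sigma> \<omega> = \<omega>" using permutes_inverses(2)[OF houghton_permutes[OF s(1)], of \<omega>] s(2) by simp
    then show "inv\<^bsub>houghton_group n\<^esub> \<sigma> \<in> stabilizer (houghton_group n) (\<lambda>\<sigma>. \<sigma>) \<omega>"
      using s inv_closed[OF s(1)] by (simp add: houghton_stabilizer houghton_inv)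
    fix \<tau> assume "\<tau> \<in> stabilizer (houghton_group n) (\<lambda>\<sigma>. \<sigma>) \<omega>"
    then show "\<sigma> \<otimes>\<^bsub>houghton_group n\<^esub> \<tau> \<in> stabilizer (houghton_group n) (\<lambda>\<sigma>. \<sigma>) \<omega>"
      using s m_closed[OF s(1), of \<tau>] by (auto simp: houghton_stabilizer)
  qed (auto simp: houghton_stabilizer)
qed

text \<open>Transpositions fixing \<open>\<omega>\<close> show that the stabilizer is transitive on the other points.\<close>

lemma houghton_stabilizer_maximal:
  assumes L: "subgroup L (houghton_group n)" and HL: "stabilizer (houghton_group n) (\<lambda>\<sigma>. \<sigma>) \<omega> \<subseteq> L"
    and \<omega>: "\<omega> \<in> Omega n"
  shows "L = stabilizer (houghton_group n) (\<lambda>\<sigma>. \<sigma>) \<omega> \<or> L = carrier (houghton_group n)"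
proof (rule disjCI)
  let ?G = "houghton_group n"
  interpret group ?G by (rule houghton_group)
  have LG: "L \<subseteq> carrier ?G" by (rule subgroup.subset[OF L])
  assume "L \<noteq> carrier ?G"
  have "\<sigma> \<omega> = \<omega>" if \<sigma>: "\<sigma> \<in> L" for \<sigma>
  proof (rule ccontr)
    assume s: "\<sigma> \<omega> \<noteq> \<omega>"
    have \<sigma>G: "\<sigma> \<in> carrier ?G" using \<sigma> LG by blast
    have "\<tau> \<in> L" if \<tau>: "\<tau> \<in> carrier ?G" for \<tau>
    proof (cases "\<tau> \<omega> = \<omega>")
      case True
      then show ?thesis using \<tau> HL by (auto simp: houghton_stabilizer)
    next
      case False
      \<comment> \<open>h carries the image of \<omega> under \<sigma> to its image under \<tau>.
        Both images differ from \<omega>, so h fixes \<omega>, and \<tau> agrees with h \<sigma> up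
        to a factor x on the right that also fixes \<omega>.\<close>
      define h where "h = Transposition.transpose (\<sigma> \<omega>) (\<tau> \<omega>)"
      have \<Omega>: "\<sigma> \<omega> \<in> Omega n" "\<tau> \<omega> \<in> Omega n"
        using permutes_in_image[OF houghton_permutes[OF \<sigma>G]] permutes_in_image[OF houghton_permutes[OF \<tau>]] \<omega> by auto
      have hG: "h \<in> carrier ?G" unfolding h_def by (rule transpose_houghton[OF \<Omega>])
      have "h \<omega> = \<omega>" using s False by (simp add: h_def Transposition.transpose_def)
      then have hL: "h \<in> L" using hG HL by (auto simp: houghton_stabilizer)
      define x where "x = inv\<^bsub>?G\<^esub> \<tau> \<otimes>\<^bsub>?G\<^esub> (h \<otimes>\<^bsub>?G\<^esub> \<sigma>)"
      have xG: "x \<in> carrier ?G" unfolding x_def by (intro m_closed inv_closed \<tau> hG \<sigma>G)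
      have "x \<omega> = \<omega>"
        using permutes_inverses(2)[OF houghton_permutes[OF \<tau>], of \<omega>]
        by (simp add: x_def houghton_inv[OF \<tau>] h_def)
      then have xL: "x \<in> L" using xG HL by (auto simp: houghton_stabilizer)
      have "h \<otimes>\<^bsub>?G\<^esub> \<sigma> \<otimes>\<^bsub>?G\<^esub> inv\<^bsub>?G\<^esub> x \<in> L"
        by (intro subgroup.m_closed[OF L] subgroup.m_inv_closed[OF L] hL \<sigma> xL)
      moreover have "h \<otimes>\<^bsub>?G\<^esub> \<sigma> \<otimes>\<^bsub>?G\<^esub> inv\<^bsub>?G\<^esub> x = \<tau>"
        unfolding x_def using hG \<sigma>G \<tau> by (simp add: inv_mult_group m_assoc mult_inv_cancel del: houghton_simps)
      ultimately show ?thesis by simp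
    qed
    with LG \<open>L \<noteq> carrier ?G\<close> show False by blast
  qed
  then show "L = stabilizer ?G (\<lambda>\<sigma>. \<sigma>) \<omega>" using LG HL by (auto simp: houghton_stabilizer)
qed

text \<open>The orbit of \<omega> is infinite. The representatives exchange \<omega> with distinct
  points f i; then the quotient of \<gamma> i by \<gamma> j sends \<omega> to f j, a point that
  \<gamma> i does not move.\<close>

lemma houghton_stabilizer_cosets:
  assumes n: "n \<ge> 1" and \<omega>: "\<omega> \<in> Omega n"
  obtains \<gamma> :: "nat \<Rightarrow> nat \<times> nat \<Rightarrow> nat \<times> nat" where "\<And>i. \<gamma> i \<in> carrier (houghton_group n)"
    "\<And>i j. i \<noteq> j \<Longrightarrow> \<gamma> i \<otimes>\<^bsub>houghton_group n\<^esub> inv\<^bsub>houghton_group n\<^esub> \<gamma> j \<notin> stabilizer (houghton_group n) (\<lambda>\<sigma>. \<sigma>) \<omega>"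
proof -
  have "infinite (Omega n)"
    using n by (auto simp: Omega_def finite_cartesian_product_iff)
  then have "infinite (Omega n - {\<omega>})" by simp
  then obtain f :: "nat \<Rightarrow> nat \<times> nat" where f: "inj f" "range f \<subseteq> Omega n - {\<omega>}"
    using infinite_countable_subset by blast
  define \<gamma> where "\<gamma> = (\<lambda>i. Transposition.transpose \<omega> (f i))"
  have \<gamma>: "\<gamma> i \<in> carrier (houghton_group n)" for i
    unfolding \<gamma>_def using f \<omega> by (intro transpose_houghton) auto
  have "(\<gamma> i \<otimes>\<^bsub>houghton_group n\<^esub> inv\<^bsub>houghton_group n\<^esub> \<gamma> j) \<omega> \<noteq> \<omega>" if "i \<noteq> j" for i j
  proof -
    have "Hilbert_Choice.inv (\<gamma> j) = \<gamma> j" by (simp add: \<gamma>_def)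
    moreover have "f j \<noteq> \<omega>" "f j \<noteq> f i" using f that by (auto dest: injD)
    ultimately show ?thesis
      unfolding houghton_inv[OF \<gamma>] by (simp add: \<gamma>_def Transposition.transpose_def)
  qed
  then show ?thesis using that[of \<gamma>] \<gamma> by (simp add: houghton_stabilizer)
qed

section \<open>Wreath products\<close>

lemma semidirect_simps [simp]:
  "carrier (semidirect_product A G \<alpha>) = carrier A \<times> carrier G"
  "(x, g) \<otimes>\<^bsub>semidirect_product A G \<alpha>\<^esub> (y, h) = (x \<otimes>\<^bsub>A\<^esub> \<alpha> g y, g \<otimes>\<^bsub>G\<^esub> h)"
  "\<one>\<^bsub>semidirect_product A G \<alpha>\<^esub> = (\<one>\<^bsub>A\<^esub>, \<one>\<^bsub>G\<^esub>)"
  by (simp_all add: semidirect_product_def)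

lemma
  assumes A: "group A" and G: "group G"
    and closed: "\<And>g x. g \<in> carrier G \<Longrightarrow> x \<in> carrier A \<Longrightarrow> \<alpha> g x \<in> carrier A"
    and mult: "\<And>g x y. g \<in> carrier G \<Longrightarrow> x \<in> carrier A \<Longrightarrow> y \<in> carrier A \<Longrightarrow>
      \<alpha> g (x \<otimes>\<^bsub>A\<^esub> y) = \<alpha> g x \<otimes>\<^bsub>A\<^esub> \<alpha> g y"
    and comp: "\<And>g h x. g \<in> carrier G \<Longrightarrow> h \<in> carrier G \<Longrightarrow> x \<in> carrier A \<Longrightarrow>
      \<alpha> (g \<otimes>\<^bsub>G\<^esub> h) x = \<alpha> g (\<alpha> h x)"
    and one: "\<And>x. x \<in> carrier A \<Longrightarrow> \<alpha> \<one>\<^bsub>G\<^esub> x = x"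
  shows semidirect_group: "group (semidirect_product A G \<alpha>)"
    and semidirect_inv: "x \<in> carrier A \<Longrightarrow> g \<in> carrier G \<Longrightarrow>
      inv\<^bsub>semidirect_product A G \<alpha>\<^esub> (x, g) = (\<alpha> (inv\<^bsub>G\<^esub> g) (inv\<^bsub>A\<^esub> x), inv\<^bsub>G\<^esub> g)"
proof -
  interpret A: group A by (rule A)
  interpret G: group G by (rule G)
  have \<alpha>1: "\<alpha> g \<one>\<^bsub>A\<^esub> = \<one>\<^bsub>A\<^esub>" if g: "g \<in> carrier G" for g
  proof -
    have "\<alpha> g \<one>\<^bsub>A\<^esub> \<otimes>\<^bsub>A\<^esub> \<alpha> g \<one>\<^bsub>A\<^esub> = \<alpha> g \<one>\<^bsub>A\<^esub>" using mult[OF g, of "\<one>\<^bsub>A\<^esub>" "\<one>\<^bsub>A\<^esub>"] by simp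
    then show ?thesis using closed[OF g A.one_closed] A.l_cancel_one by blast
  qed
  have linv: "(\<alpha> (inv\<^bsub>G\<^esub> g) (inv\<^bsub>A\<^esub> x), inv\<^bsub>G\<^esub> g) \<otimes>\<^bsub>semidirect_product A G \<alpha>\<^esub> (x, g)
      = \<one>\<^bsub>semidirect_product A G \<alpha>\<^esub>" if "x \<in> carrier A" "g \<in> carrier G" for x g
    using that by (simp add: mult[symmetric] \<alpha>1)
  show grp: "group (semidirect_product A G \<alpha>)"
  proof (rule groupI)
    fix p assume "p \<in> carrier (semidirect_product A G \<alpha>)"
    then obtain x g where xg: "p = (x, g)" "x \<in> carrier A" "g \<in> carrier G" by auto
    show "\<exists>q\<in>carrier (semidirect_product A G \<alpha>). q \<otimes>\<^bsub>semidirect_product A G \<alpha>\<^esub> p = \<one>\<^bsub>semidirect_product A G \<alpha>\<^esub>"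
      using linv[OF xg(2,3)] xg closed by (intro bexI[of _ "(\<alpha> (inv\<^bsub>G\<^esub> g) (inv\<^bsub>A\<^esub> x), inv\<^bsub>G\<^esub> g)"]) auto
  qed (auto simp: closed mult comp one A.m_assoc G.m_assoc)
  show "inv\<^bsub>semidirect_product A G \<alpha>\<^esub> (x, g) = (\<alpha> (inv\<^bsub>G\<^esub> g) (inv\<^bsub>A\<^esub> x), inv\<^bsub>G\<^esub> g)"
    if "x \<in> carrier A" "g \<in> carrier G"
    using linv[OF that] that closed by (intro group.inv_equality[OF grp]) auto
qed

section \<open>The base group, the shift action and the wreath product\<close>

locale wreath_product =
  L: group L + G: group G
  for L :: "('l, 'x) monoid_scheme" and G :: "('g, 'y) monoid_scheme"
begin

abbreviation base :: "('g \<Rightarrow> 'l) monoid"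
  where "base \<equiv> sum_group (carrier G) (\<lambda>_. L)"

abbreviation \<Gamma> :: "(('g \<Rightarrow> 'l) \<times> 'g) monoid"
  where "\<Gamma> \<equiv> wreath L G"

lemma base_group: "group base"
  by (simp add: L.is_group)

lemma base_iff:
  "x \<in> carrier base \<longleftrightarrow> x \<in> (\<Pi>\<^sub>E i\<in>carrier G. carrier L) \<and> finite {i \<in> carrier G. x i \<noteq> \<one>\<^bsub>L\<^esub>}"
  by (simp add: carrier_sum_group L.is_group)

lemma base_at: "x \<in> carrier base \<Longrightarrow> i \<in> carrier G \<Longrightarrow> x i \<in> carrier L"
  by (auto simp: base_iff)

lemma base_eqI:
  assumes "x \<in> carrier base" "y \<in> carrier base" "\<And>i. i \<in> carrier G \<Longrightarrow> x i = y i"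
  shows "x = y"
  using assms by (intro PiE_ext[of x "carrier G" "\<lambda>_. carrier L" y]) (auto simp: base_iff)

lemma base_inv: "x \<in> carrier base \<Longrightarrow> inv\<^bsub>base\<^esub> x = (\<lambda>i\<in>carrier G. inv\<^bsub>L\<^esub> (x i))"
  by (rule inv_sum_group) (simp_all add: L.is_group)

lemma base_mult_closed: "x \<in> carrier base \<Longrightarrow> y \<in> carrier base \<Longrightarrow> x \<otimes>\<^bsub>base\<^esub> y \<in> carrier base"
  using group.is_monoid[OF base_group] by (rule monoid.m_closed)

lemma base_one_closed: "\<one>\<^bsub>base\<^esub> \<in> carrier base"
  using group.is_monoid[OF base_group] by (rule monoid.one_closed)

lemma base_inv_closed: "x \<in> carrier base \<Longrightarrow> inv\<^bsub>base\<^esub> x \<in> carrier base"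
  by (rule group.inv_closed[OF base_group])

lemma shift_at: "k \<in> carrier G \<Longrightarrow> shift_action G g x k = x (inv\<^bsub>G\<^esub> g \<otimes>\<^bsub>G\<^esub> k)"
  by (simp add: shift_action_def)

lemma shift_closed:
  assumes g: "g \<in> carrier G" and x: "x \<in> carrier base" shows "shift_action G g x \<in> carrier base"
  unfolding base_iff
proof
  show "shift_action G g x \<in> (\<Pi>\<^sub>E i\<in>carrier G. carrier L)"
    using g x by (auto simp: shift_action_def base_at)
  have "{i \<in> carrier G. shift_action G g x i \<noteq> \<one>\<^bsub>L\<^esub>} \<subseteq> (\<lambda>i. g \<otimes>\<^bsub>G\<^esub> i) ` {i \<in> carrier G. x i \<noteq> \<one>\<^bsub>L\<^esub>}"
  proof
    fix i assume i: "i \<in> {i \<in> carrier G. shift_action G g x i \<noteq> \<one>\<^bsub>L\<^esub>}"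
    then have "i = g \<otimes>\<^bsub>G\<^esub> (inv\<^bsub>G\<^esub> g \<otimes>\<^bsub>G\<^esub> i)" using g by (simp add: G.mult_inv_cancel)
    moreover have "inv\<^bsub>G\<^esub> g \<otimes>\<^bsub>G\<^esub> i \<in> {i \<in> carrier G. x i \<noteq> \<one>\<^bsub>L\<^esub>}" using i g shift_at[of i g x] by auto
    ultimately show "i \<in> (\<lambda>i. g \<otimes>\<^bsub>G\<^esub> i) ` {i \<in> carrier G. x i \<noteq> \<one>\<^bsub>L\<^esub>}" by (rule image_eqI)
  qed
  then show "finite {i \<in> carrier G. shift_action G g x i \<noteq> \<one>\<^bsub>L\<^esub>}"
    using x by (auto simp: base_iff elim: finite_subset)
qed

lemma shift_mult:
  "g \<in> carrier G \<Longrightarrow> shift_action G g (x \<otimes>\<^bsub>base\<^esub> y) = shift_action G g x \<otimes>\<^bsub>base\<^esub> shift_action G g y"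
  by (auto simp: shift_action_def restrict_def fun_eq_iff)

lemma shift_comp:
  "g \<in> carrier G \<Longrightarrow> h \<in> carrier G \<Longrightarrow> shift_action G (g \<otimes>\<^bsub>G\<^esub> h) x = shift_action G g (shift_action G h x)"
  by (auto simp: shift_action_def restrict_def fun_eq_iff G.inv_mult_group G.m_assoc)

lemma shift_one: "x \<in> carrier base \<Longrightarrow> shift_action G \<one>\<^bsub>G\<^esub> x = x"
  by (rule base_eqI) (simp_all add: shift_closed shift_at)

lemma shift_base_one: "g \<in> carrier G \<Longrightarrow> shift_action G g \<one>\<^bsub>base\<^esub> = \<one>\<^bsub>base\<^esub>"
  by (auto simp: shift_action_def restrict_def fun_eq_iff)

lemma wreath_group: "group \<Gamma>"
  unfolding wreath_def
  by (rule semidirect_group[OF base_group G.is_group])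
    (simp_all only: shift_closed shift_mult shift_comp shift_one)

lemma wreath_inv:
  "x \<in> carrier base \<Longrightarrow> g \<in> carrier G \<Longrightarrow>
    inv\<^bsub>\<Gamma>\<^esub> (x, g) = (shift_action G (inv\<^bsub>G\<^esub> g) (inv\<^bsub>base\<^esub> x), inv\<^bsub>G\<^esub> g)"
  unfolding wreath_def
  by (rule semidirect_inv[OF base_group G.is_group])
    (simp_all only: shift_closed shift_mult shift_comp shift_one)

lemma wreath_carrier: "carrier \<Gamma> = carrier base \<times> carrier G"
  by (simp add: wreath_def)

lemma wreath_mult: "(x, g) \<otimes>\<^bsub>\<Gamma>\<^esub> (y, h) = (x \<otimes>\<^bsub>base\<^esub> shift_action G g y, g \<otimes>\<^bsub>G\<^esub> h)"
  by (simp only: wreath_def semidirect_simps)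

lemma wreath_one: "\<one>\<^bsub>\<Gamma>\<^esub> = (\<one>\<^bsub>base\<^esub>, \<one>\<^bsub>G\<^esub>)"
  by (simp only: wreath_def semidirect_simps)

lemma partial_wreath_carrier: "carrier (partial_wreath L G H) = carrier base \<times> H"
  by (simp add: partial_wreath_def)

definition base_copy :: "(('g \<Rightarrow> 'l) \<times> 'g) set"
  where "base_copy = carrier base \<times> {\<one>\<^bsub>G\<^esub>}"

lemma base_copy_mult:
  "x \<in> carrier base \<Longrightarrow> y \<in> carrier base \<Longrightarrow> (x, \<one>\<^bsub>G\<^esub>) \<otimes>\<^bsub>\<Gamma>\<^esub> (y, h) = (x \<otimes>\<^bsub>base\<^esub> y, \<one>\<^bsub>G\<^esub> \<otimes>\<^bsub>G\<^esub> h)"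
  by (simp only: wreath_mult shift_one)

lemma base_copy_inv: "x \<in> carrier base \<Longrightarrow> inv\<^bsub>\<Gamma>\<^esub> (x, \<one>\<^bsub>G\<^esub>) = (inv\<^bsub>base\<^esub> x, \<one>\<^bsub>G\<^esub>)"
  by (simp only: wreath_inv G.one_closed G.inv_one shift_one base_inv_closed)

lemma base_copy_inv_closed: "a \<in> base_copy \<Longrightarrow> inv\<^bsub>\<Gamma>\<^esub> a \<in> base_copy"
  by (auto simp del: inv_sum_group one_sum_group mult_sum_group simp: base_copy_def base_copy_inv base_inv_closed)

text \<open>The second component is a homomorphism to G, and the base is its kernel.\<close>

lemma base_copy_normal:
  assumes a: "a \<in> base_copy" and p: "p \<in> carrier \<Gamma>"
  shows "inv\<^bsub>\<Gamma>\<^esub> p \<otimes>\<^bsub>\<Gamma>\<^esub> a \<otimes>\<^bsub>\<Gamma>\<^esub> p \<in> base_copy"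
proof -
  interpret W: group \<Gamma> by (rule wreath_group)
  obtain x g where xg: "p = (x, g)" "x \<in> carrier base" "g \<in> carrier G" using p by (auto simp: wreath_carrier)
  obtain b where b: "a = (b, \<one>\<^bsub>G\<^esub>)" "b \<in> carrier base" using a by (auto simp: base_copy_def)
  have aG: "a \<in> carrier \<Gamma>" using b by (simp add: wreath_carrier)
  have mem: "inv\<^bsub>\<Gamma>\<^esub> p \<otimes>\<^bsub>\<Gamma>\<^esub> a \<otimes>\<^bsub>\<Gamma>\<^esub> p \<in> carrier \<Gamma>" by (intro W.m_closed W.inv_closed p aG)
  have "snd (inv\<^bsub>\<Gamma>\<^esub> p \<otimes>\<^bsub>\<Gamma>\<^esub> a \<otimes>\<^bsub>\<Gamma>\<^esub> p) = \<one>\<^bsub>G\<^esub>"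
    unfolding xg(1) b(1) wreath_inv[OF xg(2,3)] wreath_mult snd_conv using xg(3) by simp
  with mem show ?thesis by (auto simp: base_copy_def wreath_carrier mem_Times_iff)
qed

lemma base_copy_subset: "base_copy \<subseteq> carrier \<Gamma>"
  by (auto simp: base_copy_def wreath_carrier)

definition single :: "'g \<Rightarrow> 'l \<Rightarrow> 'g \<Rightarrow> 'l"
  where "single k l = (\<lambda>i\<in>carrier G. if i = k then l else \<one>\<^bsub>L\<^esub>)"

lemma single_closed:
  assumes "l \<in> carrier L" shows "single k l \<in> carrier base"
  unfolding base_iff
proof
  show "single k l \<in> (\<Pi>\<^sub>E i\<in>carrier G. carrier L)" using assms by (auto simp: single_def)
  show "finite {i \<in> carrier G. single k l i \<noteq> \<one>\<^bsub>L\<^esub>}"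
    by (rule finite_subset[of _ "{k}"]) (auto simp: single_def)
qed

text \<open>Conjugation by a in the base turns coordinate i of (b, h) into a_i b_i times the inverse
  of a at h^{-1} i. If h is trivial, this is conjugation in \<Lambda>, whose ICC property applies at
  a coordinate where b is nontrivial. Otherwise i and h^{-1} i differ, so an a supported at i
  multiplies b_i by any element of the infinite group \<Lambda>.\<close>

lemma wreath_rel_icc:
  assumes icc: "icc_group L" shows "group.rel_icc \<Gamma> base_copy"
  unfolding group.rel_icc_def[OF wreath_group]
proof (intro ballI impI)
  fix p assume p: "p \<in> carrier \<Gamma>" "p \<noteq> \<one>\<^bsub>\<Gamma>\<^esub>"
  obtain b h where bh: "p = (b, h)" "b \<in> carrier base" "h \<in> carrier G" using p by (auto simp: wreath_carrier)
  let ?C = "{a \<otimes>\<^bsub>\<Gamma>\<^esub> p \<otimes>\<^bsub>\<Gamma>\<^esub> inv\<^bsub>\<Gamma>\<^esub> a | a. a \<in> base_copy}"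
  have conj: "fst ((a, \<one>\<^bsub>G\<^esub>) \<otimes>\<^bsub>\<Gamma>\<^esub> p \<otimes>\<^bsub>\<Gamma>\<^esub> inv\<^bsub>\<Gamma>\<^esub> (a, \<one>\<^bsub>G\<^esub>)) i
      = a i \<otimes>\<^bsub>L\<^esub> b i \<otimes>\<^bsub>L\<^esub> inv\<^bsub>L\<^esub> (a (inv\<^bsub>G\<^esub> h \<otimes>\<^bsub>G\<^esub> i))"
    if a: "a \<in> carrier base" and i: "i \<in> carrier G" for a i
    unfolding bh(1) base_copy_inv[OF a] base_copy_mult[OF a bh(2)] wreath_mult fst_conv
    using a i bh by (simp add: base_inv shift_at)
  have at: "single k l \<in> carrier base" if "l \<in> carrier L" for k l by (rule single_closed[OF that])
  show "infinite ?C"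
  proof
    assume fin: "finite ?C"
    show False
    proof (cases "h = \<one>\<^bsub>G\<^esub>")
      case True
      have "b \<noteq> \<one>\<^bsub>base\<^esub>" using p(2) by (auto simp: bh True wreath_one simp del: one_sum_group)
      then obtain k where k: "k \<in> carrier G" "b k \<noteq> \<one>\<^bsub>L\<^esub>"
        using base_eqI[OF bh(2) base_one_closed] by auto
      have "{l \<otimes>\<^bsub>L\<^esub> b k \<otimes>\<^bsub>L\<^esub> inv\<^bsub>L\<^esub> l | l. l \<in> carrier L} \<subseteq> (\<lambda>q. fst q k) ` ?C"
      proof
        fix z assume "z \<in> {l \<otimes>\<^bsub>L\<^esub> b k \<otimes>\<^bsub>L\<^esub> inv\<^bsub>L\<^esub> l | l. l \<in> carrier L}"
        then obtain l where l: "l \<in> carrier L" "z = l \<otimes>\<^bsub>L\<^esub> b k \<otimes>\<^bsub>L\<^esub> inv\<^bsub>L\<^esub> l" by blast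
        let ?q = "(single k l, \<one>\<^bsub>G\<^esub>)"
        have "z = fst (?q \<otimes>\<^bsub>\<Gamma>\<^esub> p \<otimes>\<^bsub>\<Gamma>\<^esub> inv\<^bsub>\<Gamma>\<^esub> ?q) k"
          unfolding conj[OF at[OF l(1)] k(1)] using k(1) by (simp add: l(2) single_def True)
        moreover have "?q \<in> base_copy" using at[OF l(1)] by (simp add: base_copy_def)
        ultimately show "z \<in> (\<lambda>q. fst q k) ` ?C" by blast
      qed
      then have "finite {l \<otimes>\<^bsub>L\<^esub> b k \<otimes>\<^bsub>L\<^esub> inv\<^bsub>L\<^esub> l | l. l \<in> carrier L}"
        using fin finite_surj by blast
      then show False using icc base_at[OF bh(2) k(1)] k(2) by (auto simp: icc_group_def)
    next
      case False
      have o: "\<one>\<^bsub>G\<^esub> \<in> carrier G" by simp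
      have b1: "b \<one>\<^bsub>G\<^esub> \<in> carrier L" by (rule base_at[OF bh(2) o])
      have "inv\<^bsub>G\<^esub> h \<noteq> \<one>\<^bsub>G\<^esub>" using False bh(3) by simp
      have "carrier L \<subseteq> (\<lambda>q. fst q \<one>\<^bsub>G\<^esub>) ` ?C"
      proof
        fix z assume z: "z \<in> carrier L"
        \<comment> \<open>Solves l b_1 = z; the third factor is trivial because h^{-1} is not the
          coordinate \<open>\<one>\<close> that carries l.\<close>
        define l where "l = z \<otimes>\<^bsub>L\<^esub> inv\<^bsub>L\<^esub> (b \<one>\<^bsub>G\<^esub>)"
        have l: "l \<in> carrier L" using z b1 by (simp add: l_def)
        let ?q = "(single \<one>\<^bsub>G\<^esub> l, \<one>\<^bsub>G\<^esub>)"
        have "z = fst (?q \<otimes>\<^bsub>\<Gamma>\<^esub> p \<otimes>\<^bsub>\<Gamma>\<^esub> inv\<^bsub>\<Gamma>\<^esub> ?q) \<one>\<^bsub>G\<^esub>"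
          unfolding conj[OF at[OF l] o] using z b1 bh(3) \<open>inv\<^bsub>G\<^esub> h \<noteq> \<one>\<^bsub>G\<^esub>\<close>
          by (simp add: single_def) (simp add: l_def L.m_assoc)
        moreover have "?q \<in> base_copy" using at[OF l] by (simp add: base_copy_def)
        ultimately show "z \<in> (\<lambda>q. fst q \<one>\<^bsub>G\<^esub>) ` ?C" by blast
      qed
      then have "finite (carrier L)" using fin finite_surj by blast
      then show False using icc by (simp add: icc_group_def)
    qed
  qed
qed

lemma partial_wreath_subgroup:
  assumes H: "subgroup H G" shows "subgroup (carrier base \<times> H) \<Gamma>"
proof -
  interpret W: group \<Gamma> by (rule wreath_group)
  have HG: "H \<subseteq> carrier G" by (rule subgroup.subset[OF H])
  show ?thesis
  proof (rule W.subgroupI)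
    show "carrier base \<times> H \<subseteq> carrier \<Gamma>" using HG by (auto simp: wreath_carrier)
    show "carrier base \<times> H \<noteq> {}" using base_one_closed subgroup.one_closed[OF H] by blast
    fix p assume p: "p \<in> carrier base \<times> H"
    then obtain x g where xg: "p = (x, g)" "x \<in> carrier base" "g \<in> H" by blast
    have gG: "g \<in> carrier G" using xg HG by blast
    show "inv\<^bsub>\<Gamma>\<^esub> p \<in> carrier base \<times> H"
      unfolding xg(1) wreath_inv[OF xg(2) gG]
      using shift_closed[OF G.inv_closed[OF gG] base_inv_closed[OF xg(2)]] subgroup.m_inv_closed[OF H xg(3)] by blast
    fix q assume "q \<in> carrier base \<times> H"
    then obtain y h where yh: "q = (y, h)" "y \<in> carrier base" "h \<in> H" by blast
    show "p \<otimes>\<^bsub>\<Gamma>\<^esub> q \<in> carrier base \<times> H"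
      unfolding xg(1) yh(1) wreath_mult
      using base_mult_closed[OF xg(2) shift_closed[OF gG yh(2)]] subgroup.m_closed[OF H xg(3) yh(3)] by blast
  qed
qed

lemma wreath_split: 
  assumes "x \<in> carrier base" "g \<in> carrier G"
  shows "(x, \<one>\<^bsub>G\<^esub>) \<otimes>\<^bsub>\<Gamma>\<^esub> (\<one>\<^bsub>base\<^esub>, g) = (x, g)"
  unfolding wreath_mult shift_base_one[OF G.one_closed]
  using assms monoid.r_one[OF group.is_monoid[OF base_group] assms(1)] by simp

lemma complement_mult:
  assumes "g \<in> carrier G" "h \<in> carrier G"
  shows "(\<one>\<^bsub>base\<^esub>, g) \<otimes>\<^bsub>\<Gamma>\<^esub> (\<one>\<^bsub>base\<^esub>, h) = (\<one>\<^bsub>base\<^esub>, g \<otimes>\<^bsub>G\<^esub> h)"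
  unfolding wreath_mult shift_base_one[OF assms(1)]
  using monoid.r_one[OF group.is_monoid[OF base_group] base_one_closed] by simp

lemma complement_inv:
  assumes "g \<in> carrier G" shows "inv\<^bsub>\<Gamma>\<^esub> (\<one>\<^bsub>base\<^esub>, g) = (\<one>\<^bsub>base\<^esub>, inv\<^bsub>G\<^esub> g)"
  unfolding wreath_inv[OF base_one_closed assms] monoid.inv_one[OF group.is_monoid[OF base_group]]
    shift_base_one[OF G.inv_closed[OF assms]] ..

text \<open>A subgroup containing the base is the base times its trace \<open>M0\<close> on the
  complement G, since its elements can be corrected by the base to have trivial first
  component.\<close>

lemma partial_wreath_maximal:
  assumes H: "subgroup H G"
    and max: "\<And>M. subgroup M G \<Longrightarrow> H \<subseteq> M \<Longrightarrow> M = H \<or> M = carrier G"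
    and M: "subgroup M \<Gamma>" "carrier base \<times> H \<subseteq> M"
  shows "M = carrier base \<times> H \<or> M = carrier \<Gamma>"
proof -
  have MG: "M \<subseteq> carrier \<Gamma>" by (rule subgroup.subset[OF M(1)])
  define M0 where "M0 = {g \<in> carrier G. (\<one>\<^bsub>base\<^esub>, g) \<in> M}"
  have HM0: "H \<subseteq> M0" using M(2) base_one_closed subgroup.subset[OF H] by (auto simp: M0_def simp del: one_sum_group)
  have AM: "(x, \<one>\<^bsub>G\<^esub>) \<in> M" if "x \<in> carrier base" for x
    using M(2) that subgroup.one_closed[OF H] by blast
  have "subgroup M0 G"
  proof (rule G.subgroupI)
    show "M0 \<subseteq> carrier G" by (auto simp: M0_def)
    show "M0 \<noteq> {}" using HM0 subgroup.one_closed[OF H] by blast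
    fix g assume g: "g \<in> M0"
    then have gG: "g \<in> carrier G" "(\<one>\<^bsub>base\<^esub>, g) \<in> M" by (simp_all only: M0_def mem_Collect_eq)
    show "inv\<^bsub>G\<^esub> g \<in> M0"
      using subgroup.m_inv_closed[OF M(1) gG(2)] gG(1) by (simp only: complement_inv M0_def mem_Collect_eq G.inv_closed)
    fix h assume h: "h \<in> M0"
    then have hG: "h \<in> carrier G" "(\<one>\<^bsub>base\<^esub>, h) \<in> M" by (simp_all only: M0_def mem_Collect_eq)
    show "g \<otimes>\<^bsub>G\<^esub> h \<in> M0"
      using subgroup.m_closed[OF M(1) gG(2) hG(2)] gG(1) hG(1) by (simp only: complement_mult M0_def mem_Collect_eq G.m_closed)
  qed
  from max[OF this HM0] have M0: "M0 = H \<or> M0 = carrier G" .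
  have "M = carrier base \<times> M0"
  proof (intro equalityI subsetI)
    fix p assume p: "p \<in> M"
    then obtain x g where xg: "p = (x, g)" "x \<in> carrier base" "g \<in> carrier G" using MG by (auto simp: wreath_carrier)
    have "(inv\<^bsub>base\<^esub> x, \<one>\<^bsub>G\<^esub>) \<otimes>\<^bsub>\<Gamma>\<^esub> p \<in> M"
      by (rule subgroup.m_closed[OF M(1) AM[OF base_inv_closed[OF xg(2)]] p])
    moreover have "(inv\<^bsub>base\<^esub> x, \<one>\<^bsub>G\<^esub>) \<otimes>\<^bsub>\<Gamma>\<^esub> p = (\<one>\<^bsub>base\<^esub>, g)"
      unfolding xg(1) base_copy_mult[OF base_inv_closed[OF xg(2)] xg(2)] group.l_inv[OF base_group xg(2)] using xg(3) by simp
    ultimately show "p \<in> carrier base \<times> M0" using xg unfolding M0_def by (simp del: one_sum_group)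
  next
    fix p assume "p \<in> carrier base \<times> M0"
    then obtain x g where xg: "p = (x, g)" "x \<in> carrier base" "g \<in> M0" by blast
    then have g: "g \<in> carrier G" "(\<one>\<^bsub>base\<^esub>, g) \<in> M" by (simp_all only: M0_def mem_Collect_eq)
    show "p \<in> M" using subgroup.m_closed[OF M(1) AM[OF xg(2)] g(2)] by (simp only: wreath_split[OF xg(2) g(1)] xg(1))
  qed
  with M0 show ?thesis by (auto simp: wreath_carrier)
qed

section \<open>Amenability of the wreath product\<close>

definition supported :: "'g set \<Rightarrow> (('g \<Rightarrow> 'l) \<times> 'g) set"
  where "supported S = {(a, \<one>\<^bsub>G\<^esub>) | a. a \<in> carrier base \<and> (\<forall>i\<in>carrier G - S. a i = \<one>\<^bsub>L\<^esub>)}"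

lemma supported_subset: "supported S \<subseteq> carrier \<Gamma>"
  by (auto simp: supported_def wreath_carrier)

text \<open>Induction on the support, one copy of \<Lambda> at a time: the new copy normalises the
  elements supported on S, so \<open>invariant_mean_extend\<close> applies, and every element on the
  larger support is a product of one from each part.\<close>

lemma supported_mean:
  assumes L: "left_invariant_mean L mL" and S: "finite S" "S \<subseteq> carrier G"
  shows "\<exists>m. invariant_mean \<Gamma> (supported S) m"
  using S
proof (induction S)
  case empty
  interpret W: group \<Gamma> by (rule wreath_group)
  obtain m where m: "invariant_mean \<Gamma> {} m" using W.invariant_mean_empty by blast
  then have mm: "mean_on \<Gamma> m" by (simp add: invariant_mean_def)
  have triv: "p = \<one>\<^bsub>\<Gamma>\<^esub>" if p: "p \<in> supported {}" for p
  proof -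
    obtain a where a: "p = (a, \<one>\<^bsub>G\<^esub>)" "a \<in> carrier base" "\<forall>i\<in>carrier G. a i = \<one>\<^bsub>L\<^esub>"
      using p unfolding supported_def Diff_empty by blast
    have "a = \<one>\<^bsub>base\<^esub>" by (rule base_eqI[OF a(2) base_one_closed]) (use a(3) in simp)
    then show ?thesis by (simp only: a(1) wreath_one)
  qed
  have "m (\<lambda>x. u (p \<otimes>\<^bsub>\<Gamma>\<^esub> x)) = m u" if "p \<in> supported {}" "bounded (u ` carrier \<Gamma>)" for p u
    unfolding triv[OF that(1)]
    by (rule mean_cong[OF mm W.bounded_translate[OF that(2) W.one_closed]]) (simp only: W.l_one)
  then have "invariant_mean \<Gamma> (supported {}) m" using mm by (simp add: invariant_mean_def)
  then show ?case by blast
next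
  case (insert k S)
  interpret W: group \<Gamma> by (rule wreath_group)
  have kG: "k \<in> carrier G" using insert by simp
  obtain m where m: "invariant_mean \<Gamma> (supported S) m" using insert by auto
  define \<phi> where "\<phi> = (\<lambda>l. (single k l, \<one>\<^bsub>G\<^esub>))"
  have hom: "\<phi> \<in> hom L \<Gamma>"
  proof (rule homI)
    show "\<phi> l \<in> carrier \<Gamma>" if "l \<in> carrier L" for l
      using single_closed[OF that] by (simp add: \<phi>_def wreath_carrier)
    show "\<phi> (l \<otimes>\<^bsub>L\<^esub> l') = \<phi> l \<otimes>\<^bsub>\<Gamma>\<^esub> \<phi> l'" if l: "l \<in> carrier L" "l' \<in> carrier L" for l l'
      unfolding \<phi>_def base_copy_mult[OF single_closed[OF l(1)] single_closed[OF l(2)]]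
      using l by (auto simp: single_def restrict_def fun_eq_iff)
  qed
  have norm: "inv\<^bsub>\<Gamma>\<^esub> (\<phi> l) \<otimes>\<^bsub>\<Gamma>\<^esub> p \<otimes>\<^bsub>\<Gamma>\<^esub> \<phi> l \<in> supported S" if l: "l \<in> carrier L" and p: "p \<in> supported S" for l p
  proof -
    obtain a where a: "p = (a, \<one>\<^bsub>G\<^esub>)" "a \<in> carrier base" "\<And>i. i \<in> carrier G - S \<Longrightarrow> a i = \<one>\<^bsub>L\<^esub>"
      using p by (auto simp: supported_def)
    let ?s = "single k l"
    note s = single_closed[OF l, of k]
    \<comment> \<open>Off S the element a is trivial, so there the conjugate reduces to s^{-1}
      s.\<close>
    let ?b = "inv\<^bsub>base\<^esub> ?s \<otimes>\<^bsub>base\<^esub> a \<otimes>\<^bsub>base\<^esub> ?s"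
    have b: "?b \<in> carrier base" by (intro base_mult_closed base_inv_closed s a)
    have "inv\<^bsub>\<Gamma>\<^esub> (\<phi> l) \<otimes>\<^bsub>\<Gamma>\<^esub> p \<otimes>\<^bsub>\<Gamma>\<^esub> \<phi> l = (?b, \<one>\<^bsub>G\<^esub>)"
      unfolding \<phi>_def a(1) base_copy_inv[OF s] base_copy_mult[OF base_inv_closed[OF s] a(2)] G.l_one[OF G.one_closed]
        base_copy_mult[OF base_mult_closed[OF base_inv_closed[OF s] a(2)] s] ..
    moreover have "?b i = \<one>\<^bsub>L\<^esub>" if "i \<in> carrier G - S" for i
      using that a(3)[OF that] l base_at[OF s, of i] by (simp add: base_inv[OF s])
    ultimately show ?thesis using b unfolding supported_def by blast
  qed
  obtain m' where m': "invariant_mean \<Gamma> (supported S \<union> \<phi> ` carrier L) m'"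
    using W.invariant_mean_extend[OF L.is_group hom L m supported_subset norm] by blast
  have sub: "supported S \<union> \<phi> ` carrier L \<subseteq> carrier \<Gamma>" using supported_subset hom by (auto simp: hom_def)
  have "m' (\<lambda>x. u (p \<otimes>\<^bsub>\<Gamma>\<^esub> x)) = m' u" if p: "p \<in> supported (insert k S)" and u: "bounded (u ` carrier \<Gamma>)" for p u
  proof -
    obtain a where a: "p = (a, \<one>\<^bsub>G\<^esub>)" "a \<in> carrier base" "\<And>i. i \<in> carrier G - insert k S \<Longrightarrow> a i = \<one>\<^bsub>L\<^esub>"
      using p by (auto simp: supported_def)
    have ak: "a k \<in> carrier L" by (rule base_at[OF a(2) kG])
    \<comment> \<open>The factor left after splitting off the coordinate k.\<close>
    define b where "b = (\<lambda>i\<in>carrier G. if i = k then \<one>\<^bsub>L\<^esub> else a i)"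
    have b: "b \<in> carrier base"
      unfolding base_iff
    proof
      show "b \<in> (\<Pi>\<^sub>E i\<in>carrier G. carrier L)" using base_at[OF a(2)] by (auto simp: b_def)
      have "{i \<in> carrier G. b i \<noteq> \<one>\<^bsub>L\<^esub>} \<subseteq> {i \<in> carrier G. a i \<noteq> \<one>\<^bsub>L\<^esub>}" by (auto simp: b_def)
      then show "finite {i \<in> carrier G. b i \<noteq> \<one>\<^bsub>L\<^esub>}" using a(2) by (auto simp: base_iff elim: finite_subset)
    qed
    have "single k (a k) \<otimes>\<^bsub>base\<^esub> b = a"
      by (rule base_eqI[OF base_mult_closed[OF single_closed[OF ak] b] a(2)])
        (use base_at[OF a(2)] in \<open>auto simp: single_def b_def\<close>)
    then have p': "p = \<phi> (a k) \<otimes>\<^bsub>\<Gamma>\<^esub> (b, \<one>\<^bsub>G\<^esub>)"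
      unfolding \<phi>_def base_copy_mult[OF single_closed[OF ak] b] by (simp only: a(1) G.l_one[OF G.one_closed])
    have "(b, \<one>\<^bsub>G\<^esub>) \<in> supported S"
      using b a(3) by (auto simp: supported_def b_def)
    then show ?thesis unfolding p' using ak by (intro W.invariant_mean_mult[OF m' sub _ _ u]) auto
  qed
  then have "invariant_mean \<Gamma> (supported (insert k S)) m'" using m' by (auto simp: invariant_mean_def)
  then show ?case by blast
qed

text \<open>Elements of the base have finite support, so finitely many of them lie in one
  \<open>supported S\<close>, and compactness yields a mean for the whole base. The base is
  normalised by the complement G, so the extension lemma adds the translations by G.\<close>

theorem wreath_amenable:
  assumes L: "left_invariant_mean L mL" and G: "left_invariant_mean G mG"
  shows "\<exists>m. left_invariant_mean \<Gamma> m"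
proof -
  interpret W: group \<Gamma> by (rule wreath_group)
  have "\<exists>m. invariant_mean \<Gamma> base_copy m"
  proof (rule W.invariant_mean_directed[OF base_copy_subset])
    fix F assume F: "finite F" "F \<subseteq> base_copy"
    define S where "S = (\<Union>p\<in>F. {i \<in> carrier G. fst p i \<noteq> \<one>\<^bsub>L\<^esub>})"
    have "finite S" using F by (auto simp: S_def base_copy_def base_iff)
    moreover have "S \<subseteq> carrier G" by (auto simp: S_def)
    ultimately obtain m where m: "invariant_mean \<Gamma> (supported S) m" using supported_mean[OF L] by blast
    have "F \<subseteq> supported S" using F by (force simp: supported_def S_def base_copy_def)
    then show "\<exists>m. invariant_mean \<Gamma> F m" using m by (auto simp: invariant_mean_def)
  qed
  then obtain m where m: "invariant_mean \<Gamma> base_copy m" by blast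
  define \<phi> :: "'g \<Rightarrow> ('g \<Rightarrow> 'l) \<times> 'g" where "\<phi> = (\<lambda>g. (\<one>\<^bsub>base\<^esub>, g))"
  have hom: "\<phi> \<in> hom G \<Gamma>"
    by (rule homI) (simp_all add: \<phi>_def wreath_carrier base_one_closed complement_mult del: one_sum_group mult_sum_group)
  have \<phi>G: "\<phi> g \<in> carrier \<Gamma>" if "g \<in> carrier G" for g using hom that by (auto simp: hom_def)
  obtain m' where m': "invariant_mean \<Gamma> (base_copy \<union> \<phi> ` carrier G) m'"
    using W.invariant_mean_extend[OF G.is_group hom G m base_copy_subset base_copy_normal[OF _ \<phi>G]] by blast
  have sub: "base_copy \<union> \<phi> ` carrier G \<subseteq> carrier \<Gamma>" using base_copy_subset \<phi>G by auto
  have "m' (\<lambda>x. u (p \<otimes>\<^bsub>\<Gamma>\<^esub> x)) = m' u" if p: "p \<in> carrier \<Gamma>" and u: "bounded (u ` carrier \<Gamma>)" for p u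
  proof -
    obtain x g where xg: "p = (x, g)" "x \<in> carrier base" "g \<in> carrier G" using p by (auto simp: wreath_carrier)
    have p': "p = (x, \<one>\<^bsub>G\<^esub>) \<otimes>\<^bsub>\<Gamma>\<^esub> \<phi> g" by (simp only: \<phi>_def wreath_split[OF xg(2,3)] xg(1))
    show ?thesis
      unfolding p' using xg by (intro W.invariant_mean_mult[OF m' sub _ _ u]) (auto simp: base_copy_def)
  qed
  then show ?thesis using m' by (auto simp: left_invariant_mean_iff invariant_mean_def)
qed

end

theorem proposition3p20:
  fixes n :: nat and \<omega> :: "nat \<times> nat" and \<Lambda> :: "'l monoid"
  defines "G \<equiv> houghton_group n"
  defines "H \<equiv> stabilizer G (\<lambda>\<sigma>. \<sigma>) \<omega>"
  defines "\<Gamma> \<equiv> wreath \<Lambda> G"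
  defines "M \<equiv> group_vn \<Gamma>"
  defines "N \<equiv> subgroup_vn \<Gamma> (carrier (partial_wreath \<Lambda> G H))"
  assumes "n \<ge> 1" and "\<omega> \<in> Omega n"
    and "icc_group \<Lambda>" and "amenable_group \<Lambda>"
  shows "vn_factor (carrier \<Gamma>) N \<and> amenable_vn (carrier \<Gamma>) N \<and>
         vn_factor (carrier \<Gamma>) M \<and> amenable_vn (carrier \<Gamma>) M \<and>
         N \<subseteq> M \<and> jones_index (carrier \<Gamma>) M N = \<infinity> \<and>
         maximal_vn_subalgebra (carrier \<Gamma>) N M"
proof -
  have gG: "group G" unfolding G_def by (rule houghton_group)
  have g\<Lambda>: "group \<Lambda>" using assms(8) by (simp add: icc_group_def)
  interpret wreath_product \<Lambda> G using gG g\<Lambda> by (simp add: wreath_product_def)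
  interpret W: group \<Gamma> unfolding \<Gamma>_def by (rule wreath_group)
  have Hs: "subgroup H G" unfolding H_def G_def by (rule houghton_stabilizer_subgroup)
  define K where "K = carrier base \<times> H"
  have N: "N = subgroup_vn \<Gamma> K" by (simp only: N_def K_def partial_wreath_carrier)
  have M: "M = subgroup_vn \<Gamma> (carrier \<Gamma>)" by (simp only: M_def group_vn_def)
  have K: "subgroup K \<Gamma>" unfolding K_def \<Gamma>_def by (rule partial_wreath_subgroup[OF Hs])
  have AK: "base_copy \<subseteq> K" using subgroup.one_closed[OF Hs] by (auto simp: base_copy_def K_def)
  have icc: "W.rel_icc base_copy" unfolding \<Gamma>_def by (rule wreath_rel_icc[OF assms(8)])
  obtain m\<Lambda> where m\<Lambda>: "left_invariant_mean \<Lambda> m\<Lambda>" using assms(9) by (auto simp: amenable_group_def)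
  obtain mG where mG: "left_invariant_mean G mG" unfolding G_def using houghton_amenable by blast
  obtain m where m: "left_invariant_mean \<Gamma> m"
    unfolding \<Gamma>_def using wreath_amenable[OF m\<Lambda> mG] by blast
  have max: "maximal_vn_subalgebra (carrier \<Gamma>) N M"
    unfolding N M_def
  proof (rule W.subgroup_vn_maximal[OF K AK icc])
    show "inv\<^bsub>\<Gamma>\<^esub> a \<in> base_copy" if "a \<in> base_copy" for a using base_copy_inv_closed[OF that] by (simp only: \<Gamma>_def)
    show "inv\<^bsub>\<Gamma>\<^esub> g \<otimes>\<^bsub>\<Gamma>\<^esub> a \<otimes>\<^bsub>\<Gamma>\<^esub> g \<in> base_copy" if "a \<in> base_copy" "g \<in> carrier \<Gamma>" for a g
      using base_copy_normal that by (simp only: \<Gamma>_def)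
    show "L = K \<or> L = carrier \<Gamma>" if "subgroup L \<Gamma>" "K \<subseteq> L" for L
      using that unfolding K_def \<Gamma>_def
    proof (intro partial_wreath_maximal[OF Hs])
      show "L = H \<or> L = carrier G" if "subgroup L G" "H \<subseteq> L" for L
        using houghton_stabilizer_maximal[OF _ _ assms(7)] that unfolding H_def G_def by blast
    qed
  qed
  obtain \<gamma> :: "nat \<Rightarrow> nat \<times> nat \<Rightarrow> nat \<times> nat" where \<gamma>: "\<And>i. \<gamma> i \<in> carrier G"
    and sep: "\<And>i j. i \<noteq> j \<Longrightarrow> \<gamma> i \<otimes>\<^bsub>G\<^esub> inv\<^bsub>G\<^esub> \<gamma> j \<notin> H"
    unfolding G_def H_def by (rule houghton_stabilizer_cosets[OF assms(6,7)]) blast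
  \<comment> \<open>Representatives are lifted to the complement, where products and inverses are
    those of G; membership of a quotient in K then tests its component in G against H.\<close>
  have "jones_index (carrier \<Gamma>) M N = \<infinity>"
    unfolding M_def N
  proof (rule W.jones_index_infinite[OF K])
    show "(\<one>\<^bsub>base\<^esub>, \<gamma> i) \<in> carrier \<Gamma>" for i
      unfolding \<Gamma>_def wreath_carrier using base_one_closed \<gamma> by blast
    show "(\<one>\<^bsub>base\<^esub>, \<gamma> i) \<otimes>\<^bsub>\<Gamma>\<^esub> inv\<^bsub>\<Gamma>\<^esub> (\<one>\<^bsub>base\<^esub>, \<gamma> j) \<notin> K" if "i \<noteq> j" for i j
      unfolding \<Gamma>_def complement_inv[OF \<gamma>] complement_mult[OF \<gamma> G.inv_closed[OF \<gamma>]] K_def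
      using sep[OF that] by blast
  qed
  moreover have "N \<subseteq> M" using max by (simp add: maximal_vn_subalgebra_def)
  moreover have "vn_factor (carrier \<Gamma>) N" unfolding N by (rule W.subgroup_vn_factor[OF K AK icc])
  moreover have "vn_factor (carrier \<Gamma>) M"
    unfolding M by (rule W.subgroup_vn_factor[OF W.subgroup_self _ icc]) (simp add: \<Gamma>_def base_copy_subset)
  moreover have "amenable_vn (carrier \<Gamma>) N" unfolding N by (rule W.subgroup_vn_amenable[OF m K])
  moreover have "amenable_vn (carrier \<Gamma>) M" unfolding M by (rule W.subgroup_vn_amenable[OF m W.subgroup_self])
  ultimately show ?thesis using max by blast
qed

end
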